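(* Let $\mathsf{F}$ be a species such that its cycle index series $Z_{\mathsf{F}}$ is a D-finite symmetric series, and write $p_n=x_1^n+x_2^n+\cdots$. Then all of the following series are D-finite with respect to $t$: (1) the exponential generating function $\mathsf{F}(t)=\sum_{n\ge 0}|\mathsf{F}[\{1,\dots,n\}]|\,\frac{t^n}{n!}$; (2) the ordinary generating function $\widetilde{\mathsf{F}}(t)=\sum_{n\ge0}\operatorname{Orb}(\mathsf{F}[\{1,\dots,n\}])\,t^n$, provided additionally that $Z_{\mathsf{F}}(p_1,p_2,\ldots)$, viewed as a series in the variables $x_1,x_2,\ldots$ through $p_n=\sum_i x_i^n$, is D-finite with respect to the $x_i$; (3) for each fixed nonnegative integer $k$, the series $\sum_{n\ge0}\left([x_1^k\cdots x_n^k]Z_{\mathsf{F}}\right)\frac{t^n}{n!}$; (4) for any finite set $S\subset\mathbb{N}$, the series $\sum_{n\ge0}\sum_{(k_1,\dots,k_n)\in S^n}\left([x_1^{k_1}x_2^{k_2}\cdots x_n^{k_n}]Z_{\mathsf{F}}\right)\frac{t^n}{n!}$.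
   Context: A species $\mathsf{F}$ assigns to each finite set $U$ a finite set $\mathsf{F}[U]$ of structures and to each bijection $\sigma:U\to V$ a bijection $\mathsf{F}[\sigma]:\mathsf{F}[U]\to\mathsf{F}[V]$, functorially (compatible with composition and identities). $\operatorname{Orb}(\mathsf{F}[\{1,\dots,n\}])$ denotes the number of orbits of $\mathsf{F}[\{1,\dots,n\}]$ under the action of the symmetric group $S_n$ via $\sigma\mapsto\mathsf{F}[\sigma]$ (structures up to relabelling). The variables $x_1,x_2,\ldots$ are commuting indeterminates over a field $K$ of characteristic $0$ and $p_n=\sum_i x_i^n$ are the power sums; for a partition $\lambda=1^{m_1}2^{m_2}\cdots k^{m_k}$ (with $m_i$ parts equal to $i$) write $p_\lambda=p_1^{m_1}\cdots p_k^{m_k}$ and $z_\lambda=1^{m_1}m_1!\cdots k^{m_k}m_k!$. The cycle index series is $Z_{\mathsf{F}}=\sum_{n\ge0}\sum_{\lambda\vdash n}\operatorname{Fix}\mathsf{F}[\lambda]\,\frac{p_\lambda}{z_\lambda}$, where $\operatorname{Fix}\mathsf{F}[\lambda]$ is the number of structures in $\mathsf{F}[\{1,\dots,n\}]$ fixed by $\mathsf{F}[\sigma]$ for a permutation $\sigma$ of cycle type $\lambda$. A series in finitely many variables $y_1,\dots,y_m$ is D-finite if the span over $K(y_1,\dots,y_m)$ of all its iterated partial derivatives is finite-dimensional. A series in infinitely many variables is D-finite in those variables if, for every finite subset of the variables, setting all other variables to $0$ yields a D-finite series in the remaining finitely many variables. A symmetric series is called D-finite if it is D-finite as a series in the (algebraically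 independent) variables $p_1,p_2,\ldots$. $[x^\alpha]G$ denotes the coefficient of the monomial $x^\alpha$ in $G$. *)

theory Defs
  imports
    "HOL-Library.Poly_Mapping"
    "HOL-Library.FuncSet"
    "HOL-Computational_Algebra.Fraction_Field"
    "HOL-Computational_Algebra.Formal_Power_Series"
    "HOL-Combinatorics.Orbits"
    "HOL-Algebra.Sym_Groups"
    "HOL-Algebra.Group_Action"
begin

section \<open>Formal power series in variables indexed by the natural numbers\<close>

typedef 'a mps = "UNIV :: ((nat \<Rightarrow>\<^sub>0 nat) \<Rightarrow> 'a) set"
  morphisms mps_coeff Abs_mps ..

setup_lifting type_definition_mps

lemma mps_eqI: "(\<And>m. mps_coeff f m = mps_coeff g m) \<Longrightarrow> f = g"
  by transfer auto

lemma mps_coeff_Abs [simp]: "mps_coeff (Abs_mps c) = c"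
  by (simp add: Abs_mps_inverse)

definition splits :: "(nat \<Rightarrow>\<^sub>0 nat) \<Rightarrow> ((nat \<Rightarrow>\<^sub>0 nat) \<times> (nat \<Rightarrow>\<^sub>0 nat)) set"
  where "splits m = {(a, b). a + b = m}"

lemma finite_bounded_keys:
  assumes "finite V"
  shows "finite {a :: nat \<Rightarrow>\<^sub>0 nat. Poly_Mapping.keys a \<subseteq> V \<and> (\<forall>i. Poly_Mapping.lookup a i \<le> d i)}"
proof (rule inj_on_finite[where f = "\<lambda>a. restrict (Poly_Mapping.lookup a) V"
      and B = "PiE V (\<lambda>i. {..d i})"])
  let ?A = "{a :: nat \<Rightarrow>\<^sub>0 nat. Poly_Mapping.keys a \<subseteq> V \<and> (\<forall>i. Poly_Mapping.lookup a i \<le> d i)}"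
  show "inj_on (\<lambda>a. restrict (Poly_Mapping.lookup a) V) ?A"
  proof (rule inj_onI)
    fix a b assume ab: "a \<in> ?A" "b \<in> ?A"
      and eq: "restrict (Poly_Mapping.lookup a) V = restrict (Poly_Mapping.lookup b) V"
    show "a = b"
    proof (rule poly_mapping_eqI)
      fix i
      show "Poly_Mapping.lookup a i = Poly_Mapping.lookup b i"
      proof (cases "i \<in> V")
        case True
        then show ?thesis using fun_cong[OF eq, of i] by simp
      next
        case False
        then have "i \<notin> Poly_Mapping.keys a" "i \<notin> Poly_Mapping.keys b" using ab by auto
        then show ?thesis by (simp add: not_in_keys_iff_lookup_eq_zero)
      qed
    qed
  qed
  show "(\<lambda>a. restrict (Poly_Mapping.lookup a) V) ` ?A \<subseteq> PiE V (\<lambda>i. {..d i})"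
    by auto
  show "finite (PiE V (\<lambda>i. {..d i}))"
    using assms by (intro finite_PiE) auto
qed

lemma keys_add_nat:
  "Poly_Mapping.keys (a + b :: nat \<Rightarrow>\<^sub>0 nat) = Poly_Mapping.keys a \<union> Poly_Mapping.keys b"
  by (auto simp: set_eq_iff in_keys_iff lookup_add simp del: lookup_not_eq_zero_eq_in_keys)

lemma finite_splits [simp]: "finite (splits m)"
proof -
  let ?B = "{a :: nat \<Rightarrow>\<^sub>0 nat. Poly_Mapping.keys a \<subseteq> Poly_Mapping.keys m
      \<and> (\<forall>i. Poly_Mapping.lookup a i \<le> Poly_Mapping.lookup m i)}"
  have "splits m \<subseteq> ?B \<times> ?B"
    by (auto simp: splits_def lookup_add keys_add_nat)
  then show ?thesis
    by (rule finite_subset)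
      (intro finite_cartesian_product finite_bounded_keys[OF finite_keys])
qed

instantiation mps :: (comm_ring_1) comm_ring_1
begin

definition "0 = Abs_mps (\<lambda>_. 0)"
definition "1 = Abs_mps (\<lambda>m. if m = 0 then 1 else 0)"
definition "f + g = Abs_mps (\<lambda>m. mps_coeff f m + mps_coeff g m)"
definition "f - g = Abs_mps (\<lambda>m. mps_coeff f m - mps_coeff g m)"
definition "- f = Abs_mps (\<lambda>m. - mps_coeff f m)"
definition "f * g = Abs_mps (\<lambda>m. \<Sum>(a, b)\<in>splits m. mps_coeff f a * mps_coeff g b)"

instance
proof
  fix f g h :: "'a mps"
  show "f + g + h = f + (g + h)" "f + g = g + f" "0 + f = f" "- f + f = 0" "f - g = f + - g"
    by (rule mps_eqI; simp add: plus_mps_def zero_mps_def minus_mps_def uminus_mps_def ac_simps)+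
  show "f * g * h = f * (g * h)"
  proof (rule mps_eqI)
    fix m
    let ?f = "mps_coeff f" and ?g = "mps_coeff g" and ?h = "mps_coeff h"
    have "mps_coeff (f * g * h) m
        = (\<Sum>(d, c)\<in>splits m. \<Sum>(a, b)\<in>splits d. ?f a * ?g b * ?h c)"
      by (simp add: times_mps_def sum_distrib_right case_prod_unfold)
    also have "\<dots> = (\<Sum>((d, c), (a, b))\<in>(SIGMA p:splits m. splits (fst p)). ?f a * ?g b * ?h c)"
      by (subst sum.Sigma[symmetric]) (auto simp: case_prod_unfold)
    also have "\<dots> = (\<Sum>((a, d), (b, c))\<in>(SIGMA p:splits m. splits (snd p)). ?f a * (?g b * ?h c))"
      by (rule sum.reindex_bij_witness[where
            i = "\<lambda>((a, d), (b, c)). ((a + b, c), (a, b))" and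
            j = "\<lambda>((d, c), (a, b)). ((a, b + c), (b, c))"])
        (auto simp: splits_def ac_simps)
    also have "\<dots> = (\<Sum>(a, d)\<in>splits m. \<Sum>(b, c)\<in>splits d. ?f a * (?g b * ?h c))"
      by (subst sum.Sigma[symmetric]) (auto simp: case_prod_unfold)
    also have "\<dots> = mps_coeff (f * (g * h)) m"
      by (simp add: times_mps_def sum_distrib_left case_prod_unfold)
    finally show "mps_coeff (f * g * h) m = mps_coeff (f * (g * h)) m" .
  qed
  show "f * g = g * f"
  proof (rule mps_eqI)
    fix m
    show "mps_coeff (f * g) m = mps_coeff (g * f) m"
      unfolding times_mps_def mps_coeff_Abs
      by (rule sum.reindex_bij_witness[where i = prod.swap and j = prod.swap])
        (auto simp: splits_def ac_simps)
  qed
  show "1 * f = f"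
  proof (rule mps_eqI)
    fix m
    have "mps_coeff (1 * f) m
        = (\<Sum>(a, b)\<in>splits m. if a = 0 then mps_coeff f b else 0)"
      by (simp add: times_mps_def one_mps_def if_distrib[of "\<lambda>x. x * _"] cong: if_cong)
    also have "\<dots> = (\<Sum>(a, b)\<in>{(0 :: nat \<Rightarrow>\<^sub>0 nat, m)}. if a = 0 then mps_coeff f b else 0)"
      by (rule sum.mono_neutral_right) (use finite_splits[of m] in \<open>auto simp: splits_def split: if_splits\<close>)
    finally show "mps_coeff (1 * f) m = mps_coeff f m" by simp
  qed
  show "(f + g) * h = f * h + g * h"
    by (rule mps_eqI)
      (simp add: times_mps_def plus_mps_def distrib_right sum.distrib case_prod_unfold)
  show "(0 :: 'a mps) \<noteq> 1"
  proof
    assume "(0 :: 'a mps) = 1"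
    then have "mps_coeff (0 :: 'a mps) 0 = mps_coeff 1 0" by simp
    then show False by (simp add: zero_mps_def one_mps_def)
  qed
qed

end

definition total_degree :: "(nat \<Rightarrow>\<^sub>0 nat) \<Rightarrow> nat"
  where "total_degree m = (\<Sum>i\<in>Poly_Mapping.keys m. Poly_Mapping.lookup m i)"

lemma total_degree_superset:
  assumes "finite V" "Poly_Mapping.keys m \<subseteq> V"
  shows "total_degree m = (\<Sum>i\<in>V. Poly_Mapping.lookup m i)"
  unfolding total_degree_def
  by (rule sum.mono_neutral_left) (use assms in \<open>auto simp: not_in_keys_iff_lookup_eq_zero\<close>)

lemma total_degree_add: "total_degree (a + b) = total_degree a + total_degree b"
  using total_degree_superset[of "Poly_Mapping.keys (a + b)"]
  by (simp add: keys_add_nat lookup_add sum.distrib)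

lemma lookup_le_total_degree: "Poly_Mapping.lookup m i \<le> total_degree m"
  by (cases "i \<in> Poly_Mapping.keys m")
    (auto simp: total_degree_def not_in_keys_iff_lookup_eq_zero intro!: member_le_sum)

lemma mps_least_monomial:
  fixes f :: "'a :: comm_ring_1 mps"
  assumes V: "finite V" and ex: "\<exists>a. Poly_Mapping.keys a \<subseteq> V \<and> mps_coeff f a \<noteq> 0"
  obtains a where "Poly_Mapping.keys a \<subseteq> V" "mps_coeff f a \<noteq> 0"
    "\<And>b. Poly_Mapping.keys b \<subseteq> V \<Longrightarrow> mps_coeff f b \<noteq> 0 \<Longrightarrow> total_degree a \<le> total_degree b"
    "\<And>b. Poly_Mapping.keys b \<subseteq> V \<Longrightarrow> mps_coeff f b \<noteq> 0 \<Longrightarrow> total_degree b = total_degree a \<Longrightarrow> a \<le> b"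
proof -
  define A where "A = {a. Poly_Mapping.keys a \<subseteq> V \<and> mps_coeff f a \<noteq> 0}"
  define d where "d = (LEAST d. d \<in> total_degree ` A)"
  have "A \<noteq> {}" using ex by (auto simp: A_def)
  then have d: "d \<in> total_degree ` A"
    unfolding d_def by (metis LeastI_ex ex_in_conv imageI)
  have d_le: "d \<le> total_degree b" if "b \<in> A" for b
    unfolding d_def using that by (intro Least_le) auto
  define B where "B = {a \<in> A. total_degree a = d}"
  have "B \<subseteq> {a. Poly_Mapping.keys a \<subseteq> V \<and> (\<forall>i. Poly_Mapping.lookup a i \<le> d)}"
    using lookup_le_total_degree by (auto simp: B_def A_def)
  then have fB: "finite B"
    by (rule finite_subset) (rule finite_bounded_keys[OF V])
  have neB: "B \<noteq> {}" using d by (auto simp: B_def)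
  have mB: "Min B \<in> B" using fB neB by (rule Min_in)
  show thesis
  proof (rule that[of "Min B"])
    show "Poly_Mapping.keys (Min B) \<subseteq> V" "mps_coeff f (Min B) \<noteq> 0"
      using mB by (auto simp: B_def A_def)
    fix b assume b: "Poly_Mapping.keys b \<subseteq> V" "mps_coeff f b \<noteq> 0"
    show "total_degree (Min B) \<le> total_degree b"
      using mB d_le[of b] b by (auto simp: B_def A_def)
    assume "total_degree b = total_degree (Min B)"
    then have "b \<in> B" using mB b by (auto simp: B_def A_def)
    then show "Min B \<le> b" using fB by simp
  qed
qed

instance mps :: (idom) idom
proof
  fix f g :: "'a mps"
  assume "f \<noteq> 0" "g \<noteq> 0"
  then obtain a0 b0 where ab0: "mps_coeff f a0 \<noteq> 0" "mps_coeff g b0 \<noteq> 0"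
    by (metis mps_eqI mps_coeff_Abs zero_mps_def)
  define V where "V = Poly_Mapping.keys a0 \<union> Poly_Mapping.keys b0"
  have V: "finite V" by (simp add: V_def)
  obtain a where a: "Poly_Mapping.keys a \<subseteq> V" "mps_coeff f a \<noteq> 0"
    "\<And>b. Poly_Mapping.keys b \<subseteq> V \<Longrightarrow> mps_coeff f b \<noteq> 0 \<Longrightarrow> total_degree a \<le> total_degree b"
    "\<And>b. Poly_Mapping.keys b \<subseteq> V \<Longrightarrow> mps_coeff f b \<noteq> 0 \<Longrightarrow> total_degree b = total_degree a \<Longrightarrow> a \<le> b"
    using mps_least_monomial[OF V, of f] ab0 by (metis V_def sup_ge1)
  obtain b where b: "Poly_Mapping.keys b \<subseteq> V" "mps_coeff g b \<noteq> 0"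
    "\<And>c. Poly_Mapping.keys c \<subseteq> V \<Longrightarrow> mps_coeff g c \<noteq> 0 \<Longrightarrow> total_degree b \<le> total_degree c"
    "\<And>c. Poly_Mapping.keys c \<subseteq> V \<Longrightarrow> mps_coeff g c \<noteq> 0 \<Longrightarrow> total_degree c = total_degree b \<Longrightarrow> b \<le> c"
    using mps_least_monomial[OF V, of g] ab0 by (metis V_def sup_ge2)
  have uniq: "c = a \<and> d = b"
    if cd: "c + d = a + b" and nz: "mps_coeff f c \<noteq> 0" "mps_coeff g d \<noteq> 0" for c d
  proof -
    have "Poly_Mapping.keys c \<union> Poly_Mapping.keys d \<subseteq> V"
      using a(1) b(1) cd by (metis Un_subset_iff keys_add_nat)
    then have k: "Poly_Mapping.keys c \<subseteq> V" "Poly_Mapping.keys d \<subseteq> V" by auto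
    have "total_degree c + total_degree d = total_degree a + total_degree b"
      using cd by (metis total_degree_add)
    moreover have "total_degree a \<le> total_degree c" "total_degree b \<le> total_degree d"
      using a(3) b(3) k nz by auto
    ultimately have "total_degree c = total_degree a" "total_degree d = total_degree b"
      by auto
    then have le: "a \<le> c" "b \<le> d" using a(4) b(4) k nz by auto
    have "c = a"
    proof (rule ccontr)
      assume "c \<noteq> a"
      then have "a + b < c + d" using le by (intro add_less_le_mono) auto
      then show False using cd by simp
    qed
    then show ?thesis using cd by simp
  qed
  have "mps_coeff (f * g) (a + b)
      = (\<Sum>(c, d)\<in>splits (a + b). mps_coeff f c * mps_coeff g d)"
    by (simp add: times_mps_def)
  also have "\<dots> = (\<Sum>(c, d)\<in>{(a, b)}. mps_coeff f c * mps_coeff g d)"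
    by (rule sum.mono_neutral_right) (use uniq finite_splits[of "a + b"] in \<open>auto simp: splits_def\<close>)
  finally have "mps_coeff (f * g) (a + b) \<noteq> 0" using a(2) b(2) by simp
  then show "f * g \<noteq> 0" by (auto simp: zero_mps_def)
qed

definition pderiv_mps :: "nat \<Rightarrow> 'a :: comm_ring_1 mps \<Rightarrow> 'a mps"
  where "pderiv_mps i f = Abs_mps (\<lambda>m.
    of_nat (Poly_Mapping.lookup m i + 1) * mps_coeff f (m + Poly_Mapping.single i 1))"

definition set_other_vars_zero :: "nat set \<Rightarrow> 'a :: comm_ring_1 mps \<Rightarrow> 'a mps"
  where "set_other_vars_zero V f =
    Abs_mps (\<lambda>m. if Poly_Mapping.keys m \<subseteq> V then mps_coeff f m else 0)"

section \<open>D-finiteness\<close>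

inductive_set iterated_pderivs :: "nat set \<Rightarrow> 'a :: comm_ring_1 mps \<Rightarrow> 'a mps set"
  for V :: "nat set" and f :: "'a mps"
  where
    base: "f \<in> iterated_pderivs V f"
  | step: "g \<in> iterated_pderivs V f \<Longrightarrow> i \<in> V \<Longrightarrow> pderiv_mps i g \<in> iterated_pderivs V f"

definition polys_in :: "nat set \<Rightarrow> 'a :: comm_ring_1 mps set"
  where "polys_in V = {p. finite {m. mps_coeff p m \<noteq> 0}
    \<and> (\<forall>m. mps_coeff p m \<noteq> 0 \<longrightarrow> Poly_Mapping.keys m \<subseteq> V)}"

text \<open>The field of rational functions in the variables \<open>V\<close>, as a subfield of the field of
  fractions of the ring of power series.\<close>

definition ratfuns_in :: "nat set \<Rightarrow> 'a :: field mps fract set"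
  where "ratfuns_in V = {Fraction_Field.Fract p q | p q. p \<in> polys_in V \<and> q \<in> polys_in V \<and> q \<noteq> 0}"

definition span_over :: "'b :: field set \<Rightarrow> 'b set \<Rightarrow> 'b set"
  where "span_over K D = {(\<Sum>v\<in>T. c v * v) | T c. finite T \<and> T \<subseteq> D \<and> c ` T \<subseteq> K}"

definition finite_dimensional_over :: "'b :: field set \<Rightarrow> 'b set \<Rightarrow> bool"
  where "finite_dimensional_over K W \<longleftrightarrow> (\<exists>B. finite B \<and> span_over K B = W)"

text \<open>\<open>D_finite_fin\<close> is meant for a finite set \<open>V\<close> and a series involving only the variables
  in \<open>V\<close>; \<open>D_finite\<close> is meant for a possibly infinite set \<open>X\<close> of variables.\<close>

definition D_finite_fin :: "nat set \<Rightarrow> 'a :: field mps \<Rightarrow> bool"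
  where "D_finite_fin V f \<longleftrightarrow> finite_dimensional_over (ratfuns_in V)
    (span_over (ratfuns_in V) ((\<lambda>g. Fraction_Field.Fract g 1) ` iterated_pderivs V f))"

definition D_finite :: "nat set \<Rightarrow> 'a :: field mps \<Rightarrow> bool"
  where "D_finite X f \<longleftrightarrow>
    (\<forall>V. finite V \<and> V \<subseteq> X \<longrightarrow> D_finite_fin V (set_other_vars_zero V f))"

text \<open>A univariate series is regarded as a series in the single variable with index 0.\<close>

definition mps_of_fps :: "'a :: comm_ring_1 fps \<Rightarrow> 'a mps"
  where "mps_of_fps F = Abs_mps (\<lambda>m.
    if Poly_Mapping.keys m \<subseteq> {0} then fps_nth F (Poly_Mapping.lookup m 0) else 0)"

definition D_finite_fps :: "'a :: field fps \<Rightarrow> bool"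
  where "D_finite_fps F \<longleftrightarrow> D_finite_fin {0} (mps_of_fps F)"

section \<open>Species\<close>

text \<open>Finite sets of labels are finite sets of natural numbers. \<open>transport U \<sigma>\<close> is the map induced
  by the bijection that \<open>\<sigma>\<close> defines on \<open>U\<close>, whose target is \<open>\<sigma> ` U\<close>; since functions in HOL are
  total, independence of the values of \<open>\<sigma>\<close> outside \<open>U\<close> is part of the axioms.\<close>

locale species =
  fixes structures :: "nat set \<Rightarrow> 's set"
    and transport :: "nat set \<Rightarrow> (nat \<Rightarrow> nat) \<Rightarrow> 's \<Rightarrow> 's"
  assumes finite_structures: "finite U \<Longrightarrow> finite (structures U)"
    and transport_bij: "finite U \<Longrightarrow> bij_betw \<sigma> U V \<Longrightarrow>
      bij_betw (transport U \<sigma>) (structures U) (structures V)"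
    and transport_cong: "finite U \<Longrightarrow> bij_betw \<sigma> U V \<Longrightarrow> (\<And>u. u \<in> U \<Longrightarrow> \<sigma> u = \<tau> u) \<Longrightarrow>
      s \<in> structures U \<Longrightarrow> transport U \<sigma> s = transport U \<tau> s"
    and transport_id: "finite U \<Longrightarrow> s \<in> structures U \<Longrightarrow> transport U id s = s"
    and transport_comp: "finite U \<Longrightarrow> bij_betw \<sigma> U V \<Longrightarrow> bij_betw \<tau> V W \<Longrightarrow>
      s \<in> structures U \<Longrightarrow> transport U (\<tau> \<circ> \<sigma>) s = transport V \<tau> (transport U \<sigma> s)"

definition Orb :: "(nat set \<Rightarrow> 's set) \<Rightarrow> (nat set \<Rightarrow> (nat \<Rightarrow> nat) \<Rightarrow> 's \<Rightarrow> 's) \<Rightarrow> nat \<Rightarrow> nat"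
  where "Orb structures transport n =
    card (orbits (sym_group n) (structures {1..n}) (transport {1..n}))"

section \<open>The cycle index series\<close>

text \<open>A partition with \<open>m\<^sub>i\<close> parts equal to \<open>i\<close> is represented by the finitely supported
  function \<open>m\<close> with \<open>m\<^sub>0 = 0\<close>; it is at the same time the exponent of the monomial \<open>p\<^sub>\<lambda>\<close>.\<close>

definition is_partition :: "(nat \<Rightarrow>\<^sub>0 nat) \<Rightarrow> bool"
  where "is_partition m \<longleftrightarrow> Poly_Mapping.lookup m 0 = 0"

definition partition_size :: "(nat \<Rightarrow>\<^sub>0 nat) \<Rightarrow> nat"
  where "partition_size m = (\<Sum>i\<in>Poly_Mapping.keys m. i * Poly_Mapping.lookup m i)"

definition zee :: "(nat \<Rightarrow>\<^sub>0 nat) \<Rightarrow> nat"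
  where "zee m = (\<Prod>i\<in>Poly_Mapping.keys m.
    i ^ Poly_Mapping.lookup m i * fact (Poly_Mapping.lookup m i))"

definition has_cycle_type :: "nat \<Rightarrow> (nat \<Rightarrow> nat) \<Rightarrow> (nat \<Rightarrow>\<^sub>0 nat) \<Rightarrow> bool"
  where "has_cycle_type n \<sigma> m \<longleftrightarrow> \<sigma> permutes {1..n} \<and>
    (\<forall>i. Poly_Mapping.lookup m i = card {C \<in> Orbits.orbit \<sigma> ` {1..n}. card C = i})"

definition Fix :: "(nat set \<Rightarrow> 's set) \<Rightarrow> (nat set \<Rightarrow> (nat \<Rightarrow> nat) \<Rightarrow> 's \<Rightarrow> 's) \<Rightarrow> (nat \<Rightarrow>\<^sub>0 nat) \<Rightarrow> nat"
  where "Fix structures transport m =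
    (let n = partition_size m; \<sigma> = (SOME \<sigma>. has_cycle_type n \<sigma> m)
     in card {s \<in> structures {1..n}. transport {1..n} \<sigma> s = s})"

text \<open>The series below is the cycle index series as a series in \<open>p\<^sub>1, p\<^sub>2, \<dots>\<close>, the variable with
  index \<open>i \<ge> 1\<close> being \<open>p\<^sub>i\<close>; the variable with index 0 does not occur.\<close>

definition cycle_index ::
    "(nat set \<Rightarrow> 's set) \<Rightarrow> (nat set \<Rightarrow> (nat \<Rightarrow> nat) \<Rightarrow> 's \<Rightarrow> 's) \<Rightarrow> 'a :: field_char_0 mps"
  where "cycle_index structures transport = Abs_mps (\<lambda>m.
    if is_partition m then of_nat (Fix structures transport m) / of_nat (zee m) else 0)"

text \<open>Series in \<open>x\<^sub>1, x\<^sub>2, \<dots>\<close> likewise use the indices \<open>i \<ge> 1\<close> only.\<close>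

definition power_sum :: "nat \<Rightarrow> 'a :: comm_ring_1 mps"
  where "power_sum n = Abs_mps (\<lambda>\<alpha>. if \<exists>i\<ge>1. \<alpha> = Poly_Mapping.single i n then 1 else 0)"

definition power_sum_monomial :: "(nat \<Rightarrow>\<^sub>0 nat) \<Rightarrow> 'a :: comm_ring_1 mps"
  where "power_sum_monomial m = (\<Prod>i\<in>Poly_Mapping.keys m. power_sum i ^ Poly_Mapping.lookup m i)"

text \<open>Substitution of the power sums into a series in \<open>p\<^sub>1, p\<^sub>2, \<dots>\<close>. The sum over all \<open>m\<close> is
  finite by the lemma that follows the definition, because \<open>p\<^sub>\<lambda>\<close> is homogeneous of degree
  \<open>|\<lambda>|\<close>.\<close>

definition in_x :: "'a :: comm_ring_1 mps \<Rightarrow> 'a mps"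
  where "in_x f = Abs_mps (\<lambda>\<alpha>. Sum_any (\<lambda>m. mps_coeff f m * mps_coeff (power_sum_monomial m) \<alpha>))"

definition homogeneous_mps :: "nat \<Rightarrow> 'a :: comm_ring_1 mps \<Rightarrow> bool"
  where "homogeneous_mps d f \<longleftrightarrow> (\<forall>m. mps_coeff f m \<noteq> 0 \<longrightarrow> total_degree m = d)"

lemma homogeneous_one: "homogeneous_mps 0 1"
  by (auto simp: homogeneous_mps_def one_mps_def total_degree_def)

lemma homogeneous_mult:
  assumes "homogeneous_mps d f" "homogeneous_mps e g"
  shows "homogeneous_mps (d + e) (f * g)"
  unfolding homogeneous_mps_def
proof (intro allI impI)
  fix m assume "mps_coeff (f * g) m \<noteq> 0"
  then have "(\<Sum>(a, b)\<in>splits m. mps_coeff f a * mps_coeff g b) \<noteq> 0"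
    by (simp add: times_mps_def)
  then obtain p where "p \<in> splits m" "(case p of (a, b) \<Rightarrow> mps_coeff f a * mps_coeff g b) \<noteq> 0"
    by (rule sum.not_neutral_contains_not_neutral)
  then obtain a b where "a + b = m" "mps_coeff f a * mps_coeff g b \<noteq> 0"
    by (cases p) (auto simp: splits_def)
  then have "a + b = m" "mps_coeff f a \<noteq> 0" "mps_coeff g b \<noteq> 0" by auto
  then show "total_degree m = d + e"
    using assms by (auto simp: homogeneous_mps_def total_degree_add)
qed

lemma homogeneous_power_sum: "homogeneous_mps n (power_sum n)"
  by (auto simp: homogeneous_mps_def power_sum_def total_degree_def split: if_splits)

lemma homogeneous_power:
  assumes "homogeneous_mps d f"
  shows "homogeneous_mps (d * k) (f ^ k)"
  by (induction k) (use assms in \<open>auto simp: homogeneous_one homogeneous_mult\<close>)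

lemma homogeneous_prod:
  assumes "\<And>i. i \<in> I \<Longrightarrow> homogeneous_mps (d i) (f i)"
  shows "homogeneous_mps (sum d I) (prod f I)"
  using assms
  by (induction I rule: infinite_finite_induct) (auto simp: homogeneous_one homogeneous_mult)

lemma homogeneous_power_sum_monomial:
  "homogeneous_mps (partition_size m) (power_sum_monomial m)"
  unfolding partition_size_def power_sum_monomial_def
  by (intro homogeneous_prod homogeneous_power homogeneous_power_sum)

lemma finite_partitions: "finite {m. is_partition m \<and> partition_size m = n}"
proof (rule finite_subset)
  show "finite {a :: nat \<Rightarrow>\<^sub>0 nat. Poly_Mapping.keys a \<subseteq> {1..n} \<and> (\<forall>i. Poly_Mapping.lookup a i \<le> n)}"
    by (rule finite_bounded_keys) simp
  show "{m. is_partition m \<and> partition_size m = n} \<subseteq>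
    {a. Poly_Mapping.keys a \<subseteq> {1..n} \<and> (\<forall>i. Poly_Mapping.lookup a i \<le> n)}"
  proof (rule subsetI)
    fix m :: "nat \<Rightarrow>\<^sub>0 nat"
    assume "m \<in> {m. is_partition m \<and> partition_size m = n}"
    then have m0: "Poly_Mapping.lookup m 0 = 0" and size: "partition_size m = n"
      by (auto simp: is_partition_def)
    have in_keys: "1 \<le> i \<and> i \<le> n \<and> Poly_Mapping.lookup m i \<le> n"
      if "i \<in> Poly_Mapping.keys m" for i
    proof -
      have le: "i * Poly_Mapping.lookup m i \<le> n"
        unfolding size[symmetric] partition_size_def using that by (intro member_le_sum) auto
      have "Poly_Mapping.lookup m i \<noteq> 0"
        using that unfolding in_keys_iff .
      moreover have "i \<noteq> 0"
        using \<open>Poly_Mapping.lookup m i \<noteq> 0\<close> m0 by metis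
      ultimately have "i \<le> i * Poly_Mapping.lookup m i"
        and "Poly_Mapping.lookup m i \<le> i * Poly_Mapping.lookup m i" by auto
      then show ?thesis using le \<open>i \<noteq> 0\<close> by linarith
    qed
    have "Poly_Mapping.lookup m i \<le> n" for i
      by (metis in_keys in_keys_iff le0)
    then show "m \<in> {a. Poly_Mapping.keys a \<subseteq> {1..n} \<and> (\<forall>i. Poly_Mapping.lookup a i \<le> n)}"
      using in_keys by auto
  qed
qed

lemma finite_support_in_x:
  assumes "\<And>m. mps_coeff f m \<noteq> 0 \<Longrightarrow> is_partition m"
  shows "finite {m. mps_coeff f m * mps_coeff (power_sum_monomial m) \<alpha> \<noteq> 0}"
proof (rule finite_subset[OF _ finite_partitions[of "total_degree \<alpha>"]])
  show "{m. mps_coeff f m * mps_coeff (power_sum_monomial m) \<alpha> \<noteq> 0}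
      \<subseteq> {m. is_partition m \<and> partition_size m = total_degree \<alpha>}"
  proof clarify
    fix m assume "mps_coeff f m * mps_coeff (power_sum_monomial m) \<alpha> \<noteq> 0"
    then have "mps_coeff f m \<noteq> 0" "mps_coeff (power_sum_monomial m :: 'a mps) \<alpha> \<noteq> 0"
      by auto
    then show "is_partition m \<and> partition_size m = total_degree \<alpha>"
      using assms homogeneous_power_sum_monomial[where 'a = 'a, of m]
      by (auto simp: homogeneous_mps_def)
  qed
qed

end

theory Submission
  imports Defs
begin

text \<open>All four series are instances of one construction. Let \<open>h\<^sub>k\<^sup>\<bottom>\<close> be the adjoint of multiplication by the
  complete homogeneous symmetric function \<open>h\<^sub>k\<close>, a differential operator in \<open>p\<^sub>1, \<dots>, p\<^sub>k\<close>. The coefficient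
  of \<open>x\<^sub>1\<^bsup>k\<^sub>1\<^esup> \<cdots> x\<^sub>n\<^bsup>k\<^sub>n\<^esup>\<close> in a symmetric series \<open>Z\<close> is the constant term of \<open>h\<^bsub>k\<^sub>1\<^esub>\<^sup>\<bottom> \<cdots> h\<^bsub>k\<^sub>n\<^esub>\<^sup>\<bottom> Z\<close>, so the series
  in (4) is the value at \<open>p = 0\<close> of \<open>F = exp (t g\<^sup>\<bottom>) Z\<close> with \<open>g = (\<Sum>k\<in>S. h\<^sub>k)\<close>, and only
  \<open>p\<^sub>1, \<dots>, p\<^sub>N\<close> with \<open>N = max S\<close> matter. (3) and (1) are the cases \<open>S = {k}\<close> and \<open>S = {1}\<close>; by Burnside's
  lemma (2) is the series \<open>Z(x\<^sub>1, 0, 0, \<dots>)\<close>, to which the case \<open>S = {1}\<close> applies again because \<open>exp (t \<partial>/\<partial>x\<^sub>1)\<close>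
  is a translation.

  That \<open>F\<close> at \<open>p = 0\<close> is D-finite follows as in Lipshitz's theorem on diagonals. Conjugation by \<open>exp (t g\<^sup>\<bottom>)\<close>
  turns \<open>t\<^sup>a p\<^sup>m \<partial>\<^sub>t\<^sup>b F\<close> into the result of applying polynomial differential operators to \<open>Z\<close>; up to order \<open>M\<close>
  these lie in a space of dimension \<open>O(M\<^bsup>N+1\<^esup>)\<close>, as \<open>Z\<close> is D-finite, while their number is of order
  \<open>M\<^bsup>N+2\<^esup>\<close>. The terms of least degree in \<open>p\<close> of a linear relation between them give a differential equation
  in \<open>t\<close> at \<open>p = 0\<close>.\<close>

section \<open>Power series arithmetic\<close>

text \<open>Replacing p_i by p_i + y^i adds one variable y to the alphabet, and h_k^perp takes the
  coefficient of y^k; therefore a word in these operators, followed by the constant term, reads off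
  a coefficient in the x_i. As the sum of the y^k h_k^perp is the translation exp (sum_i y^i
  d/dp_i), the commutator of h_k^perp with p_i is h_{k-i}^perp, again a polynomial in derivations.
  Hence p_i exp (t g^perp) = exp (t g^perp) (p_i - t c_i) with c_i = [g^perp, p_i], and d/dt turns
  into g^perp: each operator outside the exponential costs a bounded number of operators inside. The
  obstacle is the restriction to p = 0. Coefficients of a differential equation for F may all vanish
  there, and derivatives in p do not become derivatives of the restricted series. The relation
  sought therefore has constant coefficients and involves t, p_1, ..., p_N and d/dt, but no
  derivative in p. These are N + 2 generators, against the N + 1 variables t, p_1, ..., p_N of the
  numerators over a power of a common denominator; this is where the two exponents come
  from.\<close>

lemma mps_coeff_zero [simp]: "mps_coeff 0 m = 0"
  by (simp add: zero_mps_def)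

lemma mps_coeff_one: "mps_coeff 1 m = (if m = 0 then 1 else 0)"
  by (simp add: one_mps_def)

lemma mps_coeff_add [simp]: "mps_coeff (f + g) m = mps_coeff f m + mps_coeff g m"
  by (simp add: plus_mps_def)

lemma mps_coeff_diff [simp]: "mps_coeff (f - g) m = mps_coeff f m - mps_coeff g m"
  by (simp add: minus_mps_def)

lemma mps_coeff_sum [simp]: "mps_coeff (\<Sum>i\<in>A. f i) m = (\<Sum>i\<in>A. mps_coeff (f i) m)"
  by (induction A rule: infinite_finite_induct) auto

lemma mps_coeff_mult: "mps_coeff (f * g) m = (\<Sum>(a, b)\<in>splits m. mps_coeff f a * mps_coeff g b)"
  by (simp add: times_mps_def)

definition mps_const :: "'a \<Rightarrow> 'a :: comm_ring_1 mps"
  where "mps_const c = Abs_mps (\<lambda>m. if m = 0 then c else 0)"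

definition mps_monom :: "(nat \<Rightarrow>\<^sub>0 nat) \<Rightarrow> 'a :: comm_ring_1 mps"
  where "mps_monom m = Abs_mps (\<lambda>m'. if m' = m then 1 else 0)"

abbreviation mps_var :: "nat \<Rightarrow> 'a :: comm_ring_1 mps"
  where "mps_var i \<equiv> mps_monom (Poly_Mapping.single i (Suc 0))"

lemma mps_coeff_monom: "mps_coeff (mps_monom m) m' = (if m' = m then 1 else 0)"
  by (simp add: mps_monom_def)

lemma mps_coeff_monom_mult_add: "mps_coeff (mps_monom a * f) (a + b) = mps_coeff f b"
proof -
  have "mps_coeff (mps_monom a * f) (a + b)
      = (\<Sum>(c, d)\<in>splits (a + b). if c = a then mps_coeff f d else 0)"
    by (simp add: mps_coeff_mult mps_monom_def if_distrib[of "\<lambda>x. x * _"] cong: if_cong)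
  also have "\<dots> = (\<Sum>(c, d)\<in>{(a, b)}. if c = a then mps_coeff f d else 0)"
    by (rule sum.mono_neutral_right)
      (use finite_splits[of "a + b"] in \<open>auto simp: splits_def split: if_splits\<close>)
  finally show ?thesis by simp
qed

lemma mps_coeff_monom_mult_eq_0:
  assumes "\<And>b. m \<noteq> a + b"
  shows "mps_coeff (mps_monom a * f) m = 0"
  unfolding mps_coeff_mult
  by (rule sum.neutral) (use assms in \<open>auto simp: splits_def mps_coeff_monom\<close>)

lemma mps_coeff_const_mult [simp]: "mps_coeff (mps_const c * f) m = c * mps_coeff f m"
proof -
  have "mps_coeff (mps_const c * f) m
      = (\<Sum>(a, b)\<in>splits m. if a = 0 then c * mps_coeff f b else 0)"
    by (simp add: mps_coeff_mult mps_const_def if_distrib[of "\<lambda>x. x * _"] cong: if_cong)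
  also have "\<dots> = (\<Sum>(a, b)\<in>{(0 :: nat \<Rightarrow>\<^sub>0 nat, m)}. if a = 0 then c * mps_coeff f b else 0)"
    by (rule sum.mono_neutral_right) (use finite_splits[of m] in \<open>auto simp: splits_def split: if_splits\<close>)
  finally show ?thesis by simp
qed

lemma mps_monom_mult: "mps_monom a * mps_monom b = mps_monom (a + b)"
proof (rule mps_eqI)
  fix m
  show "mps_coeff (mps_monom a * mps_monom b) m = mps_coeff (mps_monom (a + b)) m"
  proof (cases "\<exists>c. m = a + c")
    case True
    then show ?thesis by (auto simp: mps_coeff_monom_mult_add mps_coeff_monom)
  next
    case False
    then show ?thesis by (auto simp: mps_coeff_monom_mult_eq_0 mps_coeff_monom)
  qed
qed

lemma mps_monom_0 [simp]: "mps_monom 0 = 1"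
  by (rule mps_eqI) (simp add: mps_coeff_monom mps_coeff_one)

lemma mps_const_0 [simp]: "mps_const 0 = 0" and mps_const_1 [simp]: "mps_const 1 = 1"
  by (rule mps_eqI; simp add: mps_const_def mps_coeff_one)+

lemma mps_const_add: "mps_const (c + d) = mps_const c + mps_const d"
  and mps_const_mult: "mps_const (c * d) = mps_const c * mps_const d"
  and mps_const_uminus: "mps_const (- c) = - mps_const c"
proof -
  show "mps_const (c + d) = mps_const c + mps_const d"
    by (rule mps_eqI) (simp add: mps_const_def)
  show "mps_const (c * d) = mps_const c * mps_const d"
    by (rule mps_eqI) (simp, simp add: mps_const_def)
  show "mps_const (- c) = - mps_const c"
    by (rule mps_eqI) (simp add: mps_const_def uminus_mps_def)
qed

lemma mps_const_of_nat: "mps_const (of_nat n) = of_nat n"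
  by (induction n) (simp_all add: mps_const_add)

lemma mps_coeff_of_nat_mult [simp]: "mps_coeff (of_nat n * f) m = of_nat n * mps_coeff f m"
  by (simp flip: mps_const_of_nat)

lemma vector_space_mps: "vector_space (\<lambda>c (f :: 'a :: field mps). mps_const c * f)"
  by unfold_locales
    (simp_all add: distrib_left distrib_right mps_const_add mps_const_mult mult.assoc)

text \<open>Monomials are built one variable at a time because all commutation rules below concern a
  single \<open>mps_var i\<close>.\<close>

lemma monom_nat_induct [case_names zero add]:
  fixes m :: "nat \<Rightarrow>\<^sub>0 nat"
  assumes "P 0" and "\<And>i m. P m \<Longrightarrow> P (Poly_Mapping.single i (Suc 0) + m)"
  shows "P m"
proof (induction "total_degree m" arbitrary: m)
  case 0
  then have "Poly_Mapping.lookup m i = 0" for i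
    using lookup_le_total_degree[of m i] by simp
  then have "m = 0" by (intro poly_mapping_eqI) simp
  then show ?case using assms(1) by simp
next
  case (Suc n)
  then have "m \<noteq> 0" by (auto simp: total_degree_def)
  then obtain i where i: "Poly_Mapping.lookup m i \<noteq> 0"
    by (metis lookup_zero poly_mapping_eqI)
  define m' where "m' = m - Poly_Mapping.single i 1"
  have m: "m = Poly_Mapping.single i 1 + m'"
    by (rule poly_mapping_eqI) (use i in \<open>auto simp: m'_def lookup_add lookup_minus lookup_single when_def\<close>)
  have "total_degree (Poly_Mapping.single i (1::nat)) = 1" by (simp add: total_degree_def)
  then have "n = total_degree m'"
    using Suc(2) m total_degree_add[of "Poly_Mapping.single i 1" m'] by simp
  then show ?case using Suc(1)[of m'] assms(2)[of m' i] m by simp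
qed

text \<open>Exponents are bounded one by one and not in total: a box has an exact cardinality, and
  what is lost against a simplex is a constant factor that the dimension count absorbs.\<close>

lemma card_bounded_keys:
  assumes "finite V"
  shows "card {a :: nat \<Rightarrow>\<^sub>0 nat. Poly_Mapping.keys a \<subseteq> V \<and> (\<forall>i. Poly_Mapping.lookup a i \<le> d)}
    = (d + 1) ^ card V"
proof -
  let ?A = "{a :: nat \<Rightarrow>\<^sub>0 nat. Poly_Mapping.keys a \<subseteq> V \<and> (\<forall>i. Poly_Mapping.lookup a i \<le> d)}"
  let ?B = "PiE V (\<lambda>_. {..d})"
  have "bij_betw (\<lambda>a. restrict (Poly_Mapping.lookup a) V) ?A ?B"
  proof (rule bij_betw_byWitness[where f' = "\<lambda>f. Abs_poly_mapping (\<lambda>i. if i \<in> V then f i else 0)"])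
    have fin: "finite {i. (if i \<in> V then f i else 0) \<noteq> (0::nat)}" for f
      by (rule finite_subset[OF _ assms]) auto
    have l: "Poly_Mapping.lookup (Abs_poly_mapping (\<lambda>i. if i \<in> V then f i else (0::nat)))
        = (\<lambda>i. if i \<in> V then f i else 0)" for f
      using fin[of f] by (subst lookup_Abs_poly_mapping) auto
    show "\<forall>a\<in>?A. Abs_poly_mapping (\<lambda>i. if i \<in> V then restrict (Poly_Mapping.lookup a) V i else 0) = a"
      by (auto intro!: poly_mapping_eqI simp: l not_in_keys_iff_lookup_eq_zero)
    show "\<forall>f\<in>?B. restrict (Poly_Mapping.lookup (Abs_poly_mapping (\<lambda>i. if i \<in> V then f i else 0))) V = f"
      by (auto simp: l fun_eq_iff PiE_def extensional_def)
    show "(\<lambda>a. restrict (Poly_Mapping.lookup a) V) ` ?A \<subseteq> ?B" by auto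
    show "(\<lambda>f. Abs_poly_mapping (\<lambda>i. if i \<in> V then f i else 0)) ` ?B \<subseteq> ?A"
      by (auto simp: l in_keys_iff split: if_splits simp del: lookup_not_eq_zero_eq_in_keys)
  qed
  then show ?thesis
    using card_PiE[OF assms, of "\<lambda>_. {..d}"] by (simp add: bij_betw_same_card)
qed

section \<open>Derivatives\<close>

lemma mps_coeff_pderiv: "mps_coeff (pderiv_mps i f) m =
    of_nat (Poly_Mapping.lookup m i + 1) * mps_coeff f (Poly_Mapping.single i 1 + m)"
  by (simp add: pderiv_mps_def add.commute)

lemma pderiv_mps_add: "pderiv_mps i (f + g) = pderiv_mps i f + pderiv_mps i g"
  by (rule mps_eqI) (simp add: mps_coeff_pderiv algebra_simps)

lemma pderiv_mps_0 [simp]: "pderiv_mps i 0 = 0"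
  by (rule mps_eqI) (simp add: mps_coeff_pderiv)

lemma pderiv_mps_sum: "pderiv_mps i (\<Sum>j\<in>A. f j) = (\<Sum>j\<in>A. pderiv_mps i (f j))"
  by (induction A rule: infinite_finite_induct) (simp_all add: pderiv_mps_add)

lemma pderiv_mps_const_mult: "pderiv_mps i (mps_const c * f) = mps_const c * pderiv_mps i f"
  by (rule mps_eqI) (simp add: mps_coeff_pderiv mult.left_commute)

lemma pderiv_mps_commute: "pderiv_mps i (pderiv_mps j f) = pderiv_mps j (pderiv_mps i f)"
  by (cases "i = j"; rule mps_eqI)
    (simp_all add: mps_coeff_pderiv lookup_add lookup_single when_def algebra_simps)

text \<open>The weight kills every splitting whose first half lacks variable \<open>i\<close>; the
  others arise from a splitting of \<open>m\<close> by adding \<open>e\<close> to the first half.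
  This is one half of the product rule.\<close>

lemma sum_splits_single:
  fixes f g :: "(nat \<Rightarrow>\<^sub>0 nat) \<Rightarrow> 'a :: comm_ring_1" and i :: nat
  defines "e \<equiv> Poly_Mapping.single i (1::nat)"
  shows "(\<Sum>(a, b)\<in>splits (e + m). of_nat (Poly_Mapping.lookup a i) * (f a * g b))
    = (\<Sum>(a, b)\<in>splits m. of_nat (Poly_Mapping.lookup a i + 1) * (f (e + a) * g b))"
proof -
  have "(\<Sum>(a, b)\<in>splits m. of_nat (Poly_Mapping.lookup a i + 1) * (f (e + a) * g b))
     = (\<Sum>(a, b)\<in>(\<lambda>(a, b). (e + a, b)) ` splits m. of_nat (Poly_Mapping.lookup a i) * (f a * g b))"
    by (subst sum.reindex)
      (auto simp: inj_on_def e_def case_prod_unfold lookup_add lookup_single algebra_simps intro!: sum.cong)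
  also have "\<dots> = (\<Sum>(a, b)\<in>splits (e + m). of_nat (Poly_Mapping.lookup a i) * (f a * g b))"
  proof (rule sum.mono_neutral_left)
    show "(\<lambda>(a, b). (e + a, b)) ` splits m \<subseteq> splits (e + m)"
      by (auto simp: splits_def ac_simps)
    show "\<forall>x\<in>splits (e + m) - (\<lambda>(a, b). (e + a, b)) ` splits m.
        (case x of (a, b) \<Rightarrow> of_nat (Poly_Mapping.lookup a i) * (f a * g b)) = 0"
    proof (safe, clarsimp)
      fix a b assume ab: "(a, b) \<in> splits (e + m)" "(a, b) \<notin> (\<lambda>(a, b). (e + a, b)) ` splits m"
      show "of_nat (Poly_Mapping.lookup a i) * (f a * g b) = 0"
      proof (cases "Poly_Mapping.lookup a i = 0")
        case False
        define a' where "a' = a - e"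
        have a: "a = e + a'"
          by (rule poly_mapping_eqI)
            (use False in \<open>auto simp: a'_def e_def lookup_add lookup_minus lookup_single when_def\<close>)
        then have "a' + b = m" using ab(1) by (simp add: splits_def add.assoc)
        then have "(a, b) \<in> (\<lambda>(a, b). (e + a, b)) ` splits m"
          by (auto simp: splits_def a intro!: image_eqI[of _ _ "(a', b)"])
        then show ?thesis using ab(2) by simp
      qed simp
    qed
  qed simp
  finally show ?thesis by simp
qed

lemma pderiv_mps_mult: "pderiv_mps i (f * g) = pderiv_mps i f * g + f * pderiv_mps i g"
proof (rule mps_eqI)
  fix m
  define e where "e = Poly_Mapping.single i (1::nat)"
  let ?f = "mps_coeff f" and ?g = "mps_coeff g" and ?l = "\<lambda>a. Poly_Mapping.lookup a i"
  have swap: "(\<Sum>(a, b)\<in>splits k. F a b) = (\<Sum>(b, a)\<in>splits k. F a b)"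
    for F :: "(nat \<Rightarrow>\<^sub>0 nat) \<Rightarrow> (nat \<Rightarrow>\<^sub>0 nat) \<Rightarrow> 'a" and k
    by (rule sum.reindex_bij_witness[where i = prod.swap and j = prod.swap])
      (auto simp: splits_def ac_simps)
  have "mps_coeff (pderiv_mps i (f * g)) m
      = (\<Sum>(a, b)\<in>splits (e + m). of_nat (?l m + 1) * (?f a * ?g b))"
    by (simp add: mps_coeff_pderiv mps_coeff_mult e_def sum_distrib_left case_prod_unfold)
  \<comment> \<open>The exponent of variable \<open>i\<close> in \<open>e + m\<close> is shared
    between the two factors. Each share is treated by \<open>sum_splits_single\<close>, the second
    one after a swap.\<close>
  also have "\<dots> = (\<Sum>(a, b)\<in>splits (e + m). of_nat (?l a) * (?f a * ?g b) + of_nat (?l b) * (?f a * ?g b))"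
  proof (rule sum.cong, simp, clarify)
    fix a b assume "(a, b) \<in> splits (e + m)"
    then have "?l (a + b) = ?l (e + m)" by (simp add: splits_def)
    then have "?l m + 1 = ?l a + ?l b" by (simp add: lookup_add e_def)
    then show "of_nat (?l m + 1) * (?f a * ?g b)
        = of_nat (?l a) * (?f a * ?g b) + of_nat (?l b) * (?f a * ?g b)"
      by (simp add: algebra_simps)
  qed
  also have "\<dots> = (\<Sum>(a, b)\<in>splits (e + m). of_nat (?l a) * (?f a * ?g b))
      + (\<Sum>(a, b)\<in>splits (e + m). of_nat (?l a) * (?g a * ?f b))"
  proof -
    have "(\<Sum>(a, b)\<in>splits (e + m). of_nat (?l b) * (?f a * ?g b))
        = (\<Sum>(a, b)\<in>splits (e + m). of_nat (?l a) * (?g a * ?f b))"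
      by (subst swap) (simp add: mult.commute)
    then show ?thesis by (simp add: sum.distrib case_prod_unfold)
  qed
  also have "\<dots> = (\<Sum>(a, b)\<in>splits m. of_nat (?l a + 1) * (?f (e + a) * ?g b))
      + (\<Sum>(a, b)\<in>splits m. of_nat (?l a + 1) * (?g (e + a) * ?f b))"
    unfolding e_def sum_splits_single ..
  also have "(\<Sum>(a, b)\<in>splits m. of_nat (?l a + 1) * (?g (e + a) * ?f b))
      = (\<Sum>(b, a)\<in>splits m. of_nat (?l a + 1) * (?g (e + a) * ?f b))"
    by (rule swap)
  finally show "mps_coeff (pderiv_mps i (f * g)) m
      = mps_coeff (pderiv_mps i f * g + f * pderiv_mps i g) m"
    unfolding mps_coeff_add mps_coeff_mult[of "pderiv_mps i f"] mps_coeff_mult[of f]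
    by (simp add: mps_coeff_pderiv e_def mult_ac)
qed

lemma pderiv_mps_var: "pderiv_mps i (mps_var j) = (if i = j then 1 else 0)"
proof (rule mps_eqI)
  fix m
  have "Poly_Mapping.single i 1 + m = Poly_Mapping.single j (1::nat) \<longleftrightarrow> i = j \<and> m = 0"
  proof
    assume *: "Poly_Mapping.single i 1 + m = Poly_Mapping.single j (1::nat)"
    have "Poly_Mapping.lookup (Poly_Mapping.single i 1 + m) i = Poly_Mapping.lookup (Poly_Mapping.single j (1::nat)) i"
      by (simp only: *)
    then have "i = j" by (auto simp: lookup_add lookup_single when_def split: if_splits)
    then show "i = j \<and> m = 0" using * by simp
  qed auto
  then show "mps_coeff (pderiv_mps i (mps_var j)) m = mps_coeff (if i = j then 1 else 0) m"
    by (auto simp: mps_coeff_pderiv mps_coeff_monom mps_coeff_one)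
qed

section \<open>Linear relations over the rational functions\<close>

lemma polys_in_0 [simp]: "0 \<in> polys_in V"
  by (simp add: polys_in_def)

lemma polys_in_monom: "Poly_Mapping.keys m \<subseteq> V \<Longrightarrow> mps_monom m \<in> polys_in V"
  by (auto simp: polys_in_def mps_coeff_monom)

lemma polys_in_1 [simp]: "1 \<in> polys_in V"
  using polys_in_monom[of 0 V] by simp

lemma polys_in_add: "p \<in> polys_in V \<Longrightarrow> q \<in> polys_in V \<Longrightarrow> p + q \<in> polys_in V"
proof -
  assume *: "p \<in> polys_in V" "q \<in> polys_in V"
  have "finite {m. mps_coeff (p + q) m \<noteq> 0}"
    by (rule finite_subset[of _ "{m. mps_coeff p m \<noteq> 0} \<union> {m. mps_coeff q m \<noteq> 0}"])
      (use * in \<open>auto simp: polys_in_def\<close>)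
  moreover have "Poly_Mapping.keys m \<subseteq> V" if "mps_coeff (p + q) m \<noteq> 0" for m
    using * that by (cases "mps_coeff p m = 0") (auto simp: polys_in_def)
  ultimately show ?thesis by (simp add: polys_in_def)
qed

lemma polys_in_const_mult: "p \<in> polys_in V \<Longrightarrow> mps_const c * p \<in> polys_in V"
proof -
  assume *: "p \<in> polys_in V"
  have "{m. mps_coeff (mps_const c * p) m \<noteq> 0} \<subseteq> {m. mps_coeff p m \<noteq> 0}" by auto
  then show ?thesis using * unfolding polys_in_def by (blast intro: finite_subset)
qed

lemma mps_mult_support:
  assumes "mps_coeff (p * q) m \<noteq> 0"
  obtains a b where "m = a + b" "mps_coeff p a \<noteq> 0" "mps_coeff q b \<noteq> 0"
proof -
  have "(\<Sum>(a, b)\<in>splits m. mps_coeff p a * mps_coeff q b) \<noteq> 0"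
    using assms by (simp add: mps_coeff_mult)
  then obtain x where "x \<in> splits m" "(case x of (a, b) \<Rightarrow> mps_coeff p a * mps_coeff q b) \<noteq> 0"
    by (rule sum.not_neutral_contains_not_neutral)
  then obtain a b where "m = a + b" "mps_coeff p a * mps_coeff q b \<noteq> 0"
    by (cases x) (auto simp: splits_def)
  then show thesis using that[of a b] mult_not_zero[of "mps_coeff p a" "mps_coeff q b"] by simp
qed

lemma polys_in_mult: "p \<in> polys_in V \<Longrightarrow> q \<in> polys_in V \<Longrightarrow> p * q \<in> polys_in V"
proof -
  assume *: "p \<in> polys_in V" "q \<in> polys_in V"
  have "finite {m. mps_coeff (p * q) m \<noteq> 0}"
    by (rule finite_subset[of _ "(\<lambda>(a, b). a + b) ` ({m. mps_coeff p m \<noteq> 0} \<times> {m. mps_coeff q m \<noteq> 0})"])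
      (use * in \<open>auto simp: polys_in_def elim!: mps_mult_support\<close>)
  moreover have "Poly_Mapping.keys m \<subseteq> V" if "mps_coeff (p * q) m \<noteq> 0" for m
    using that by (rule mps_mult_support) (use * in \<open>auto simp: polys_in_def keys_add_nat\<close>)
  ultimately show ?thesis by (simp add: polys_in_def)
qed

lemma polys_in_uminus: "p \<in> polys_in V \<Longrightarrow> - p \<in> polys_in V"
  using polys_in_const_mult[of p V "- 1"] by (simp add: mps_const_uminus)

lemma polys_in_sum: "(\<And>i. i \<in> A \<Longrightarrow> f i \<in> polys_in V) \<Longrightarrow> sum f A \<in> polys_in V"
  by (induction A rule: infinite_finite_induct) (auto intro: polys_in_add)

lemma polys_in_prod: "(\<And>i. i \<in> A \<Longrightarrow> f i \<in> polys_in V) \<Longrightarrow> prod f A \<in> polys_in V"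
  by (induction A rule: infinite_finite_induct) (auto intro: polys_in_mult)

lemma polys_in_pderiv: "p \<in> polys_in V \<Longrightarrow> pderiv_mps i p \<in> polys_in V"
proof -
  assume *: "p \<in> polys_in V"
  have nz: "mps_coeff p (Poly_Mapping.single i 1 + m) \<noteq> 0" if "mps_coeff (pderiv_mps i p) m \<noteq> 0" for m
    using that by (auto simp: mps_coeff_pderiv)
  have "finite ((\<lambda>m. Poly_Mapping.single i 1 + m) -` {m. mps_coeff p m \<noteq> 0})"
    by (rule finite_vimageI) (use * in \<open>auto simp: polys_in_def inj_on_def\<close>)
  then have "finite {m. mps_coeff (pderiv_mps i p) m \<noteq> 0}"
    by (rule rev_finite_subset) (use nz in auto)
  moreover have "Poly_Mapping.keys m \<subseteq> V" if "mps_coeff (pderiv_mps i p) m \<noteq> 0" for m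
    using nz[OF that] * unfolding polys_in_def by (metis (mono_tags, lifting) keys_add_nat le_sup_iff mem_Collect_eq)
  ultimately show ?thesis by (simp add: polys_in_def)
qed

abbreviation mps_fract :: "'a :: idom mps \<Rightarrow> 'a mps fract"
  where "mps_fract f \<equiv> Fraction_Field.Fract f 1"

lemma mps_fract_eq_iff [simp]: "mps_fract f = mps_fract g \<longleftrightarrow> f = g"
  by (simp add: eq_fract)

lemma mps_fract_add: "mps_fract (f + g) = mps_fract f + mps_fract g"
  and mps_fract_mult: "mps_fract (f * g) = mps_fract f * mps_fract g"
  and mps_fract_0 [simp]: "mps_fract 0 = 0"
  by (simp_all only: Zero_fract_def add_fract mult_fract mult_1_right mult_1_left one_neq_zero not_False_eq_True simp_thms)

lemma mps_fract_sum: "mps_fract (\<Sum>i\<in>A. f i) = (\<Sum>i\<in>A. mps_fract (f i))"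
  by (induction A rule: infinite_finite_induct) (simp_all only: sum.infinite sum.empty sum.insert mps_fract_add mps_fract_0 if_False if_True simp_thms)

text \<open>Denominators are cleared, so that membership of a power series is a statement in the ring.\<close>

definition fract_span :: "nat set \<Rightarrow> 'a :: field mps set \<Rightarrow> 'a mps fract set"
  where "fract_span V H = {x. \<exists>q p. q \<in> polys_in V \<and> q \<noteq> 0 \<and> (\<forall>h\<in>H. p h \<in> polys_in V)
    \<and> mps_fract q * x = mps_fract (\<Sum>h\<in>H. p h * h)}"

definition rat_span :: "nat set \<Rightarrow> 'a :: field mps set \<Rightarrow> 'a mps set"
  where "rat_span V H = {x. \<exists>q p. q \<in> polys_in V \<and> q \<noteq> 0 \<and> (\<forall>h\<in>H. p h \<in> polys_in V)
    \<and> q * x = (\<Sum>h\<in>H. p h * h)}"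

text \<open>D-finiteness is defined by spans in the fraction field, while derivatives exist only in
  the ring; this is the passage between the two.\<close>

lemma mps_fract_in_fract_span: "mps_fract x \<in> fract_span V H \<longleftrightarrow> x \<in> rat_span V H"
  by (simp add: fract_span_def rat_span_def)

lemma fract_span_add:
  assumes "x \<in> fract_span V H" "y \<in> fract_span V H"
  shows "x + y \<in> fract_span V H"
proof -
  obtain q p where 1: "q \<in> polys_in V" "q \<noteq> 0" "\<And>h. h \<in> H \<Longrightarrow> p h \<in> polys_in V"
    "mps_fract q * x = mps_fract (\<Sum>h\<in>H. p h * h)"
    using assms(1) by (auto simp: fract_span_def)
  obtain r s where 2: "r \<in> polys_in V" "r \<noteq> 0" "\<And>h. h \<in> H \<Longrightarrow> s h \<in> polys_in V"
    "mps_fract r * y = mps_fract (\<Sum>h\<in>H. s h * h)"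
    using assms(2) by (auto simp: fract_span_def)
  have "mps_fract (q * r) * (x + y) = mps_fract r * (mps_fract q * x) + mps_fract q * (mps_fract r * y)"
    unfolding mps_fract_mult by (simp only: distrib_left mult.assoc mult.left_commute[of "mps_fract r"])
  also have "\<dots> = mps_fract (\<Sum>h\<in>H. (r * p h + q * s h) * h)"
    unfolding 1(4) 2(4) mps_fract_mult[symmetric] mps_fract_add[symmetric] mps_fract_eq_iff
    by (simp only: sum_distrib_left sum.distrib distrib_right mult.assoc)
  finally show ?thesis
    unfolding fract_span_def using 1 2
    by (intro CollectI exI[of _ "q * r"] exI[of _ "\<lambda>h. r * p h + q * s h"])
      (auto intro!: polys_in_mult polys_in_add)
qed

lemma fract_span_0: "0 \<in> fract_span V H"
  unfolding fract_span_def
  by (intro CollectI exI[of _ 1] exI[of _ "\<lambda>_. 0"]) simp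

lemma fract_span_scale:
  assumes "x \<in> fract_span V H" "c \<in> ratfuns_in V"
  shows "c * x \<in> fract_span V H"
proof -
  obtain q p where 1: "q \<in> polys_in V" "q \<noteq> 0" "\<And>h. h \<in> H \<Longrightarrow> p h \<in> polys_in V"
    "mps_fract q * x = mps_fract (\<Sum>h\<in>H. p h * h)"
    using assms(1) by (auto simp: fract_span_def)
  obtain a b where 2: "a \<in> polys_in V" "b \<in> polys_in V" "b \<noteq> 0" "c = Fraction_Field.Fract a b"
    using assms(2) by (auto simp: ratfuns_in_def)
  have "mps_fract (q * b) * (c * x) = (mps_fract b * c) * (mps_fract q * x)"
    by (simp only: mps_fract_mult mult_ac)
  also have "mps_fract b * c = mps_fract a"
    using 2 by (simp add: eq_fract)
  also have "mps_fract a * (mps_fract q * x) = mps_fract (\<Sum>h\<in>H. (a * p h) * h)"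
    by (simp add: 1(4) sum_distrib_left mult.assoc)
  finally show ?thesis
    unfolding fract_span_def using 1 2
    by (intro CollectI exI[of _ "q * b"] exI[of _ "\<lambda>h. a * p h"]) (auto intro!: polys_in_mult)
qed

lemma fract_span_sum: "(\<And>i. i \<in> A \<Longrightarrow> f i \<in> fract_span V H) \<Longrightarrow> sum f A \<in> fract_span V H"
  by (induction A rule: infinite_finite_induct) (auto intro: fract_span_add fract_span_0)

lemma span_over_subset_fract_span:
  assumes "D \<subseteq> fract_span V H"
  shows "span_over (ratfuns_in V) D \<subseteq> fract_span V H"
  using assms by (auto simp: span_over_def intro!: fract_span_sum fract_span_scale)

lemma fract_span_base:
  assumes "finite H" "h \<in> H"
  shows "mps_fract h \<in> fract_span V H"
proof -
  have "(\<Sum>h'\<in>H. (if h' = h then 1 else 0) * h') = h"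
    using assms by (simp add: if_distrib[of "\<lambda>x. x * _"] cong: if_cong)
  then show ?thesis
    unfolding fract_span_def
    by (intro CollectI exI[of _ 1] exI[of _ "\<lambda>h'. if h' = h then 1 else 0"]) auto
qed

lemma fract_span_eq_span_over:
  assumes "finite H"
  shows "fract_span V H = span_over (ratfuns_in V) (mps_fract ` H)"
proof
  show "span_over (ratfuns_in V) (mps_fract ` H) \<subseteq> fract_span V H"
    using assms by (intro span_over_subset_fract_span) (auto intro: fract_span_base)
  show "fract_span V H \<subseteq> span_over (ratfuns_in V) (mps_fract ` H)"
  proof
    fix x assume "x \<in> fract_span V H"
    then obtain q p where 1: "q \<in> polys_in V" "q \<noteq> 0" "\<And>h. h \<in> H \<Longrightarrow> p h \<in> polys_in V"
      "mps_fract q * x = mps_fract (\<Sum>h\<in>H. p h * h)"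
      by (auto simp: fract_span_def)
    have inj: "inj_on mps_fract H" by (auto simp: inj_on_def)
    \<comment> \<open>The coefficients in \<open>span_over\<close> are indexed by the vectors
      themselves, so the generator behind \<open>v\<close> has to be recovered.\<close>
    define c where "c v = Fraction_Field.Fract (p (the_inv_into H mps_fract v)) q" for v
    have c: "c (mps_fract h) = Fraction_Field.Fract (p h) q" if "h \<in> H" for h
      using that by (simp add: c_def the_inv_into_f_f[OF inj])
    have "Fraction_Field.Fract 1 q * mps_fract q = 1"
      using 1(2) by (simp add: One_fract_def eq_fract)
    then have "x = Fraction_Field.Fract 1 q * (mps_fract q * x)"
      by (simp flip: mult.assoc)
    also have "\<dots> = (\<Sum>h\<in>H. c (mps_fract h) * mps_fract h)"
      unfolding 1(4) mps_fract_sum sum_distrib_left by (rule sum.cong) (simp_all add: c)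
    also have "\<dots> = (\<Sum>v\<in>mps_fract ` H. c v * v)"
      by (simp add: sum.reindex[OF inj])
    finally show "x \<in> span_over (ratfuns_in V) (mps_fract ` H)"
      unfolding span_over_def using assms 1 c
      by (intro CollectI exI[of _ "mps_fract ` H"] exI[of _ c]) (auto simp: ratfuns_in_def)
  qed
qed

lemma rat_span_add: "x \<in> rat_span V H \<Longrightarrow> y \<in> rat_span V H \<Longrightarrow> x + y \<in> rat_span V H"
  using fract_span_add[of "mps_fract x" V H "mps_fract y"] by (simp add: mps_fract_in_fract_span)

lemma rat_span_poly_mult: "x \<in> rat_span V H \<Longrightarrow> p \<in> polys_in V \<Longrightarrow> p * x \<in> rat_span V H"
proof -
  assume *: "x \<in> rat_span V H" "p \<in> polys_in V"
  then have "mps_fract p \<in> ratfuns_in V"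
    unfolding ratfuns_in_def by (intro CollectI exI[of _ p] exI[of _ 1]) auto
  then show ?thesis
    using fract_span_scale[of "mps_fract x" V H "mps_fract p"] *
    by (simp only: mps_fract_in_fract_span mps_fract_mult[symmetric])
qed

lemma rat_span_sum: "(\<And>i. i \<in> A \<Longrightarrow> f i \<in> rat_span V H) \<Longrightarrow> sum f A \<in> rat_span V H"
  using fract_span_sum[of A "\<lambda>i. mps_fract (f i)" V H]
  by (simp add: mps_fract_in_fract_span[symmetric] mps_fract_sum)

lemma rat_span_base: "finite H \<Longrightarrow> h \<in> H \<Longrightarrow> h \<in> rat_span V H"
  using fract_span_base[of H h V] by (simp add: mps_fract_in_fract_span)

lemma rat_span_cancel:
  assumes "q * x \<in> rat_span V H" "q \<in> polys_in V" "q \<noteq> 0"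
  shows "x \<in> rat_span V H"
proof -
  obtain r p where "r \<in> polys_in V" "r \<noteq> 0" "\<forall>h\<in>H. p h \<in> polys_in V" "r * (q * x) = (\<Sum>h\<in>H. p h * h)"
    using assms(1) by (auto simp: rat_span_def)
  then show ?thesis
    unfolding rat_span_def using assms
    by (intro CollectI exI[of _ "r * q"] exI[of _ p]) (auto intro: polys_in_mult simp: mult.assoc)
qed

text \<open>The product rule gives q x' = (q x)' - q' x, where q x is a polynomial combination of
  \<open>H\<close>. Both terms lie in the span, and q can be cancelled.\<close>

lemma rat_span_pderiv:
  assumes "finite H" "x \<in> rat_span V H" "\<And>h. h \<in> H \<Longrightarrow> pderiv_mps i h \<in> rat_span V H"
  shows "pderiv_mps i x \<in> rat_span V H"
proof -
  obtain q p where 1: "q \<in> polys_in V" "q \<noteq> 0" "\<And>h. h \<in> H \<Longrightarrow> p h \<in> polys_in V"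
    "q * x = (\<Sum>h\<in>H. p h * h)"
    using assms(2) by (auto simp: rat_span_def)
  have "pderiv_mps i (q * x) \<in> rat_span V H"
    unfolding 1(4) pderiv_mps_sum pderiv_mps_mult using 1 assms
    by (intro rat_span_sum rat_span_add rat_span_poly_mult) (auto intro: rat_span_base polys_in_pderiv)
  moreover have "- pderiv_mps i q * x \<in> rat_span V H"
    using assms 1 by (intro rat_span_poly_mult polys_in_uminus polys_in_pderiv)
  ultimately have "pderiv_mps i (q * x) + - pderiv_mps i q * x \<in> rat_span V H"
    by (rule rat_span_add)
  then have "q * pderiv_mps i x \<in> rat_span V H" by (simp add: pderiv_mps_mult)
  then show ?thesis using 1 by (auto intro: rat_span_cancel)
qed

lemma span_over_mono: "D \<subseteq> E \<Longrightarrow> span_over K D \<subseteq> span_over K E"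
  unfolding span_over_def by blast

section \<open>D-finiteness by linear systems and by differential equations\<close>

text \<open>The finite spanning set given by the hypothesis consists of fractions. Each of them uses
  only finitely many iterated derivatives of \<open>f\<close>, so a finite set \<open>H\<close> of
  these derivatives spans everything, in particular the derivatives of its own members. The product
  \<open>Q\<close> of all denominators then yields one first-order linear system.\<close>

lemma D_finite_fin_system:
  fixes f :: "'a :: field mps"
  assumes "finite V" "D_finite_fin V f"
  obtains H Q where "finite H" "f \<in> H" "Q \<in> polys_in V" "Q \<noteq> 0"
    "\<And>i h. i \<in> V \<Longrightarrow> h \<in> H \<Longrightarrow> \<exists>p. (\<forall>h'\<in>H. p h' \<in> polys_in V) \<and> Q * pderiv_mps i h = (\<Sum>h'\<in>H. p h' * h')"
proof -
  let ?I = "iterated_pderivs V f" and ?K = "ratfuns_in V :: 'a mps fract set"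
  obtain B where B: "finite B" "span_over ?K B = span_over ?K (mps_fract ` ?I)"
    using assms(2) by (auto simp: D_finite_fin_def finite_dimensional_over_def)
  have one: "(1 :: 'a mps fract) \<in> ?K"
    by (auto simp: ratfuns_in_def One_fract_def intro!: exI[of _ 1])
  have self: "D \<subseteq> span_over ?K D" for D
  proof
    fix v assume "v \<in> D"
    then show "v \<in> span_over ?K D"
      unfolding span_over_def using one
      by (intro CollectI exI[of _ "{v}"] exI[of _ "\<lambda>_. 1"]) auto
  qed
  have "\<exists>H. finite H \<and> H \<subseteq> ?I \<and> b \<in> span_over ?K (mps_fract ` H)" if "b \<in> B" for b
  proof -
    have "b \<in> span_over ?K (mps_fract ` ?I)" using that self[of B] B by auto
    then obtain T c where T: "finite T" "T \<subseteq> mps_fract ` ?I" "c ` T \<subseteq> ?K" "b = (\<Sum>v\<in>T. c v * v)"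
      by (auto simp: span_over_def)
    obtain H where "H \<subseteq> ?I" "finite H" "T = mps_fract ` H"
      using finite_subset_image[OF T(1,2)] by auto
    then show ?thesis using T by (auto simp: span_over_def)
  qed
  then obtain Hb where Hb: "\<And>b. b \<in> B \<Longrightarrow> finite (Hb b) \<and> Hb b \<subseteq> ?I \<and> b \<in> span_over ?K (mps_fract ` Hb b)"
    by metis
  \<comment> \<open>With \<open>f\<close> among the generators, the filtration defined later can
    start from \<open>f\<close> at level 0.\<close>
  define H where "H = insert f (\<Union>b\<in>B. Hb b)"
  have H: "finite H" "f \<in> H" "H \<subseteq> ?I"
    using B(1) Hb by (auto simp: H_def intro: iterated_pderivs.base)
  have "B \<subseteq> fract_span V H"
  proof
    fix b assume b: "b \<in> B"
    then have "mps_fract ` Hb b \<subseteq> mps_fract ` H" by (auto simp: H_def)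
    then show "b \<in> fract_span V H"
      using Hb[OF b] span_over_mono unfolding fract_span_eq_span_over[OF H(1)] by blast
  qed
  then have "span_over ?K (mps_fract ` ?I) \<subseteq> fract_span V H"
    unfolding B(2)[symmetric] by (rule span_over_subset_fract_span)
  then have rat: "g \<in> rat_span V H" if "g \<in> ?I" for g
    using self[of "mps_fract ` ?I"] that mps_fract_in_fract_span by blast
  define R where "R x q p \<longleftrightarrow> q \<in> polys_in V \<and> q \<noteq> 0 \<and> (\<forall>h'\<in>H. p h' \<in> polys_in V)
      \<and> q * pderiv_mps (fst x) (snd x) = (\<Sum>h'\<in>H. p h' * h')" for x q p
  have "\<exists>q p. R x q p" if "x \<in> V \<times> H" for x
  proof -
    have "pderiv_mps (fst x) (snd x) \<in> ?I"
      using that H(3) by (intro iterated_pderivs.step) auto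
    from rat[OF this] show ?thesis unfolding rat_span_def mem_Collect_eq R_def .
  qed
  then obtain q p where "\<And>x. x \<in> V \<times> H \<Longrightarrow> R x (q x) (p x)"
    by metis
  then have qp: "\<And>x. x \<in> V \<times> H \<Longrightarrow> q x \<in> polys_in V \<and> q x \<noteq> 0
      \<and> (\<forall>h'\<in>H. p x h' \<in> polys_in V) \<and> q x * pderiv_mps (fst x) (snd x) = (\<Sum>h'\<in>H. p x h' * h')"
    unfolding R_def by blast
  define Q where "Q = (\<Prod>x\<in>V \<times> H. q x)"
  show thesis
  proof (rule that[OF H(1,2), of Q])
    show "Q \<in> polys_in V" unfolding Q_def by (rule polys_in_prod) (use qp in blast)
    show "Q \<noteq> 0" unfolding Q_def using qp assms(1) H(1) by (subst prod_zero_iff) blast+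
    fix i h assume ih: "i \<in> V" "h \<in> H"
    define Q' where "Q' = (\<Prod>x\<in>V \<times> H - {(i, h)}. q x)"
    have Q: "Q = Q' * q (i, h)"
      using prod.remove[of "V \<times> H" "(i, h)" q] assms(1) H(1) ih by (simp add: Q_def Q'_def mult.commute)
    have Q': "Q' \<in> polys_in V" unfolding Q'_def by (rule polys_in_prod) (use qp in blast)
    have "Q * pderiv_mps i h = (\<Sum>h'\<in>H. (Q' * p (i, h) h') * h')"
      using qp[of "(i, h)"] ih by (simp add: Q mult.assoc sum_distrib_left)
    moreover have "\<forall>h'\<in>H. Q' * p (i, h) h' \<in> polys_in V"
      using Q' qp[of "(i, h)"] ih by (auto intro: polys_in_mult)
    ultimately show "\<exists>p. (\<forall>h'\<in>H. p h' \<in> polys_in V) \<and> Q * pderiv_mps i h = (\<Sum>h'\<in>H. p h' * h')"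
      by (intro exI[of _ "\<lambda>h'. Q' * p (i, h) h'"]) simp
  qed
qed

lemma iterated_pderivs_singleton: "iterated_pderivs {i} f = range (\<lambda>n. (pderiv_mps i ^^ n) f)"
proof (intro equalityI subsetI)
  fix g assume "g \<in> iterated_pderivs {i} f"
  then show "g \<in> range (\<lambda>n. (pderiv_mps i ^^ n) f)"
  proof induction
    case base
    then show ?case by (auto intro: range_eqI[of _ _ 0])
  next
    case (step g j)
    then show ?case by (auto intro: range_eqI[of _ _ "Suc n" for n])
  qed
next
  have "(pderiv_mps i ^^ n) f \<in> iterated_pderivs {i} f" for n
    by (induction n) (auto intro: iterated_pderivs.intros)
  then show "g \<in> iterated_pderivs {i} f" if "g \<in> range (\<lambda>n. (pderiv_mps i ^^ n) f)" for g
    using that by auto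
qed

text \<open>The highest derivative that really occurs is a combination of the lower ones, and
  \<open>rat_span_pderiv\<close> carries all further derivatives into the same span.\<close>

lemma D_finite_fin_if_ODE:
  fixes f :: "'a :: field mps"
  assumes q: "\<And>b. q b \<in> polys_in {i}" and nz: "b0 \<le> r" "q b0 \<noteq> 0"
    and ode: "(\<Sum>b\<le>r. q b * (pderiv_mps i ^^ b) f) = 0"
  shows "D_finite_fin {i} f"
proof -
  \<comment> \<open>The coefficient \<open>q r\<close> may vanish, so the true order is the largest
    index with a nonzero coefficient.\<close>
  define s where "s = Max {b. b \<le> r \<and> q b \<noteq> 0}"
  have fin: "finite {b. b \<le> r \<and> q b \<noteq> 0}" by simp
  have s: "s \<le> r" "q s \<noteq> 0" using Max_in[OF fin] nz unfolding s_def by blast+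
  have s_max: "q b = 0" if "b \<le> r" "b > s" for b
    using Max_ge[OF fin, of b] that unfolding s_def by fastforce
  let ?D = "\<lambda>b. (pderiv_mps i ^^ b) f"
  have "(\<Sum>b\<le>r. q b * ?D b) = (\<Sum>b\<le>s. q b * ?D b)"
    using s s_max by (intro sum.mono_neutral_right) (auto simp: not_le)
  then have lead: "q s * ?D s = (\<Sum>b<s. (- q b) * ?D b)"
    using ode by (simp add: lessThan_Suc_atMost[symmetric] add_eq_0_iff sum_negf)
  define H where "H = ?D ` {..<s}"
  have H: "finite H" by (simp add: H_def)
  have base: "?D b \<in> rat_span {i} H" if "b < s" for b
    using that by (intro rat_span_base[OF H]) (auto simp: H_def)
  have "q s * ?D s \<in> rat_span {i} H"
    unfolding lead using base q
    by (intro rat_span_sum rat_span_poly_mult polys_in_uminus) auto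
  then have top: "?D s \<in> rat_span {i} H"
    by (rule rat_span_cancel) (use q s in auto)
  have "pderiv_mps i h \<in> rat_span {i} H" if h: "h \<in> H" for h
  proof -
    obtain b where b: "b < s" "h = ?D b" using h unfolding H_def by blast
    then have "pderiv_mps i h = ?D (Suc b)" by simp
    moreover have "?D (Suc b) \<in> rat_span {i} H"
      using base[of "Suc b"] top b(1) by (cases "Suc b = s") (blast, linarith)
    ultimately show ?thesis by metis
  qed
  note step = rat_span_pderiv[OF H _ this]
  \<comment> \<open>For \<open>s = 0\<close> the set \<open>H\<close> is empty and \<open>f\<close>
    is itself the top term.\<close>
  have "f \<in> rat_span {i} H"
    using base[of 0] top by (cases "s = 0") simp_all
  then have all: "?D n \<in> rat_span {i} H" for n
    by (induction n) (auto intro: step)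
  have "span_over (ratfuns_in {i}) (mps_fract ` range ?D) = span_over (ratfuns_in {i}) (mps_fract ` H)"
  proof
    show "span_over (ratfuns_in {i}) (mps_fract ` H) \<subseteq> span_over (ratfuns_in {i}) (mps_fract ` range ?D)"
      by (rule span_over_mono) (auto simp: H_def)
    show "span_over (ratfuns_in {i}) (mps_fract ` range ?D) \<subseteq> span_over (ratfuns_in {i}) (mps_fract ` H)"
    proof -
      have "mps_fract ` range ?D \<subseteq> fract_span {i} H"
        using all mps_fract_in_fract_span by blast
      then show ?thesis
        using span_over_subset_fract_span by (simp only: fract_span_eq_span_over[OF H, symmetric])
    qed
  qed
  then show ?thesis
    unfolding D_finite_fin_def finite_dimensional_over_def iterated_pderivs_singleton
    using H by (intro exI[of _ "mps_fract ` H"]) simp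
qed

section \<open>Skewing by complete homogeneous symmetric functions\<close>

text \<open>The adjoint \<open>h\<^sub>k\<^sup>\<bottom>\<close> of multiplication by the complete homogeneous symmetric function \<open>h\<^sub>k\<close>,
  defined by the adjoint of Newton's identity \<open>k h\<^sub>k = (\<Sum>i=1..k. p\<^sub>i h\<^bsub>k-i\<^esub>)\<close>,
  where the adjoint of \<open>p\<^sub>i\<close> is \<open>i \<partial>/\<partial>p\<^sub>i\<close>.\<close>

fun h_perp :: "nat \<Rightarrow> 'a :: field_char_0 mps \<Rightarrow> 'a mps" where
  "h_perp 0 f = f"
| "h_perp (Suc k) f = mps_const (1 / of_nat (Suc k)) *
    (\<Sum>i\<le>k. of_nat (Suc i) * pderiv_mps (Suc i) (h_perp (k - i) f))"

declare h_perp.simps(2) [simp del]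

lemma mps_of_nat_cancel:
  fixes f :: "'a :: field_char_0 mps"
  assumes "of_nat (Suc k) * f = of_nat (Suc k) * g"
  shows "f = g"
proof (rule mps_eqI)
  fix m
  have "mps_coeff (of_nat (Suc k) * f) m = mps_coeff (of_nat (Suc k) * g) m"
    by (simp only: assms)
  then have "of_nat (Suc k) * mps_coeff f m = of_nat (Suc k) * mps_coeff g m"
    by (simp only: mps_coeff_of_nat_mult)
  then show "mps_coeff f m = mps_coeff g m"
    by (simp only: mult_cancel_left of_nat_neq_0) simp
qed

lemma of_nat_mult_h_perp_Suc:
  "of_nat (Suc k) * h_perp (Suc k) f = (\<Sum>i\<le>k. of_nat (Suc i) * pderiv_mps (Suc i) (h_perp (k - i) f))"
proof -
  have "of_nat (Suc k) * mps_const (1 / of_nat (Suc k)) = (1 :: 'a mps)"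
    unfolding mps_const_of_nat[symmetric] mps_const_mult[symmetric] by (simp del: of_nat_Suc)
  then show ?thesis
    unfolding h_perp.simps mult.assoc[symmetric] by (simp only: mult_1_left)
qed

definition mps_linear :: "('a :: comm_ring_1 mps \<Rightarrow> 'a mps) \<Rightarrow> bool"
  where "mps_linear T \<longleftrightarrow> (\<forall>f g. T (f + g) = T f + T g) \<and> (\<forall>c f. T (mps_const c * f) = mps_const c * T f)"

lemma mps_linear_add: "mps_linear T \<Longrightarrow> T (f + g) = T f + T g"
  and mps_linear_const_mult: "mps_linear T \<Longrightarrow> T (mps_const c * f) = mps_const c * T f"
  by (simp_all add: mps_linear_def)

lemma mps_linear_of_nat_mult: "mps_linear T \<Longrightarrow> T (of_nat n * f) = of_nat n * T f"
  using mps_linear_const_mult[of T "of_nat n"] by (simp only: mps_const_of_nat)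

lemma mps_linear_0: "mps_linear T \<Longrightarrow> T 0 = 0"
  using mps_linear_const_mult[of T 0 0] by simp

lemma mps_linear_sum: "mps_linear T \<Longrightarrow> T (\<Sum>i\<in>A. f i) = (\<Sum>i\<in>A. T (f i))"
  by (induction A rule: infinite_finite_induct) (simp_all add: mps_linear_0 mps_linear_add)

lemma mps_linear_diff: "mps_linear T \<Longrightarrow> T (f - g) = T f - T g"
  using mps_linear_add[of T "f - g" g] by simp

lemma mps_linear_pderiv: "mps_linear (pderiv_mps i)"
  by (simp add: mps_linear_def pderiv_mps_add pderiv_mps_const_mult)

lemma mps_linear_mult: "mps_linear ((*) g)"
  by (simp add: mps_linear_def distrib_left mult.left_commute)

lemma mps_linear_set_other_vars_zero: "mps_linear (set_other_vars_zero V)"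
  unfolding mps_linear_def
  by (intro conjI allI mps_eqI) (auto simp: set_other_vars_zero_def)

lemma mps_linear_lincomb:
  assumes "\<And>i. i \<in> A \<Longrightarrow> mps_linear (T i)"
  shows "mps_linear (\<lambda>f. \<Sum>i\<in>A. T i f)"
  using assms by (simp add: mps_linear_def sum.distrib sum_distrib_left)

lemma mps_linear_funpow: "mps_linear T \<Longrightarrow> mps_linear (T ^^ n)"
  by (induction n) (simp_all add: mps_linear_def)

lemma mps_linear_h_perp: "mps_linear (h_perp k :: 'a :: field_char_0 mps \<Rightarrow> 'a mps)"
proof (induction k rule: less_induct)
  case (less k)
  show ?case
  proof (cases k)
    case 0
    then show ?thesis by (simp add: mps_linear_def)
  next
    case (Suc k')
    have *: "mps_linear (h_perp (k' - i) :: 'a mps \<Rightarrow> 'a mps)" for i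
      using less[of "k' - i"] Suc by (simp add: less_Suc_eq_le)
    show ?thesis
      unfolding mps_linear_def Suc h_perp.simps
      by (simp add: mps_linear_add[OF *] mps_linear_const_mult[OF *] pderiv_mps_add
          pderiv_mps_const_mult distrib_left sum.distrib sum_distrib_left mult.left_commute)
  qed
qed

text \<open>h_k^perp is a polynomial in the derivations with indices 1 to k. Commutation with other
  derivations, with multiplication by \<open>mps_var 0\<close>, with other skewing operators and
  with setting variables to 0 all come from here.\<close>

lemma h_perp_commute:
  assumes "mps_linear T"
    and "\<And>i f. 1 \<le> i \<Longrightarrow> i \<le> k \<Longrightarrow> T (pderiv_mps i f) = pderiv_mps i (T f)"
  shows "T (h_perp k f) = h_perp k (T f)"
  using assms(2)
proof (induction k rule: less_induct)
  case (less k)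
  show ?case
  proof (cases k)
    case (Suc k')
    have *: "T (pderiv_mps (Suc i) (h_perp (k' - i) f)) = pderiv_mps (Suc i) (h_perp (k' - i) (T f))"
      if "i \<le> k'" for i
      using less(1)[of "k' - i"] less(2) that Suc by simp
    show ?thesis
      unfolding Suc h_perp.simps mps_linear_const_mult[OF assms(1)] mps_linear_sum[OF assms(1)]
        mps_linear_of_nat_mult[OF assms(1)]
      using * by (intro arg_cong2[of _ _ _ _ "(*)"] sum.cong) auto
  qed simp
qed

text \<open>The translation by y^j in p_j makes h_k^perp lose j when it passes p_j. In the induction
  along the recursion for k h_k^perp, the product rule contributes j copies of
  \<open>h_perp (k - j) f\<close> and the induction hypothesis k - j copies, hence k in
  total.\<close>

lemma h_perp_mult_var:
  assumes "j \<ge> 1"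
  shows "h_perp k (mps_var j * f) = mps_var j * h_perp k f + (if j \<le> k then h_perp (k - j) f else 0)"
proof (induction k rule: less_induct)
  case (less k)
  show ?case
  proof (cases k)
    case 0
    then show ?thesis using assms by simp
  next
    case (Suc k')
    let ?D = "\<lambda>i F. of_nat (Suc i) * pderiv_mps (Suc i) F"
    have "of_nat (Suc k') * h_perp (Suc k') (mps_var j * f)
      = (\<Sum>i\<le>k'. ?D i (mps_var j * h_perp (k' - i) f + (if j \<le> k' - i then h_perp (k' - i - j) f else 0)))"
      unfolding of_nat_mult_h_perp_Suc using less[of "k' - i" for i] Suc by (intro sum.cong) auto
    also have "\<dots> = (\<Sum>i\<le>k'. mps_var j * ?D i (h_perp (k' - i) f))
        + (\<Sum>i\<le>k'. if Suc i = j then of_nat j * h_perp (k' - i) f else 0)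
        + (\<Sum>i\<le>k'. if j \<le> k' - i then ?D i (h_perp (k' - i - j) f) else 0)"
      unfolding sum.distrib[symmetric]
      by (intro sum.cong) (auto simp: pderiv_mps_add pderiv_mps_mult pderiv_mps_var algebra_simps
          simp del: of_nat_Suc)
    also have "(\<Sum>i\<le>k'. mps_var j * ?D i (h_perp (k' - i) f)) = of_nat (Suc k') * (mps_var j * h_perp (Suc k') f)"
      unfolding sum_distrib_left[symmetric] of_nat_mult_h_perp_Suc[symmetric] by (simp only: mult_ac)
    also have "(\<Sum>i\<le>k'. if Suc i = j then of_nat j * h_perp (k' - i) f else 0)
        = (if j \<le> Suc k' then of_nat j * h_perp (Suc k' - j) f else 0)"
    proof (cases "j \<le> Suc k'")
      case True
      then have "(\<Sum>i\<le>k'. if Suc i = j then of_nat j * h_perp (k' - i) f else 0)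
          = (\<Sum>i\<in>{j - 1}. if Suc i = j then of_nat j * h_perp (k' - i) f else 0)"
        using assms by (intro sum.mono_neutral_right) auto
      also have "\<dots> = of_nat j * h_perp (Suc k' - j) f"
        using assms by (cases j) auto
      finally show ?thesis using True by simp
    qed (auto intro!: sum.neutral)
    also have "(\<Sum>i\<le>k'. if j \<le> k' - i then ?D i (h_perp (k' - i - j) f) else 0)
        = (if j \<le> Suc k' then of_nat (Suc k' - j) * h_perp (Suc k' - j) f else 0)"
    proof (cases "j \<le> k'")
      case True
      have "(\<Sum>i\<le>k'. if j \<le> k' - i then ?D i (h_perp (k' - i - j) f) else 0)
          = (\<Sum>i\<le>k' - j. ?D i (h_perp ((k' - j) - i) f))"
        using True assms by (intro sum.mono_neutral_cong_right) (auto simp: add.commute)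
      also have "\<dots> = of_nat (Suc (k' - j)) * h_perp (Suc (k' - j)) f"
        unfolding of_nat_mult_h_perp_Suc ..
      also have "Suc (k' - j) = Suc k' - j" using True by simp
      finally show ?thesis using True by simp
    next
      case False
      then have "Suc k' - j = 0" by simp
      then show ?thesis using assms False by (auto intro!: sum.neutral)
    qed
    also have "of_nat (Suc k') * (mps_var j * h_perp (Suc k') f)
        + (if j \<le> Suc k' then of_nat j * h_perp (Suc k' - j) f else 0)
        + (if j \<le> Suc k' then of_nat (Suc k' - j) * h_perp (Suc k' - j) f else 0)
      = of_nat (Suc k') * (mps_var j * h_perp (Suc k') f + (if j \<le> Suc k' then h_perp (Suc k' - j) f else 0))"
    proof (cases "j \<le> Suc k'")
      case True
      then have "of_nat (Suc k') = of_nat j + (of_nat (Suc k' - j) :: 'a mps)"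
        unfolding of_nat_add[symmetric] by simp
      then show ?thesis using True by (simp only: if_True distrib_left distrib_right ac_simps)
    qed (simp add: distrib_left)
    finally show ?thesis unfolding Suc by (rule mps_of_nat_cancel)
  qed
qed

text \<open>With \<open>g = (\<Sum>k\<in>S. h\<^sub>k)\<close>, this is \<open>g\<^sup>\<bottom>\<close> for \<open>i = 0\<close> and the commutator of
  \<open>g\<^sup>\<bottom>\<close> and multiplication by \<open>p\<^sub>i\<close> for \<open>i \<ge> 1\<close>.\<close>

definition h_perp_sum :: "nat set \<Rightarrow> nat \<Rightarrow> 'a :: field_char_0 mps \<Rightarrow> 'a mps"
  where "h_perp_sum S i f = (\<Sum>k | k \<in> S \<and> i \<le> k. h_perp (k - i) f)"

lemma mps_linear_h_perp_sum: "mps_linear (h_perp_sum S i)"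
  unfolding h_perp_sum_def by (intro mps_linear_lincomb mps_linear_h_perp)

lemma h_perp_sum_commute:
  assumes "mps_linear T" "S \<subseteq> {..N}"
    and "\<And>i f. 1 \<le> i \<Longrightarrow> i \<le> N \<Longrightarrow> T (pderiv_mps i f) = pderiv_mps i (T f)"
  shows "T (h_perp_sum S j f) = h_perp_sum S j (T f)"
  unfolding h_perp_sum_def mps_linear_sum[OF assms(1)]
proof (rule sum.cong)
  fix k assume "k \<in> {k. k \<in> S \<and> j \<le> k}"
  then have "k - j \<le> N" using assms(2) by auto
  then show "T (h_perp (k - j) f) = h_perp (k - j) (T f)"
    using assms by (intro h_perp_commute) auto
qed simp

lemma h_perp_pderiv: "h_perp k (pderiv_mps i f) = pderiv_mps i (h_perp k f)"
  by (rule h_perp_commute[symmetric, OF mps_linear_pderiv]) (rule pderiv_mps_commute)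

lemma h_perp_sum_pderiv: "h_perp_sum S j (pderiv_mps i f) = pderiv_mps i (h_perp_sum S j f)"
  by (simp add: h_perp_sum_def h_perp_pderiv pderiv_mps_sum)

lemma h_perp_sum_mult_var_0: "h_perp_sum S j (mps_var 0 * f) = mps_var 0 * h_perp_sum S j f"
  unfolding h_perp_sum_def sum_distrib_left
  by (intro sum.cong refl h_perp_commute[symmetric, OF mps_linear_mult])
    (simp add: pderiv_mps_mult pderiv_mps_var)

lemma h_perp_sum_mult_var:
  assumes "finite S" "j \<ge> 1"
  shows "h_perp_sum S 0 (mps_var j * f) = mps_var j * h_perp_sum S 0 f + h_perp_sum S j f"
  using assms
  by (simp add: h_perp_sum_def h_perp_mult_var sum.distrib sum_distrib_left sum.inter_filter)

lemma h_perp_sum_h_perp_sum: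
  "h_perp_sum S i (h_perp_sum S j f) = h_perp_sum S j (h_perp_sum S i f)"
  unfolding h_perp_sum_def[of S j] mps_linear_sum[OF mps_linear_h_perp_sum]
  by (intro sum.cong refl h_perp_commute mps_linear_h_perp_sum h_perp_sum_pderiv)

lemma funpow_h_perp_sum_commute:
  assumes "\<And>f. T (h_perp_sum S 0 f) = h_perp_sum S 0 (T f)"
  shows "T ((h_perp_sum S 0 ^^ n) f) = (h_perp_sum S 0 ^^ n) (T f)"
  by (induction n) (simp_all add: assms)

text \<open>The commutator of g^perp with p_j commutes with g^perp, so it comes out of a power once
  per factor and no higher commutators arise.\<close>

lemma funpow_h_perp_sum_mult_var:
  assumes "finite S" "j \<ge> 1"
  shows "(h_perp_sum S 0 ^^ Suc n) (mps_var j * f)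
    = mps_var j * (h_perp_sum S 0 ^^ Suc n) f + of_nat (Suc n) * (h_perp_sum S 0 ^^ n) (h_perp_sum S j f)"
proof (induction n)
  case 0
  then show ?case by (simp add: h_perp_sum_mult_var[OF assms])
next
  case (Suc n)
  let ?g = "h_perp_sum S 0"
  have "(?g ^^ Suc (Suc n)) (mps_var j * f)
      = ?g (mps_var j * (?g ^^ Suc n) f + of_nat (Suc n) * (?g ^^ n) (h_perp_sum S j f))"
    using Suc by simp
  also have "\<dots> = mps_var j * ?g ((?g ^^ Suc n) f) + h_perp_sum S j ((?g ^^ Suc n) f)
      + of_nat (Suc n) * ?g ((?g ^^ n) (h_perp_sum S j f))"
    by (simp only: mps_linear_add[OF mps_linear_h_perp_sum] mps_linear_of_nat_mult[OF mps_linear_h_perp_sum]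
        h_perp_sum_mult_var[OF assms])
  also have "h_perp_sum S j ((?g ^^ Suc n) f) = (?g ^^ Suc n) (h_perp_sum S j f)"
    by (rule funpow_h_perp_sum_commute) (rule h_perp_sum_h_perp_sum)
  finally show ?case by (simp add: algebra_simps)
qed

section \<open>Coefficients of symmetric series\<close>

primrec h_perp_word :: "(nat \<Rightarrow> nat) \<Rightarrow> nat \<Rightarrow> 'a :: field_char_0 mps \<Rightarrow> 'a mps" where
  "h_perp_word k 0 f = f"
| "h_perp_word k (Suc n) f = h_perp (k (Suc n)) (h_perp_word k n f)"

lemma h_perp_word_cong: "(\<And>v. v \<in> {1..n} \<Longrightarrow> k v = k' v) \<Longrightarrow> h_perp_word k n f = h_perp_word k' n f"
  by (induction n) auto

text \<open>Each letter contributes its commutator with p_i once, which lowers that letter by i.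
  Apart from the first summand this is the recursion of
  \<open>mps_coeff_power_sum_mult\<close>.\<close>

lemma h_perp_word_mult_var:
  assumes "i \<ge> 1"
  shows "h_perp_word k n (mps_var i * f) = mps_var i * h_perp_word k n f
    + (\<Sum>v | v \<in> {1..n} \<and> i \<le> k v. h_perp_word (k(v := k v - i)) n f)"
proof (induction n)
  case (Suc n)
  have *: "{v. v \<in> {1..Suc n} \<and> i \<le> k v} =
      (if i \<le> k (Suc n) then {Suc n} else {}) \<union> {v. v \<in> {1..n} \<and> i \<le> k v}"
    by (auto simp: le_Suc_eq)
  have last: "h_perp_word (k(Suc n := c)) n f = h_perp_word k n f" for c
    by (rule h_perp_word_cong) auto
  show ?case
    unfolding * h_perp_word.simps Suc mps_linear_add[OF mps_linear_h_perp]
      mps_linear_sum[OF mps_linear_h_perp] h_perp_mult_var[OF assms]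
    by (subst sum.union_disjoint) (auto simp: last intro!: sum.cong)
qed simp

lemma h_perp_1: "h_perp k 1 = (if k = 0 then 1 else 0)"
proof (induction k rule: less_induct)
  case (less k)
  show ?case
  proof (cases k)
    case (Suc k')
    have "pderiv_mps i (1 :: 'a mps) = 0" for i
      using pderiv_mps_mult[of i "1 :: 'a mps" 1] by (simp only: mult_1_left mult_1_right add_cancel_right_right)
    then have "pderiv_mps (Suc i) (h_perp (k' - i) (1 :: 'a mps)) = 0" if "i \<le> k'" for i
      using less[of "k' - i"] Suc by simp
    then show ?thesis by (simp add: Suc h_perp.simps)
  qed simp
qed

lemma h_perp_word_1: "h_perp_word k n 1 = (if \<forall>v\<in>{1..n}. k v = 0 then 1 else 0)"
  by (induction n) (simp_all add: h_perp_1 mps_linear_0[OF mps_linear_h_perp] atLeastAtMostSuc_conv)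

definition exponents :: "nat \<Rightarrow> (nat \<Rightarrow> nat) \<Rightarrow> (nat \<Rightarrow>\<^sub>0 nat)"
  where "exponents n k = (\<Sum>i=1..n. Poly_Mapping.single i (k i))"

lemma lookup_exponents: "Poly_Mapping.lookup (exponents n k) u = (if u \<in> {1..n} then k u else 0)"
  by (simp add: exponents_def lookup_sum lookup_single when_def)

text \<open>Of the monomials x_v^i of the power sum, only those with v among 1, ..., n and i \<le>
  k_v divide the given one. As i \<ge> 1, different v give different monomials, so none is counted
  twice.\<close>

lemma mps_coeff_power_sum_mult:
  assumes "i \<ge> 1"
  shows "mps_coeff (power_sum i * f) (exponents n k)
    = (\<Sum>v | v \<in> {1..n} \<and> i \<le> k v. mps_coeff f (exponents n (k(v := k v - i))))"
proof -
  let ?V = "{v. v \<in> {1..n} \<and> i \<le> k v}"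
  let ?e = "\<lambda>v. (Poly_Mapping.single v i, exponents n (k(v := k v - i)))"
  have inj: "inj_on ?e ?V"
  proof (rule inj_onI)
    fix u v assume "?e u = ?e v"
    then have "Poly_Mapping.lookup (Poly_Mapping.single u i) u = Poly_Mapping.lookup (Poly_Mapping.single v i) u"
      by simp
    then show "u = v" using assms by (auto simp: lookup_single when_def split: if_splits)
  qed
  have "(\<Sum>v\<in>?V. mps_coeff f (exponents n (k(v := k v - i))))
      = (\<Sum>(a, b)\<in>?e ` ?V. mps_coeff (power_sum i) a * mps_coeff f b)"
    unfolding sum.reindex[OF inj] by (intro sum.cong) (auto simp: power_sum_def)
  also have "\<dots> = (\<Sum>(a, b)\<in>splits (exponents n k). mps_coeff (power_sum i) a * mps_coeff f b)"
  proof (rule sum.mono_neutral_left)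
    show "?e ` ?V \<subseteq> splits (exponents n k)"
      by (auto simp: splits_def lookup_exponents lookup_add lookup_single when_def intro!: poly_mapping_eqI)
    show "\<forall>x\<in>splits (exponents n k) - ?e ` ?V.
        (case x of (a, b) \<Rightarrow> mps_coeff (power_sum i) a * mps_coeff f b) = 0"
    proof (intro ballI)
      fix x assume x: "x \<in> splits (exponents n k) - ?e ` ?V"
      obtain a b where ab: "x = (a, b)" by (cases x)
      have "mps_coeff (power_sum i :: 'a mps) a = 0"
      proof (rule ccontr)
        assume "mps_coeff (power_sum i :: 'a mps) a \<noteq> 0"
        then obtain v where v: "v \<ge> 1" "a = Poly_Mapping.single v i"
          by (auto simp: power_sum_def split: if_splits)
        have sum: "Poly_Mapping.lookup (Poly_Mapping.single v i + b) u = Poly_Mapping.lookup (exponents n k) u" for u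
          using x v by (simp add: ab splits_def)
        have "i \<le> Poly_Mapping.lookup (exponents n k) v"
          unfolding sum[symmetric] by (simp add: lookup_add)
        then have "v \<in> ?V" using assms v by (auto simp: lookup_exponents split: if_splits)
        moreover have "b = exponents n (k(v := k v - i))"
        proof (rule poly_mapping_eqI)
          fix u
          show "Poly_Mapping.lookup b u = Poly_Mapping.lookup (exponents n (k(v := k v - i))) u"
            using sum[of u] \<open>v \<in> ?V\<close>
            by (auto simp: lookup_add lookup_single when_def lookup_exponents split: if_splits)
        qed
        ultimately show False using x by (auto simp: ab v)
      qed
      then show "(case x of (a, b) \<Rightarrow> mps_coeff (power_sum i) a * mps_coeff f b) = 0"
        by (simp add: ab)
    qed
  qed simp
  finally show ?thesis by (simp add: mps_coeff_mult)
qed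

lemma power_sum_monomial_superset:
  assumes "finite V" "Poly_Mapping.keys m \<subseteq> V"
  shows "power_sum_monomial m = (\<Prod>i\<in>V. power_sum i ^ Poly_Mapping.lookup m i)"
  unfolding power_sum_monomial_def
  by (rule prod.mono_neutral_left) (use assms in \<open>auto simp: not_in_keys_iff_lookup_eq_zero\<close>)

lemma power_sum_monomial_add_single:
  "power_sum_monomial (Poly_Mapping.single i (Suc 0) + m) = power_sum i * power_sum_monomial m"
proof -
  let ?V = "insert i (Poly_Mapping.keys m)"
  have "power_sum_monomial (Poly_Mapping.single i (Suc 0) + m)
      = (\<Prod>j\<in>?V. (if j = i then power_sum i else 1) * power_sum j ^ Poly_Mapping.lookup m j)"
    by (subst power_sum_monomial_superset[of ?V])
      (auto simp: keys_add_nat lookup_add lookup_single when_def intro!: prod.cong)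
  also have "\<dots> = power_sum i * (\<Prod>j\<in>?V. power_sum j ^ Poly_Mapping.lookup m j)"
    unfolding prod.distrib by (simp add: prod.delta)
  also have "(\<Prod>j\<in>?V. power_sum j ^ Poly_Mapping.lookup m j) = power_sum_monomial m"
    by (rule power_sum_monomial_superset[symmetric]) auto
  finally show ?thesis .
qed

text \<open>Both sides obey the same recursion when a factor p_i is split off; the extra summand on
  the operator side is a multiple of p_i and has no constant term.\<close>

lemma mps_coeff_power_sum_monomial:
  assumes "is_partition m"
  shows "mps_coeff (power_sum_monomial m) (exponents n k)
    = mps_coeff (h_perp_word k n (mps_monom m :: 'a :: field_char_0 mps)) 0"
  using assms
proof (induction m arbitrary: k rule: monom_nat_induct)
  case zero
  have "exponents n k = 0 \<longleftrightarrow> (\<forall>v\<in>{1..n}. k v = 0)"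
    by (auto simp: poly_mapping_eq_iff fun_eq_iff lookup_exponents)
  then show ?case by (simp add: power_sum_monomial_def h_perp_word_1 mps_coeff_one)
next
  case (add i m)
  have i: "i \<ge> 1" and m: "is_partition m"
    using add.prems by (auto simp: is_partition_def lookup_add lookup_single when_def split: if_splits)
  have "mps_coeff (mps_var i * f) 0 = 0" for f :: "'a mps"
  proof (rule mps_coeff_monom_mult_eq_0)
    fix b :: "nat \<Rightarrow>\<^sub>0 nat"
    have "Poly_Mapping.lookup (Poly_Mapping.single i (Suc 0) + b) i \<noteq> 0" by (simp add: lookup_add)
    then show "0 \<noteq> Poly_Mapping.single i (Suc 0) + b" by (metis lookup_zero)
  qed
  then show ?case
    unfolding power_sum_monomial_add_single mps_coeff_power_sum_mult[OF i] mps_monom_mult[symmetric]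
      h_perp_word_mult_var[OF i]
    using add.IH[OF m] by (simp del: fun_upd_apply)
qed

text \<open>A linear functional on power series is not determined by its values on monomials, but
  one that reads finitely many coefficients is. This carries the identity from the products of power
  sums to infinite series.\<close>

definition finitary :: "('a :: comm_ring_1 mps \<Rightarrow> 'a) \<Rightarrow> bool"
  where "finitary \<phi> \<longleftrightarrow> (\<exists>A c. finite A \<and> (\<forall>f. \<phi> f = (\<Sum>m\<in>A. c m * mps_coeff f m)))"

lemma finitary_coeff: "finitary (\<lambda>f. mps_coeff f m)"
  unfolding finitary_def by (intro exI[of _ "{m}"] exI[of _ "\<lambda>_. 1"]) simp

lemma finitary_cmult: "finitary \<phi> \<Longrightarrow> finitary (\<lambda>f. c * \<phi> f)"
proof -
  assume "finitary \<phi>"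
  then obtain A d where "finite A" "\<And>f. \<phi> f = (\<Sum>m\<in>A. d m * mps_coeff f m)"
    by (auto simp: finitary_def)
  then show ?thesis
    unfolding finitary_def
    by (intro exI[of _ A] exI[of _ "\<lambda>m. c * d m"]) (simp add: sum_distrib_left mult.assoc)
qed

lemma finitary_add: "finitary \<phi> \<Longrightarrow> finitary \<psi> \<Longrightarrow> finitary (\<lambda>f. \<phi> f + \<psi> f)"
proof -
  assume "finitary \<phi>" "finitary \<psi>"
  then obtain A c B d where *: "finite A" "\<And>f. \<phi> f = (\<Sum>m\<in>A. c m * mps_coeff f m)"
    "finite B" "\<And>f. \<psi> f = (\<Sum>m\<in>B. d m * mps_coeff f m)"
    unfolding finitary_def by metis
  have 1: "(\<Sum>m\<in>A. c m * mps_coeff f m) = (\<Sum>m\<in>A \<union> B. (if m \<in> A then c m else 0) * mps_coeff f m)" for f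
    using * by (intro sum.mono_neutral_cong_left) auto
  have 2: "(\<Sum>m\<in>B. d m * mps_coeff f m) = (\<Sum>m\<in>A \<union> B. (if m \<in> B then d m else 0) * mps_coeff f m)" for f
    using * by (intro sum.mono_neutral_cong_left) auto
  show ?thesis
    unfolding finitary_def using *(1,3)
    by (intro exI[of _ "A \<union> B"] exI[of _ "\<lambda>m. (if m \<in> A then c m else 0) + (if m \<in> B then d m else 0)"])
      (simp add: *(2,4) 1 2 distrib_right sum.distrib)
qed

lemma finitary_sum: "(\<And>i. i \<in> I \<Longrightarrow> finitary (\<phi> i)) \<Longrightarrow> finitary (\<lambda>f. \<Sum>i\<in>I. \<phi> i f)"
proof (induction I rule: infinite_finite_induct)
  case (insert i I)
  then show ?case by (simp add: finitary_add)
qed (use finitary_cmult[OF finitary_coeff, of 0] in simp_all)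

lemma finitary_compose:
  assumes "finitary \<phi>" "\<And>m. finitary (\<lambda>f. mps_coeff (T f) m)"
  shows "finitary (\<lambda>f. \<phi> (T f))"
proof -
  obtain A c where *: "\<And>f. \<phi> f = (\<Sum>m\<in>A. c m * mps_coeff f m)"
    using assms(1) by (auto simp: finitary_def)
  show ?thesis unfolding * by (intro finitary_sum finitary_cmult assms(2))
qed

lemma finitary_h_perp: "finitary (\<lambda>f. mps_coeff (h_perp k f) m)"
proof (induction k arbitrary: m rule: less_induct)
  case (less k)
  show ?case
  proof (cases k)
    case 0
    then show ?thesis by (simp add: finitary_coeff)
  next
    case (Suc k')
    show ?thesis
      unfolding Suc h_perp.simps mps_coeff_const_mult mps_coeff_sum mps_coeff_of_nat_mult mps_coeff_pderiv
      using less Suc by (intro finitary_cmult finitary_sum) auto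
  qed
qed

lemma finitary_h_perp_word: "finitary (\<lambda>f. mps_coeff (h_perp_word k n f) m)"
proof (induction n arbitrary: m)
  case 0
  then show ?case by (simp add: finitary_coeff)
next
  case (Suc n)
  then show ?case
    unfolding h_perp_word.simps
    by (rule finitary_compose[OF finitary_h_perp, of "h_perp_word k n"])
qed

lemma mps_coeff_in_x:
  fixes f :: "'a :: field_char_0 mps"
  assumes "\<And>m. mps_coeff f m \<noteq> 0 \<Longrightarrow> is_partition m"
  shows "mps_coeff (in_x f) (exponents n k) = mps_coeff (h_perp_word k n f) 0"
proof -
  let ?\<phi> = "\<lambda>f :: 'a mps. mps_coeff (h_perp_word k n f) 0"
  obtain A c where A: "finite A" "\<And>f. ?\<phi> f = (\<Sum>m\<in>A. c m * mps_coeff f m)"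
    using finitary_h_perp_word[of k n 0] unfolding finitary_def by blast
  \<comment> \<open>The weights \<open>c\<close> are recovered from the values on monomials, which
    \<open>mps_coeff_power_sum_monomial\<close> provides for partitions.\<close>
  have mon: "?\<phi> (mps_monom m) = (if m \<in> A then c m else 0)" for m
    unfolding A(2) using A(1) by (simp add: mps_coeff_monom if_distrib[of "(*) _"] cong: if_cong)
  have "mps_coeff f m * mps_coeff (power_sum_monomial m) (exponents n k)
      = mps_coeff f m * (if m \<in> A then c m else 0)" for m
    using assms[of m] by (cases "mps_coeff f m = 0") (auto simp: mps_coeff_power_sum_monomial mon)
  then have "mps_coeff (in_x f) (exponents n k) = Sum_any (\<lambda>m. mps_coeff f m * (if m \<in> A then c m else 0))"
    by (simp only: in_x_def mps_coeff_Abs)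
  also have "\<dots> = (\<Sum>m\<in>A. mps_coeff f m * (if m \<in> A then c m else 0))"
    using A(1) by (intro Sum_any.expand_superset) auto
  also have "\<dots> = ?\<phi> f" unfolding A(2) by (simp add: mult.commute)
  finally show ?thesis .
qed

text \<open>Multiplying out the power produces every word over \<open>S\<close> once; the sum over
  exponent tuples thereby becomes a power of a single operator.\<close>

lemma sum_h_perp_word:
  assumes "finite S"
  shows "(\<Sum>k\<in>{1..n} \<rightarrow>\<^sub>E S. h_perp_word k n f) = (h_perp_sum S 0 ^^ n) f"
proof (induction n)
  case (Suc n)
  have "(\<Sum>k\<in>{1..Suc n} \<rightarrow>\<^sub>E S. h_perp_word k (Suc n) f)
      = (\<Sum>k\<in>(\<lambda>(y, g). g(Suc n := y)) ` (S \<times> ({1..n} \<rightarrow>\<^sub>E S)). h_perp_word k (Suc n) f)"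
    by (simp add: atLeastAtMostSuc_conv PiE_insert_eq)
  also have "\<dots> = (\<Sum>(y, g)\<in>S \<times> ({1..n} \<rightarrow>\<^sub>E S). h_perp_word (g(Suc n := y)) (Suc n) f)"
    by (subst sum.reindex) (use inj_combinator[of "Suc n" "{1..n}" "\<lambda>_. S"] in \<open>auto simp: case_prod_unfold\<close>)
  also have "\<dots> = (\<Sum>y\<in>S. \<Sum>g\<in>{1..n} \<rightarrow>\<^sub>E S. h_perp y (h_perp_word g n f))"
    unfolding sum.cartesian_product
  proof (intro sum.cong refl, clarify)
    fix y g
    have "h_perp_word (g(Suc n := y)) n f = h_perp_word g n f"
      by (rule h_perp_word_cong) auto
    then show "h_perp_word (g(Suc n := y)) (Suc n) f = h_perp y (h_perp_word g n f)"
      by simp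
  qed
  also have "\<dots> = h_perp_sum S 0 ((h_perp_sum S 0 ^^ n) f)"
    unfolding mps_linear_sum[OF mps_linear_h_perp, symmetric] Suc by (simp add: h_perp_sum_def)
  finally show ?case by simp
qed simp

section \<open>The exponential of a skewing operator\<close>

text \<open>The series \<open>exp (t g\<^sup>\<bottom>) f\<close> where \<open>g = (\<Sum>k\<in>S. h\<^sub>k)\<close> and \<open>t\<close> is the variable with index 0.\<close>

definition exp_h_perp :: "nat set \<Rightarrow> 'a :: field_char_0 mps \<Rightarrow> 'a mps"
  where "exp_h_perp S f = Abs_mps (\<lambda>m. \<Sum>j\<le>Poly_Mapping.lookup m 0.
    mps_coeff ((h_perp_sum S 0 ^^ j) f) (m - Poly_Mapping.single 0 j) / fact j)"

lemma mps_coeff_exp_h_perp: "mps_coeff (exp_h_perp S f) m = (\<Sum>j\<le>Poly_Mapping.lookup m 0.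
    mps_coeff ((h_perp_sum S 0 ^^ j) f) (m - Poly_Mapping.single 0 j) / fact j)"
  by (simp add: exp_h_perp_def)

lemma mps_linear_exp_h_perp: "mps_linear (exp_h_perp S)"
proof -
  note lin = mps_linear_funpow[OF mps_linear_h_perp_sum[of S 0]]
  show ?thesis
    unfolding mps_linear_def
    by (auto intro!: mps_eqI simp: mps_coeff_exp_h_perp mps_linear_add[OF lin]
        mps_linear_const_mult[OF lin] sum.distrib add_divide_distrib sum_distrib_left)
qed

lemma mps_coeff_var_mult:
  "mps_coeff (mps_var i * f) m =
    (if Poly_Mapping.lookup m i = 0 then 0 else mps_coeff f (m - Poly_Mapping.single i 1))"
proof (cases "Poly_Mapping.lookup m i = 0")
  case True
  have "m \<noteq> Poly_Mapping.single i (Suc 0) + b" for b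
  proof
    assume "m = Poly_Mapping.single i (Suc 0) + b"
    then have "Poly_Mapping.lookup m i = Suc (Poly_Mapping.lookup b i)" by (simp add: lookup_add)
    then show False using True by simp
  qed
  then show ?thesis using True by (simp add: mps_coeff_monom_mult_eq_0)
next
  case False
  then have "m = Poly_Mapping.single i (Suc 0) + (m - Poly_Mapping.single i (Suc 0))"
    by (intro poly_mapping_eqI) (auto simp: lookup_add lookup_minus lookup_single when_def)
  then have "mps_coeff (mps_var i * f) m = mps_coeff f (m - Poly_Mapping.single i (Suc 0))"
    by (metis mps_coeff_monom_mult_add)
  then show ?thesis using False by simp
qed

lemma monom_diff_commute: "m - a - b = m - b - (a :: nat \<Rightarrow>\<^sub>0 nat)"
  by (rule poly_mapping_eqI) (simp add: lookup_minus)

lemma exp_h_perp_mult_var_0: "exp_h_perp S (mps_var 0 * f) = mps_var 0 * exp_h_perp S f"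
proof (rule mps_eqI)
  fix m :: "nat \<Rightarrow>\<^sub>0 nat"
  have pow: "(h_perp_sum S 0 ^^ j) (mps_var 0 * f) = mps_var 0 * (h_perp_sum S 0 ^^ j) f" for j
    using funpow_h_perp_sum_commute[of "(*) (mps_var 0)" S j f] by (simp add: h_perp_sum_mult_var_0)
  let ?c = "\<lambda>j m. mps_coeff ((h_perp_sum S 0 ^^ j) f) m / fact j"
  show "mps_coeff (exp_h_perp S (mps_var 0 * f)) m = mps_coeff (mps_var 0 * exp_h_perp S f) m"
  proof (cases "Poly_Mapping.lookup m 0")
    case 0
    then show ?thesis
      by (simp add: mps_coeff_exp_h_perp pow mps_coeff_var_mult lookup_minus)
  next
    case (Suc n)
    have "mps_coeff (exp_h_perp S (mps_var 0 * f)) m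
        = (\<Sum>j\<le>Suc n. if j = Suc n then 0 else ?c j (m - Poly_Mapping.single 0 j - Poly_Mapping.single 0 1))"
      unfolding mps_coeff_exp_h_perp Suc
      by (intro sum.cong) (auto simp: pow mps_coeff_var_mult lookup_minus Suc)
    also have "\<dots> = (\<Sum>j\<le>n. ?c j (m - Poly_Mapping.single 0 1 - Poly_Mapping.single 0 j))"
      by (intro sum.mono_neutral_cong_right) (auto simp: monom_diff_commute)
    also have "\<dots> = mps_coeff (mps_var 0 * exp_h_perp S f) m"
      by (simp add: mps_coeff_var_mult Suc mps_coeff_exp_h_perp lookup_minus)
    finally show ?thesis .
  qed
qed

text \<open>Read from right to left, multiplication by p_i moves inside the exponential at the price
  of -t times the commutator. The expansion ends with this linear term because the commutator
  commutes with g^perp.\<close>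

lemma exp_h_perp_mult_var:
  assumes "finite S" "i \<ge> 1"
  shows "exp_h_perp S (mps_var i * f - mps_var 0 * h_perp_sum S i f) = mps_var i * exp_h_perp S f"
proof (rule mps_eqI)
  fix m :: "nat \<Rightarrow>\<^sub>0 nat"
  let ?g = "h_perp_sum S 0" and ?n = "Poly_Mapping.lookup m 0" and ?e = "\<lambda>j. Poly_Mapping.single 0 j"
  have i0: "Poly_Mapping.lookup (m - ?e j) i = Poly_Mapping.lookup m i" for j
    using assms by (simp add: lookup_minus lookup_single when_def)
  have A: "mps_coeff (exp_h_perp S (mps_var i * f)) m
      = mps_coeff (mps_var i * exp_h_perp S f) m
        + (\<Sum>j<?n. mps_coeff ((?g ^^ j) (h_perp_sum S i f)) (m - ?e (Suc j)) / fact j)"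
  proof -
    \<comment> \<open>The power 0 has no commutator term; for j = l + 1 the factor j cancels against
      j! and leaves l!.\<close>
    let ?t = "\<lambda>j. case j of 0 \<Rightarrow> 0 | Suc l \<Rightarrow> mps_coeff ((?g ^^ l) (h_perp_sum S i f)) (m - ?e (Suc l)) / fact l"
    have "mps_coeff (exp_h_perp S (mps_var i * f)) m
        = (\<Sum>j\<le>?n. mps_coeff (mps_var i * (?g ^^ j) f) (m - ?e j) / fact j + ?t j)"
      unfolding mps_coeff_exp_h_perp
    proof (rule sum.cong)
      fix j
      show "mps_coeff ((?g ^^ j) (mps_var i * f)) (m - ?e j) / fact j
          = mps_coeff (mps_var i * (?g ^^ j) f) (m - ?e j) / fact j + ?t j"
      proof (cases j)
        case (Suc l)
        have "of_nat (Suc l) * c / fact (Suc l) = c / fact l" for c :: 'a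
          by (simp del: of_nat_Suc add: fact_Suc)
        then show ?thesis
          unfolding Suc funpow_h_perp_sum_mult_var[OF assms]
          by (simp del: of_nat_Suc funpow.simps fact_Suc add: add_divide_distrib)
      qed simp
    qed simp
    also have "\<dots> = (\<Sum>j\<le>?n. mps_coeff (mps_var i * (?g ^^ j) f) (m - ?e j) / fact j) + (\<Sum>j\<le>?n. ?t j)"
      by (rule sum.distrib)
    also have "(\<Sum>j\<le>?n. ?t j) = (\<Sum>j<?n. mps_coeff ((?g ^^ j) (h_perp_sum S i f)) (m - ?e (Suc j)) / fact j)"
      unfolding sum.atMost_shift by simp
    also have "(\<Sum>j\<le>?n. mps_coeff (mps_var i * (?g ^^ j) f) (m - ?e j) / fact j)
        = mps_coeff (mps_var i * exp_h_perp S f) m"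
      unfolding mps_coeff_var_mult i0
      using assms(2)
      by (auto simp: mps_coeff_exp_h_perp lookup_minus lookup_single when_def monom_diff_commute)
    finally show ?thesis .
  qed
  have B: "mps_coeff (exp_h_perp S (mps_var 0 * h_perp_sum S i f)) m
      = (\<Sum>j<?n. mps_coeff ((?g ^^ j) (h_perp_sum S i f)) (m - ?e (Suc j)) / fact j)"
  proof -
    have e: "m - ?e 1 - ?e j = m - ?e (Suc j)" for j
      by (rule poly_mapping_eqI) (simp add: lookup_minus lookup_single when_def)
    show ?thesis
    proof (cases ?n)
      case (Suc n)
      then show ?thesis
        unfolding exp_h_perp_mult_var_0 mps_coeff_var_mult mps_coeff_exp_h_perp e
        by (simp add: lookup_minus lessThan_Suc_atMost)
    qed (simp add: exp_h_perp_mult_var_0 mps_coeff_var_mult)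
  qed
  show "mps_coeff (exp_h_perp S (mps_var i * f - mps_var 0 * h_perp_sum S i f)) m
      = mps_coeff (mps_var i * exp_h_perp S f) m"
    unfolding mps_linear_diff[OF mps_linear_exp_h_perp] mps_coeff_diff A B by simp
qed

lemma pderiv_mps_eq_0D:
  fixes f :: "'a :: field_char_0 mps"
  assumes "pderiv_mps i f = 0" "Poly_Mapping.lookup m i \<noteq> 0"
  shows "mps_coeff f m = 0"
proof -
  define m' where "m' = m - Poly_Mapping.single i (Suc 0)"
  have m: "m = Poly_Mapping.single i (Suc 0) + m'"
    using assms(2) by (intro poly_mapping_eqI) (auto simp: m'_def lookup_add lookup_minus lookup_single when_def)
  have "of_nat (Suc (Poly_Mapping.lookup m' i)) * mps_coeff f m = mps_coeff (pderiv_mps i f) m'"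
    by (simp add: mps_coeff_pderiv m)
  then show ?thesis using assms(1) by (simp del: of_nat_Suc)
qed

text \<open>If \<open>f\<close> is free of t, so are the powers of g^perp applied to it, and t^a
  arises from the summand with j = a only.\<close>

lemma mps_coeff_exp_h_perp_eq:
  assumes "pderiv_mps 0 f = 0"
  shows "mps_coeff (exp_h_perp S f) m = mps_coeff ((h_perp_sum S 0 ^^ Poly_Mapping.lookup m 0) f)
    (m - Poly_Mapping.single 0 (Poly_Mapping.lookup m 0)) / fact (Poly_Mapping.lookup m 0)"
proof -
  have "pderiv_mps 0 ((h_perp_sum S 0 ^^ j) f) = 0" for j
    using funpow_h_perp_sum_commute[of "pderiv_mps 0" S j f] assms
      mps_linear_0[OF mps_linear_funpow[OF mps_linear_h_perp_sum]]
    by (simp add: h_perp_sum_pderiv)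
  then have "mps_coeff ((h_perp_sum S 0 ^^ j) f) (m - Poly_Mapping.single 0 j) = 0"
    if "j < Poly_Mapping.lookup m 0" for j
    using that by (intro pderiv_mps_eq_0D[of 0]) (auto simp: lookup_minus)
  then have "mps_coeff (exp_h_perp S f) m = (\<Sum>j\<in>{Poly_Mapping.lookup m 0}.
      mps_coeff ((h_perp_sum S 0 ^^ j) f) (m - Poly_Mapping.single 0 j) / fact j)"
    unfolding mps_coeff_exp_h_perp by (intro sum.mono_neutral_right) auto
  then show ?thesis by simp
qed

lemma pderiv_exp_h_perp:
  assumes "pderiv_mps 0 f = 0"
  shows "pderiv_mps 0 (exp_h_perp S f) = exp_h_perp S (h_perp_sum S 0 f)"
proof (rule mps_eqI)
  fix m :: "nat \<Rightarrow>\<^sub>0 nat"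
  let ?n = "Poly_Mapping.lookup m 0"
  have g: "pderiv_mps 0 (h_perp_sum S 0 f) = 0"
    by (simp add: assms mps_linear_0[OF mps_linear_h_perp_sum] flip: h_perp_sum_pderiv)
  have e: "Poly_Mapping.single 0 (Suc 0) + m - Poly_Mapping.single 0 (Suc ?n) = m - Poly_Mapping.single 0 ?n"
    by (rule poly_mapping_eqI) (simp add: lookup_add lookup_minus lookup_single when_def)
  have pow: "(h_perp_sum S 0 ^^ Suc ?n) f = (h_perp_sum S 0 ^^ ?n) (h_perp_sum S 0 f)"
    by (simp add: funpow_swap1)
  have c: "of_nat (Suc ?n) * c / fact (Suc ?n) = c / fact ?n" for c :: 'a
    by (simp del: of_nat_Suc add: fact_Suc)
  show "mps_coeff (pderiv_mps 0 (exp_h_perp S f)) m = mps_coeff (exp_h_perp S (h_perp_sum S 0 f)) m"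
    unfolding mps_coeff_pderiv mps_coeff_exp_h_perp_eq[OF assms] mps_coeff_exp_h_perp_eq[OF g]
    by (simp add: lookup_add e c pow[symmetric] del: of_nat_Suc funpow.simps fact_Suc)
qed

lemma funpow_pderiv_exp_h_perp:
  assumes "pderiv_mps 0 f = 0"
  shows "(pderiv_mps 0 ^^ b) (exp_h_perp S f) = exp_h_perp S ((h_perp_sum S 0 ^^ b) f)"
proof (induction b)
  case (Suc b)
  have "pderiv_mps 0 ((h_perp_sum S 0 ^^ b) f) = 0"
    using funpow_h_perp_sum_commute[of "pderiv_mps 0" S b f] assms
      mps_linear_0[OF mps_linear_funpow[OF mps_linear_h_perp_sum]]
    by (simp add: h_perp_sum_pderiv)
  then show ?case using Suc by (simp add: pderiv_exp_h_perp)
qed simp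

section \<open>A dimension count\<close>

definition poly_deg :: "nat set \<Rightarrow> nat \<Rightarrow> 'a :: comm_ring_1 mps set"
  where "poly_deg W e = {p. \<forall>m. mps_coeff p m \<noteq> 0 \<longrightarrow> Poly_Mapping.keys m \<subseteq> W \<and> total_degree m \<le> e}"

lemma poly_deg_mono: "p \<in> poly_deg W e \<Longrightarrow> e \<le> e' \<Longrightarrow> p \<in> poly_deg W e'"
  by (fastforce simp: poly_deg_def)

lemma poly_deg_add: "p \<in> poly_deg W e \<Longrightarrow> q \<in> poly_deg W e \<Longrightarrow> p + q \<in> poly_deg W e"
  unfolding poly_deg_def mem_Collect_eq mps_coeff_add by (metis add.right_neutral)

lemma poly_deg_const_mult: "p \<in> poly_deg W e \<Longrightarrow> mps_const c * p \<in> poly_deg W e"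
  unfolding poly_deg_def mem_Collect_eq mps_coeff_const_mult by (metis mult_zero_right)

lemma poly_deg_0: "0 \<in> poly_deg W e"
  by (simp add: poly_deg_def)

lemma poly_deg_sum: "(\<And>i. i \<in> A \<Longrightarrow> f i \<in> poly_deg W e) \<Longrightarrow> sum f A \<in> poly_deg W e"
  by (induction A rule: infinite_finite_induct) (auto intro: poly_deg_add poly_deg_0)

lemma poly_deg_mult:
  assumes "p \<in> poly_deg W d" "q \<in> poly_deg W e"
  shows "p * q \<in> poly_deg W (d + e)"
  unfolding poly_deg_def
proof (intro CollectI allI impI)
  fix m assume "mps_coeff (p * q) m \<noteq> 0"
  then obtain a b where "m = a + b" "mps_coeff p a \<noteq> 0" "mps_coeff q b \<noteq> 0"
    by (rule mps_mult_support)
  then show "Poly_Mapping.keys m \<subseteq> W \<and> total_degree m \<le> d + e"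
    using assms by (auto simp: poly_deg_def keys_add_nat total_degree_add intro: add_mono)
qed

lemma poly_deg_var: "i \<in> W \<Longrightarrow> mps_var i \<in> poly_deg W 1"
  by (auto simp: poly_deg_def mps_coeff_monom total_degree_def split: if_splits)

lemma poly_deg_pderiv:
  assumes "p \<in> poly_deg W e"
  shows "pderiv_mps i p \<in> poly_deg W e"
  unfolding poly_deg_def
proof (intro CollectI allI impI)
  fix m assume "mps_coeff (pderiv_mps i p) m \<noteq> 0"
  then have "mps_coeff p (Poly_Mapping.single i 1 + m) \<noteq> 0" by (auto simp: mps_coeff_pderiv)
  then have "Poly_Mapping.keys (Poly_Mapping.single i 1 + m) \<subseteq> W \<and> total_degree (Poly_Mapping.single i 1 + m) \<le> e"
    using assms unfolding poly_deg_def by blast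
  then show "Poly_Mapping.keys m \<subseteq> W \<and> total_degree m \<le> e"
    by (simp add: keys_add_nat total_degree_add)
qed

lemma poly_deg_of_polys_in:
  assumes "finite P" "P \<subseteq> polys_in V" "V \<subseteq> W"
  shows "\<exists>e. P \<subseteq> poly_deg W e"
proof -
  define A where "A = (\<Union>p\<in>P. {m. mps_coeff p m \<noteq> 0})"
  have "finite A" using assms by (auto simp: A_def polys_in_def)
  then have "total_degree m \<le> (\<Sum>m\<in>A. total_degree m)" if "m \<in> A" for m
    using that by (intro member_le_sum) auto
  then have "P \<subseteq> poly_deg W (\<Sum>m\<in>A. total_degree m)"
    using assms by (fastforce simp: poly_deg_def polys_in_def A_def)
  then show ?thesis ..
qed

text \<open>The level \<open>n\<close> of a filtration of the module generated by \<open>H\<close> over the operators in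
  \<open>mps_var i\<close> and \<open>pderiv_mps i\<close>; each of these operators raises the level by at most one.\<close>

definition level :: "'a :: field_char_0 mps set \<Rightarrow> 'a mps \<Rightarrow> nat set \<Rightarrow> nat \<Rightarrow> nat \<Rightarrow> 'a mps set"
  where "level H Q W d n = {f. \<exists>p. (\<forall>h\<in>H. p h \<in> poly_deg W (Suc d * n)) \<and> Q ^ n * f = (\<Sum>h\<in>H. p h * h)}"

lemma
  shows level_add: "f \<in> level H Q W d n \<Longrightarrow> g \<in> level H Q W d n \<Longrightarrow> f + g \<in> level H Q W d n"
    and level_const_mult: "f \<in> level H Q W d n \<Longrightarrow> mps_const c * f \<in> level H Q W d n"
    and level_0: "0 \<in> level H Q W d n"
proof -
  assume "f \<in> level H Q W d n"
  then obtain p where p: "\<And>h. h \<in> H \<Longrightarrow> p h \<in> poly_deg W (Suc d * n)" "Q ^ n * f = (\<Sum>h\<in>H. p h * h)"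
    by (auto simp: level_def)
  show "mps_const c * f \<in> level H Q W d n"
    unfolding level_def using p
    by (intro CollectI exI[of _ "\<lambda>h. mps_const c * p h"])
      (simp add: poly_deg_const_mult sum_distrib_left mult.left_commute mult.assoc del: mult_Suc)
  assume "g \<in> level H Q W d n"
  then obtain q where q: "\<And>h. h \<in> H \<Longrightarrow> q h \<in> poly_deg W (Suc d * n)" "Q ^ n * g = (\<Sum>h\<in>H. q h * h)"
    by (auto simp: level_def)
  show "f + g \<in> level H Q W d n"
    unfolding level_def using p q
    by (intro CollectI exI[of _ "\<lambda>h. p h + q h"])
      (simp add: poly_deg_add distrib_left distrib_right sum.distrib del: mult_Suc)
next
  show "0 \<in> level H Q W d n"
    unfolding level_def by (intro CollectI exI[of _ "\<lambda>_. 0"]) (simp add: poly_deg_0)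
qed

lemma level_sum: "(\<And>i. i \<in> A \<Longrightarrow> f i \<in> level H Q W d n) \<Longrightarrow> sum f A \<in> level H Q W d n"
  by (induction A rule: infinite_finite_induct) (auto intro: level_add level_0)

lemma level_of_nat_mult: "f \<in> level H Q W d n \<Longrightarrow> of_nat k * f \<in> level H Q W d n"
  using level_const_mult[of f H Q W d n "of_nat k"] by (simp only: mps_const_of_nat)

text \<open>Each step costs one factor \<open>Q\<close>. The bound \<open>Suc d\<close> per level
  leaves room for \<open>Q\<close>, of degree at most \<open>d\<close>, together with one
  variable.\<close>

lemma level_Suc_mult:
  assumes "f \<in> level H Q W d n" "Q * r \<in> poly_deg W (Suc d)"
  shows "r * f \<in> level H Q W d (Suc n)"
proof -
  obtain p where p: "\<And>h. h \<in> H \<Longrightarrow> p h \<in> poly_deg W (Suc d * n)" "Q ^ n * f = (\<Sum>h\<in>H. p h * h)"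
    using assms(1) by (auto simp: level_def)
  have "Q ^ Suc n * (r * f) = (Q * r) * (Q ^ n * f)" by (simp add: mult_ac)
  also have "\<dots> = (\<Sum>h\<in>H. ((Q * r) * p h) * h)"
    unfolding p(2) by (simp add: sum_distrib_left mult.assoc)
  finally show ?thesis
    unfolding level_def using poly_deg_mult[OF assms(2) p(1)]
    by (intro CollectI exI[of _ "\<lambda>h. (Q * r) * p h"]) (simp add: add.commute)
qed

lemma level_mono:
  assumes "f \<in> level H Q W d n" "Q \<in> poly_deg W d" "n \<le> n'"
  shows "f \<in> level H Q W d n'"
  using assms(3)
proof (induction n' rule: dec_induct)
  case (step n')
  then show ?case
    using level_Suc_mult[of f H Q W d n' 1] poly_deg_mono[OF assms(2), of "Suc d"] by simp
qed (rule assms(1))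

lemma level_var_mult:
  assumes "f \<in> level H Q W d n" "Q \<in> poly_deg W d" "i \<in> W"
  shows "mps_var i * f \<in> level H Q W d (Suc n)"
  using poly_deg_mult[OF assms(2) poly_deg_var[OF assms(3)]]
  by (intro level_Suc_mult[OF assms(1)]) simp

text \<open>This is the quotient rule for a numerator over Q^n, written without division. The system
  replaces \<open>Q\<close> times the derivative of a generator by coefficients of degree at most
  \<open>d\<close>, so numerator degrees grow by at most \<open>d\<close>.\<close>

lemma level_pderiv:
  assumes "finite H" "f \<in> level H Q W d n" "Q \<in> poly_deg W d"
    and system: "\<And>h. h \<in> H \<Longrightarrow> \<exists>p. (\<forall>h'\<in>H. p h' \<in> poly_deg W d) \<and> Q * pderiv_mps i h = (\<Sum>h'\<in>H. p h' * h')"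
  shows "pderiv_mps i f \<in> level H Q W d (Suc n)"
proof -
  obtain p where p: "\<And>h. h \<in> H \<Longrightarrow> p h \<in> poly_deg W (Suc d * n)" "Q ^ n * f = (\<Sum>h\<in>H. p h * h)"
    using assms(2) by (auto simp: level_def)
  obtain r where r: "\<And>h h'. h \<in> H \<Longrightarrow> h' \<in> H \<Longrightarrow> r h h' \<in> poly_deg W d"
    "\<And>h. h \<in> H \<Longrightarrow> Q * pderiv_mps i h = (\<Sum>h'\<in>H. r h h' * h')"
    using system by metis
  \<comment> \<open>The extra factor \<open>Q\<close> avoids the exponent n - 1, which would be
    truncated at n = 0.\<close>
  have pow: "pderiv_mps i (Q ^ n) * Q = of_nat n * pderiv_mps i Q * Q ^ n"
  proof (induction n)
    case 0
    have "pderiv_mps i (1 :: 'a mps) = 0"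
      using pderiv_mps_mult[of i "1 :: 'a mps" 1] by (simp only: mult_1_left mult_1_right add_cancel_right_right)
    then show ?case by simp
  next
    case (Suc n)
    have "pderiv_mps i (Q ^ Suc n) * Q = pderiv_mps i Q * Q ^ Suc n + Q * (pderiv_mps i (Q ^ n) * Q)"
      by (simp add: pderiv_mps_mult algebra_simps)
    then show ?case unfolding Suc by (simp add: algebra_simps)
  qed
  define s where "s h = Q * pderiv_mps i (p h) + (\<Sum>h'\<in>H. p h' * r h' h)
      + mps_const (- of_nat n) * (pderiv_mps i Q * p h)" for h
  have "Q ^ Suc n * pderiv_mps i f = Q * pderiv_mps i (Q ^ n * f) - of_nat n * pderiv_mps i Q * (Q ^ n * f)"
  proof -
    have "Q * pderiv_mps i (Q ^ n * f) = (pderiv_mps i (Q ^ n) * Q) * f + Q ^ Suc n * pderiv_mps i f"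
      by (simp add: pderiv_mps_mult algebra_simps)
    then show ?thesis unfolding pow by (simp add: algebra_simps)
  qed
  also have "Q * pderiv_mps i (Q ^ n * f)
      = (\<Sum>h\<in>H. Q * pderiv_mps i (p h) * h) + (\<Sum>h\<in>H. p h * (Q * pderiv_mps i h))"
    unfolding p(2) by (simp add: pderiv_mps_sum pderiv_mps_mult sum_distrib_left sum.distrib algebra_simps)
  also have "(\<Sum>h\<in>H. p h * (Q * pderiv_mps i h)) = (\<Sum>h\<in>H. \<Sum>h'\<in>H. p h * (r h h' * h'))"
    by (intro sum.cong) (simp_all add: r(2) sum_distrib_left)
  also have "\<dots> = (\<Sum>h'\<in>H. (\<Sum>h\<in>H. p h * r h h') * h')"
    by (subst sum.swap) (simp add: sum_distrib_right mult.assoc)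
  also have "of_nat n * pderiv_mps i Q * (Q ^ n * f) = (\<Sum>h\<in>H. of_nat n * pderiv_mps i Q * p h * h)"
    unfolding p(2) by (simp add: sum_distrib_left mult.assoc)
  finally have "Q ^ Suc n * pderiv_mps i f = (\<Sum>h\<in>H. s h * h)"
    by (simp add: s_def distrib_right sum.distrib mps_const_uminus mps_const_of_nat left_diff_distrib sum_subtractf mult.assoc)
  moreover have "s h \<in> poly_deg W (Suc d * Suc n)" if h: "h \<in> H" for h
    unfolding s_def
  proof (intro poly_deg_add poly_deg_sum poly_deg_const_mult)
    have e: "d + Suc d * n \<le> Suc d * Suc n" "Suc d * n + d \<le> Suc d * Suc n" by simp_all
    show "Q * pderiv_mps i (p h) \<in> poly_deg W (Suc d * Suc n)"
      using poly_deg_mult[OF assms(3) poly_deg_pderiv[OF p(1)[OF h]]] e(1) by (rule poly_deg_mono)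
    show "pderiv_mps i Q * p h \<in> poly_deg W (Suc d * Suc n)"
      using poly_deg_mult[OF poly_deg_pderiv[OF assms(3)] p(1)[OF h]] e(1) by (rule poly_deg_mono)
    fix h' assume h': "h' \<in> H"
    show "p h' * r h' h \<in> poly_deg W (Suc d * Suc n)"
      using poly_deg_mult[OF p(1)[OF h'] r(1)[OF h' h]] e(2) by (rule poly_deg_mono)
  qed
  ultimately show ?thesis unfolding level_def by blast
qed

text \<open>h_k^perp is a combination of products of at most k derivations, and each derivation
  raises the level by at most one.\<close>

lemma level_h_perp:
  assumes "\<And>i n f. 1 \<le> i \<Longrightarrow> i \<le> k \<Longrightarrow> f \<in> level H Q W d n \<Longrightarrow> pderiv_mps i f \<in> level H Q W d (Suc n)"
    and "Q \<in> poly_deg W d" "f \<in> level H Q W d n"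
  shows "h_perp k f \<in> level H Q W d (n + k)"
  using assms(1)
proof (induction k rule: less_induct)
  case (less k)
  show ?case
  proof (cases k)
    case 0
    then show ?thesis using assms(3) by simp
  next
    case (Suc k')
    have "pderiv_mps (Suc i) (h_perp (k' - i) f) \<in> level H Q W d (n + k)" if "i \<le> k'" for i
    proof -
      have "h_perp (k' - i) f \<in> level H Q W d (n + (k' - i))"
        using less Suc by simp
      then have "pderiv_mps (Suc i) (h_perp (k' - i) f) \<in> level H Q W d (Suc (n + (k' - i)))"
        using that Suc by (intro less.prems) auto
      then show ?thesis by (rule level_mono[OF _ assms(2)]) (use that Suc in auto)
    qed
    then show ?thesis
      unfolding Suc h_perp.simps by (intro level_const_mult level_sum level_of_nat_mult) auto
  qed
qed

text \<open>The claim concerns a family, not its set of values. Two equal members would collapse in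
  that set; they are treated apart and give the relation v_i - v_j = 0.\<close>

lemma linear_dependence:
  fixes v :: "'i \<Rightarrow> 'a :: field mps"
  assumes "finite I" "finite B" "card B < card I"
    and span: "\<And>i. i \<in> I \<Longrightarrow> \<exists>c. v i = (\<Sum>b\<in>B. mps_const (c b) * b)"
  obtains c where "\<exists>i\<in>I. c i \<noteq> 0" "(\<Sum>i\<in>I. mps_const (c i) * v i) = 0"
proof -
  interpret vector_space "\<lambda>c (f :: 'a mps). mps_const c * f" by (rule vector_space_mps)
  have vB: "v ` I \<subseteq> span B"
  proof
    fix x assume "x \<in> v ` I"
    then obtain i where i: "i \<in> I" "x = v i" by blast
    then obtain c where x: "x = (\<Sum>b\<in>B. mps_const (c b) * b)" using span by blast
    show "x \<in> local.span B" unfolding x by (intro span_sum span_scale span_base)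
  qed
  show thesis
  proof (cases "inj_on v I")
    case True
    then have "card (v ` I) = card I" by (rule card_image)
    then have "dependent (v ` I)"
      using independent_span_bound[OF assms(2) _ vB] assms(3) by force
    then obtain c where c: "\<exists>x\<in>v ` I. c x \<noteq> 0" "(\<Sum>x\<in>v ` I. mps_const (c x) * x) = 0"
      using dependent_finite[of "v ` I"] assms(1) by auto
    show thesis
    proof (rule that[of "\<lambda>i. c (v i)"])
      show "\<exists>i\<in>I. c (v i) \<noteq> 0" using c(1) by auto
      show "(\<Sum>i\<in>I. mps_const (c (v i)) * v i) = 0"
        using c(2) by (simp add: sum.reindex[OF True])
    qed
  next
    case False
    then obtain i j where ij: "i \<in> I" "j \<in> I" "i \<noteq> j" "v i = v j" by (auto simp: inj_on_def)
    let ?c = "\<lambda>l. if l = i then 1 else if l = j then - 1 else (0 :: 'a)"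
    have "(\<Sum>l\<in>I. mps_const (?c l) * v l) = (\<Sum>l\<in>{i, j}. mps_const (?c l) * v l)"
      using ij assms(1) by (intro sum.mono_neutral_right) auto
    also have "\<dots> = 0" using ij by (simp add: mps_const_uminus)
    finally have "(\<Sum>l\<in>I. mps_const (?c l) * v l) = 0" .
    moreover have "\<exists>l\<in>I. ?c l \<noteq> 0"
      using ij(1) by (rule rev_bexI) simp
    ultimately show thesis using that[of ?c] by blast
  qed
qed

section \<open>Elimination of the power sums\<close>

lemma mps_coeff_set_other_vars_zero:
  "mps_coeff (set_other_vars_zero V f) m = (if Poly_Mapping.keys m \<subseteq> V then mps_coeff f m else 0)"
  by (simp add: set_other_vars_zero_def)

lemma set_other_vars_zero_pderiv:
  assumes "i \<in> V"
  shows "set_other_vars_zero V (pderiv_mps i f) = pderiv_mps i (set_other_vars_zero V f)"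
  by (rule mps_eqI)
    (use assms in \<open>simp add: mps_coeff_set_other_vars_zero mps_coeff_pderiv keys_add_nat\<close>)

lemma set_other_vars_zero_monom_mult:
  assumes "Poly_Mapping.keys a \<subseteq> V"
  shows "set_other_vars_zero V (mps_monom a * f) = mps_monom a * set_other_vars_zero V f"
proof (rule mps_eqI)
  fix m
  show "mps_coeff (set_other_vars_zero V (mps_monom a * f)) m = mps_coeff (mps_monom a * set_other_vars_zero V f) m"
  proof (cases "\<exists>b. m = a + b")
    case True
    then obtain b where m: "m = a + b" ..
    show ?thesis using assms
      unfolding m mps_coeff_monom_mult_add mps_coeff_set_other_vars_zero keys_add_nat by simp
  next
    case False
    then show ?thesis by (auto simp: mps_coeff_set_other_vars_zero mps_coeff_monom_mult_eq_0)
  qed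
qed

text \<open>The p-part of a monomial in t and the p_i; its total degree is what the elimination
  minimises.\<close>

definition tail_monom :: "(nat \<Rightarrow>\<^sub>0 nat) \<Rightarrow> (nat \<Rightarrow>\<^sub>0 nat)"
  where "tail_monom m = m - Poly_Mapping.single 0 (Poly_Mapping.lookup m 0)"

lemma lookup_tail_monom: "Poly_Mapping.lookup (tail_monom m) i = (if i = 0 then 0 else Poly_Mapping.lookup m i)"
  by (simp add: tail_monom_def lookup_minus lookup_single when_def)

lemma monom_split: "m = Poly_Mapping.single 0 (Poly_Mapping.lookup m 0) + tail_monom m"
  by (rule poly_mapping_eqI) (simp add: lookup_add lookup_tail_monom lookup_single when_def)

lemma tail_monom_add: "tail_monom (a + b) = tail_monom a + tail_monom b"
  by (rule poly_mapping_eqI) (simp add: lookup_add lookup_tail_monom)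

lemma tail_monom_single_add: "tail_monom (Poly_Mapping.single 0 n + tail_monom m) = tail_monom m"
  by (rule poly_mapping_eqI) (simp add: lookup_add lookup_tail_monom lookup_single when_def)

lemma total_degree_eq_0: "total_degree m = 0 \<longleftrightarrow> m = 0"
proof
  assume "total_degree m = 0"
  then have "Poly_Mapping.lookup m i = 0" for i
    using lookup_le_total_degree[of m i] by simp
  then show "m = 0" by (intro poly_mapping_eqI) simp
qed (simp add: total_degree_def)

text \<open>Comparing coefficients at a monomial in \<open>p\<^sub>1, p\<^sub>2, \<dots>\<close> of least degree turns a linear relation
  between the series \<open>p\<^sup>m \<partial>\<^sup>b F/\<partial>t\<^sup>b\<close> into a differential equation at \<open>p = 0\<close>.\<close>

lemma D_finite_fin_eliminate:
  fixes F :: "'a :: field_char_0 mps"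
  assumes "finite A" and nz: "\<exists>x\<in>A. c x \<noteq> 0"
    and rel: "(\<Sum>(m, b)\<in>A. mps_const (c (m, b)) * (mps_monom m * (pderiv_mps 0 ^^ b) F)) = 0"
  shows "D_finite_fin {0} (set_other_vars_zero {0} F)"
proof -
  let ?w = "\<lambda>x :: (nat \<Rightarrow>\<^sub>0 nat) \<times> nat. total_degree (tail_monom (fst x))"
  obtain x0 where x0: "x0 \<in> A" "c x0 \<noteq> 0" and min: "\<And>x. x \<in> A \<Longrightarrow> c x \<noteq> 0 \<Longrightarrow> ?w x0 \<le> ?w x"
    using ex_has_least_nat[of "\<lambda>x. x \<in> A \<and> c x \<noteq> 0" _ ?w] nz by blast
  obtain m0 b0 where mb: "x0 = (m0, b0)" by (cases x0)
  let ?\<pi> = "set_other_vars_zero {0} :: 'a mps \<Rightarrow> 'a mps"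
  let ?D = "\<lambda>b. (pderiv_mps 0 ^^ b) F"
  \<comment> \<open>These terms share the very p-part of \<open>x0\<close>, not merely its degree:
    the coefficient at a single monomial in p is compared.\<close>
  define B where "B = {x \<in> A. tail_monom (fst x) = tail_monom m0}"
  define t where "t m = (mps_monom (Poly_Mapping.single 0 (Poly_Mapping.lookup m 0)) :: 'a mps)"
    for m :: "nat \<Rightarrow>\<^sub>0 nat"
  define q where "q b = (\<Sum>x | x \<in> B \<and> snd x = b. mps_const (c x) * t (fst x))" for b
  define r where "r = Max (snd ` A)"
  have fin: "finite B" using assms(1) by (simp add: B_def)
  have r: "b \<le> r" if "(m, b) \<in> A" for m b
    unfolding r_def using assms(1) that by (intro Max_ge) force+
  have \<pi>D: "?\<pi> (?D b) = (pderiv_mps 0 ^^ b) (?\<pi> F)" for b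
    by (induction b) (simp_all add: set_other_vars_zero_pderiv)
  have \<pi>t: "?\<pi> (t m * f) = t m * ?\<pi> f" for m f
    unfolding t_def by (rule set_other_vars_zero_monom_mult) simp
  show ?thesis
  proof (rule D_finite_fin_if_ODE[of q 0 b0 r])
    show "q b \<in> polys_in {0}" for b
      unfolding q_def t_def by (intro polys_in_sum polys_in_const_mult polys_in_monom) simp
    show "b0 \<le> r" using r x0 by (simp add: mb)
    \<comment> \<open>Members of \<open>B\<close> with the same order \<open>b0\<close> differ in
      their exponents of t, so their contributions cannot cancel.\<close>
    show "q b0 \<noteq> 0"
    proof -
      have "mps_coeff (q b0) (Poly_Mapping.single 0 (Poly_Mapping.lookup m0 0))
          = (\<Sum>x | x \<in> B \<and> snd x = b0. if x = x0 then c x else 0)"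
        unfolding q_def mps_coeff_sum mps_coeff_const_mult
      proof (rule sum.cong)
        fix x assume x: "x \<in> {x \<in> B. snd x = b0}"
        have "Poly_Mapping.single (0 :: nat) (Poly_Mapping.lookup m0 0)
            = Poly_Mapping.single 0 (Poly_Mapping.lookup (fst x) 0) \<longleftrightarrow> x = x0"
        proof
          assume *: "Poly_Mapping.single (0 :: nat) (Poly_Mapping.lookup m0 0)
            = Poly_Mapping.single 0 (Poly_Mapping.lookup (fst x) 0)"
          have tl: "tail_monom (fst x) = tail_monom m0" using x by (simp add: B_def)
          have "fst x = Poly_Mapping.single 0 (Poly_Mapping.lookup (fst x) 0) + tail_monom (fst x)"
            by (rule monom_split)
          also have "\<dots> = Poly_Mapping.single 0 (Poly_Mapping.lookup m0 0) + tail_monom m0"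
            by (simp only: * tl)
          also have "\<dots> = m0" by (rule monom_split[symmetric])
          finally have "fst x = m0" .
          then show "x = x0" using x by (cases x) (simp add: mb)
        next
          assume "x = x0"
          then have "fst x = m0" by (simp only: mb fst_conv)
          then show "Poly_Mapping.single (0 :: nat) (Poly_Mapping.lookup m0 0)
            = Poly_Mapping.single 0 (Poly_Mapping.lookup (fst x) 0)"
            by (simp only:)
        qed
        then show "c x * mps_coeff (t (fst x)) (Poly_Mapping.single 0 (Poly_Mapping.lookup m0 0))
            = (if x = x0 then c x else 0)"
          unfolding t_def mps_coeff_monom by (simp only:) simp
      qed simp
      also have "\<dots> = c x0"
      proof -
        have "x0 \<in> {x. x \<in> B \<and> snd x = b0}" using x0 by (simp add: B_def mb)
        then show ?thesis using fin by (subst sum.delta) auto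
      qed
      finally show ?thesis using x0 by auto
    qed
    have sum: "(\<Sum>b\<le>r. q b * (pderiv_mps 0 ^^ b) (?\<pi> F))
        = ?\<pi> (\<Sum>x\<in>B. mps_const (c x) * (t (fst x) * ?D (snd x)))"
    proof -
      have "(\<Sum>b\<le>r. q b * (pderiv_mps 0 ^^ b) (?\<pi> F))
          = (\<Sum>b\<le>r. \<Sum>x | x \<in> B \<and> snd x = b. mps_const (c x) * (t (fst x) * ?\<pi> (?D (snd x))))"
        unfolding q_def sum_distrib_right by (intro sum.cong) (auto simp: \<pi>D mult.assoc)
      also have "\<dots> = (\<Sum>x\<in>B. mps_const (c x) * (t (fst x) * ?\<pi> (?D (snd x))))"
        by (rule sum.group) (use fin r in \<open>auto simp: B_def\<close>)
      also have "\<dots> = ?\<pi> (\<Sum>x\<in>B. mps_const (c x) * (t (fst x) * ?D (snd x)))"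
        by (simp add: mps_linear_sum[OF mps_linear_set_other_vars_zero]
            mps_linear_const_mult[OF mps_linear_set_other_vars_zero] \<pi>t)
      finally show ?thesis .
    qed
    have coeff: "mps_coeff (\<Sum>x\<in>B. mps_const (c x) * (t (fst x) * ?D (snd x))) (Poly_Mapping.single 0 n) = 0" for n
    proof -
      let ?m = "Poly_Mapping.single 0 n + tail_monom m0"
      have "0 = mps_coeff (\<Sum>(m, b)\<in>A. mps_const (c (m, b)) * (mps_monom m * ?D b)) ?m"
        unfolding rel by simp
      also have "\<dots> = (\<Sum>x\<in>A. c x * mps_coeff (mps_monom (fst x) * ?D (snd x)) ?m)"
        by (simp add: case_prod_unfold)
      also have "\<dots> = (\<Sum>x\<in>B. c x * mps_coeff (t (fst x) * ?D (snd x)) (Poly_Mapping.single 0 n))"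
      proof (rule sum.mono_neutral_cong_right)
        \<comment> \<open>The p-part of a term with nonzero coefficient has at least the degree of
          the p-part of \<open>x0\<close>, so it divides the latter only if both are equal; then the
          term lies in \<open>B\<close>.\<close>
        show "\<forall>x\<in>A - B. c x * mps_coeff (mps_monom (fst x) * ?D (snd x)) ?m = 0"
        proof
          fix x assume x: "x \<in> A - B"
          show "c x * mps_coeff (mps_monom (fst x) * ?D (snd x)) ?m = 0"
          proof (cases "c x = 0")
            case False
            have "?m \<noteq> fst x + d" for d
            proof
              assume "?m = fst x + d"
              then have *: "tail_monom m0 = tail_monom (fst x) + tail_monom d"
                by (metis tail_monom_single_add tail_monom_add)
              then have "?w x0 = ?w x + total_degree (tail_monom d)"
                by (simp add: mb total_degree_add)
              moreover have "?w x0 \<le> ?w x" using min x False by auto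
              ultimately have "tail_monom d = 0" by (simp flip: total_degree_eq_0)
              then have "x \<in> B" using * x by (simp add: B_def)
              then show False using x by simp
            qed
            then show ?thesis by (simp add: mps_coeff_monom_mult_eq_0)
          qed simp
        qed
        fix x assume "x \<in> B"
        then have tl: "tail_monom (fst x) = tail_monom m0" by (simp add: B_def)
        have "mps_monom (fst x) = mps_monom (tail_monom m0) * t (fst x)"
          unfolding t_def mps_monom_mult using monom_split[of "fst x"] by (simp add: tl add.commute)
        then have "mps_coeff (mps_monom (fst x) * ?D (snd x)) ?m
            = mps_coeff (mps_monom (tail_monom m0) * (t (fst x) * ?D (snd x)))
                (tail_monom m0 + Poly_Mapping.single 0 n)"
          by (simp add: mult.assoc add.commute)
        then show "c x * mps_coeff (mps_monom (fst x) * ?D (snd x)) ?m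
            = c x * mps_coeff (t (fst x) * ?D (snd x)) (Poly_Mapping.single 0 n)"
          by (simp add: mps_coeff_monom_mult_add)
      qed (use assms(1) in \<open>auto simp: B_def\<close>)
      finally show ?thesis by simp
    qed
    show "(\<Sum>b\<le>r. q b * (pderiv_mps 0 ^^ b) (?\<pi> F)) = 0"
    proof (rule mps_eqI)
      fix m :: "nat \<Rightarrow>\<^sub>0 nat"
      show "mps_coeff (\<Sum>b\<le>r. q b * (pderiv_mps 0 ^^ b) (?\<pi> F)) m = mps_coeff 0 m"
      proof (cases "Poly_Mapping.keys m \<subseteq> {0}")
        case True
        have m: "Poly_Mapping.single 0 (Poly_Mapping.lookup m 0) = m"
          by (rule poly_mapping_eqI) (use True in \<open>auto simp: lookup_single when_def in_keys_iff\<close>)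
        show ?thesis
          unfolding sum mps_coeff_set_other_vars_zero coeff[of "Poly_Mapping.lookup m 0", unfolded m]
          by (simp only: if_cancel mps_coeff_zero)
      next
        case False
        then show ?thesis unfolding sum mps_coeff_set_other_vars_zero by simp
      qed
    qed
  qed
qed

text \<open>The powers of \<open>mps_var i\<close> and \<open>\<partial>/\<partial>t\<close> applied to \<open>exp (t g\<^sup>\<bottom>) f\<close> are images under
  \<open>exp (t g\<^sup>\<bottom>)\<close> of series in a filtration whose \<open>n\<close>-th level has dimension \<open>O(n\<^bsup>N+1\<^esup>)\<close>,
  while there are more than \<open>n\<^bsup>N+2\<^esup>\<close> of them up to order \<open>n\<close>.\<close>

lemma D_finite_exp_h_perp:
  fixes f :: "'a :: field_char_0 mps"
  assumes S: "S \<subseteq> {..N}" and f0: "pderiv_mps 0 f = 0" and "D_finite_fin {1..N} f"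
  shows "D_finite_fin {0} (set_other_vars_zero {0} (exp_h_perp S f))"
proof -
  obtain H Q where H: "finite H" "f \<in> H" and Q: "Q \<in> polys_in {1..N}" "Q \<noteq> 0"
    and sys: "\<And>i h. i \<in> {1..N} \<Longrightarrow> h \<in> H \<Longrightarrow>
      \<exists>p. (\<forall>h'\<in>H. p h' \<in> polys_in {1..N}) \<and> Q * pderiv_mps i h = (\<Sum>h'\<in>H. p h' * h')"
    by (rule D_finite_fin_system[OF _ assms(3)]) (rule finite_atLeastAtMost, blast)
  define R where "R i h p \<longleftrightarrow> (\<forall>h'\<in>H. p h' \<in> polys_in {1..N})
      \<and> Q * pderiv_mps i h = (\<Sum>h'\<in>H. p h' * h')" for i h p
  have "\<exists>p. R i h p" if "i \<in> {1..N}" "h \<in> H" for i h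
    unfolding R_def using that by (rule sys)
  then obtain p where R: "\<And>i h. i \<in> {1..N} \<Longrightarrow> h \<in> H \<Longrightarrow> R i h (p i h)"
    by metis
  have p: "p i h h' \<in> polys_in {1..N}" and p_sum: "Q * pderiv_mps i h = (\<Sum>h'\<in>H. p i h h' * h')"
    if "i \<in> {1..N}" "h \<in> H" "h' \<in> H" for i h h'
    using R[OF that(1,2)] that(3) by (simp_all add: R_def)
  \<comment> \<open>The numerators involve t as well. This set of N + 1 variables supplies the
    exponent N + 1 in the count.\<close>
  define W where "W = {0..N}"
  have fS: "finite S" using S by (rule finite_subset) simp
  define P where "P = insert Q ((\<lambda>(i, h, h'). p i h h') ` ({1..N} \<times> H \<times> H))"
  have "finite P" "P \<subseteq> polys_in {1..N}" using p Q H by (auto simp: P_def)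
  then obtain d where d: "P \<subseteq> poly_deg W d"
    using poly_deg_of_polys_in[of P "{1..N}" W] by (auto simp: W_def)
  have Qd: "Q \<in> poly_deg W d" using d by (simp add: P_def)
  define L where "L = level H Q W d"
  have L_pderiv: "pderiv_mps i g \<in> L (Suc n)" if "1 \<le> i" "i \<le> N" "g \<in> L n" for i n g
    unfolding L_def
  proof (rule level_pderiv[OF H(1) _ Qd])
    show "g \<in> level H Q W d n" using that by (simp add: L_def)
    fix h assume h: "h \<in> H"
    have "p i h h' \<in> P" if "h' \<in> H" for h'
      unfolding P_def using h \<open>1 \<le> i\<close> \<open>i \<le> N\<close> that
      by (intro insertI2 image_eqI[of _ _ "(i, h, h')"]) auto
    then show "\<exists>p. (\<forall>h'\<in>H. p h' \<in> poly_deg W d) \<and> Q * pderiv_mps i h = (\<Sum>h'\<in>H. p h' * h')"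
      using p_sum[of i h h] that h d by (intro exI[of _ "p i h"] conjI ballI) auto
  qed
  have L_g: "h_perp_sum S j g \<in> L (n + N)" if "g \<in> L n" for j n g
    unfolding h_perp_sum_def L_def
  proof (rule level_sum)
    fix k assume "k \<in> {k. k \<in> S \<and> j \<le> k}"
    then have k: "k - j \<le> N" using S by auto
    then have "h_perp (k - j) g \<in> level H Q W d (n + (k - j))"
      using that L_pderiv by (intro level_h_perp Qd) (auto simp: L_def)
    then show "h_perp (k - j) g \<in> level H Q W d (n + N)"
      by (rule level_mono[OF _ Qd]) (use k in simp)
  qed
  have L_var: "mps_var i * g \<in> L (Suc n)" if "i \<le> N" "g \<in> L n" for i n g
    using that unfolding L_def by (intro level_var_mult Qd) (auto simp: W_def)
  have L_f: "f \<in> L 0"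
    unfolding L_def level_def
  proof (intro CollectI exI[of _ "\<lambda>h. if h = f then 1 else 0"] conjI ballI)
    show "(if h = f then 1 else 0) \<in> poly_deg W (Suc d * 0)" for h
      by (auto simp: poly_deg_def mps_coeff_one total_degree_def)
    show "Q ^ 0 * f = (\<Sum>h\<in>H. (if h = f then 1 else 0) * h)"
      using H by (simp add: if_distrib[of "\<lambda>x. x * _"] cong: if_cong)
  qed
  let ?F = "exp_h_perp S f"
  \<comment> \<open>A factor p_i costs at most N + 1 levels, N for the commutator and one for its
    factor t; a derivative in t costs N.\<close>
  have ex: "\<exists>v \<in> L (Suc N * (total_degree m + b)). exp_h_perp S v = mps_monom m * (pderiv_mps 0 ^^ b) ?F"
    if "Poly_Mapping.keys m \<subseteq> W" for m b
    using that
  proof (induction m rule: monom_nat_induct)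
    case zero
    have "(h_perp_sum S 0 ^^ b) f \<in> L (Suc N * b)"
    proof (induction b)
      case (Suc b)
      have "h_perp_sum S 0 ((h_perp_sum S 0 ^^ b) f) \<in> L (Suc N * b + N)"
        using Suc by (rule L_g)
      then show ?case
        unfolding L_def funpow.simps comp_def by (rule level_mono[OF _ Qd]) simp
    qed (simp add: L_f)
    then show ?case
      by (intro bexI[of _ "(h_perp_sum S 0 ^^ b) f"])
        (simp_all add: funpow_pderiv_exp_h_perp[OF f0] total_degree_def del: mult_Suc)
  next
    case (add i m)
    let ?n = "Suc N * (total_degree m + b)"
    have i: "i \<le> N" and m: "Poly_Mapping.keys m \<subseteq> W"
      using add.prems by (auto simp: keys_add_nat W_def)
    obtain v where v: "v \<in> L ?n" "exp_h_perp S v = mps_monom m * (pderiv_mps 0 ^^ b) ?F"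
      using add.IH[OF m] by blast
    have n: "Suc N * (total_degree (Poly_Mapping.single i (Suc 0) + m) + b) = Suc (?n + N)"
    proof -
      have "total_degree (Poly_Mapping.single i (Suc 0)) = 1" by (simp add: total_degree_def)
      then show ?thesis by (simp add: total_degree_add)
    qed
    have mon: "mps_monom (Poly_Mapping.single i (Suc 0) + m) * (pderiv_mps 0 ^^ b) ?F
        = mps_var i * exp_h_perp S v"
      by (simp add: v(2) mps_monom_mult[symmetric] mult.assoc)
    define u where "u = mps_var i * v + (if i = 0 then 0 else mps_const (- 1) * (mps_var 0 * h_perp_sum S i v))"
    have "mps_var i * v \<in> L (Suc (?n + N))"
      using L_var[OF i v(1)] unfolding L_def by (rule level_mono[OF _ Qd]) simp
    moreover have "mps_const (- 1) * (mps_var 0 * h_perp_sum S i v) \<in> L (Suc (?n + N))"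
      unfolding L_def by (intro level_const_mult) (use L_var[OF _ L_g[OF v(1)]] in \<open>simp add: L_def\<close>)
    ultimately have "u \<in> L (Suc (?n + N))"
      unfolding u_def L_def by (auto intro: level_add level_0)
    moreover have "exp_h_perp S u = mps_var i * exp_h_perp S v"
      using exp_h_perp_mult_var[OF fS, of i v] exp_h_perp_mult_var_0[of S v]
      by (cases "i = 0") (simp_all add: u_def mps_const_uminus)
    ultimately show ?case unfolding n mon by blast
  qed
  \<comment> \<open>With all exponents and \<open>b\<close> up to M, the order is at most (N + 1) M
    + M, the level at most \<open>n\<close>, and numerators have degree at most C M. So
    \<open>G\<close> below has at most card H times ((C + 1) (M + 1))^(N+1) elements. The choice of
    \<open>M\<close> turns this into M (M + 1)^(N+1), less than the (M + 1)^(N+2) indices in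
    \<open>I\<close>.\<close>
  define C where "C = Suc d * (Suc N * (N + 2))"
  define M where "M = card H * (C + 1) ^ (N + 1)"
  define Bx where "Bx e = {a :: nat \<Rightarrow>\<^sub>0 nat. Poly_Mapping.keys a \<subseteq> W \<and> (\<forall>i. Poly_Mapping.lookup a i \<le> e)}" for e
  have Bx: "finite (Bx e)" "card (Bx e) = (e + 1) ^ (N + 1)" for e
    unfolding Bx_def by (simp_all add: finite_bounded_keys card_bounded_keys W_def)
  define n where "n = Suc N * ((N + 2) * M)"
  have small: "total_degree m + b \<le> (N + 2) * M" if "m \<in> Bx M" "b \<le> M" for m b
  proof -
    have "total_degree m = (\<Sum>i\<in>W. Poly_Mapping.lookup m i)"
      using that by (intro total_degree_superset) (auto simp: Bx_def W_def)
    also have "\<dots> \<le> card W * M"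
      using that sum_bounded_above[of W "Poly_Mapping.lookup m" M] by (simp add: Bx_def)
    finally show ?thesis using that by (simp add: W_def algebra_simps)
  qed
  define R' where "R' m b v \<longleftrightarrow> v \<in> L n \<and> exp_h_perp S v = mps_monom m * (pderiv_mps 0 ^^ b) ?F" for m b v
  have "\<exists>v. R' m b v" if "m \<in> Bx M" "b \<le> M" for m b
  proof -
    have "Poly_Mapping.keys m \<subseteq> W" using that by (simp add: Bx_def)
    then obtain v where v: "v \<in> L (Suc N * (total_degree m + b))"
      "exp_h_perp S v = mps_monom m * (pderiv_mps 0 ^^ b) ?F"
      using ex by blast
    have "v \<in> L n"
      using v(1) unfolding L_def n_def
      by (rule level_mono[OF _ Qd]) (use small[OF that] mult_le_mono2 in blast)
    then have "R' m b v" using v(2) by (simp add: R'_def)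
    then show ?thesis ..
  qed
  then obtain v where "\<And>m b. m \<in> Bx M \<Longrightarrow> b \<le> M \<Longrightarrow> R' m b (v m b)"
    by metis
  then have v: "v m b \<in> L n" "exp_h_perp S (v m b) = mps_monom m * (pderiv_mps 0 ^^ b) ?F"
    if "m \<in> Bx M" "b \<le> M" for m b
    using that by (simp_all add: R'_def)
  define I where "I = Bx M \<times> {..M}"
  define G where "G = (\<lambda>(a, h). mps_monom a * h) ` (Bx (Suc d * n) \<times> H)"
  have le_CM: "Suc d * n + 1 \<le> (C + 1) * (M + 1)"
    by (simp add: n_def C_def algebra_simps)
  have "card G \<le> (Suc d * n + 1) ^ (N + 1) * card H"
  proof -
    have "card G \<le> card (Bx (Suc d * n) \<times> H)"
      unfolding G_def using Bx H by (intro card_image_le) auto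
    then show ?thesis unfolding card_cartesian_product Bx(2) .
  qed
  also have "(Suc d * n + 1) ^ (N + 1) * card H \<le> ((C + 1) * (M + 1)) ^ (N + 1) * card H"
    by (rule mult_le_mono1, rule power_mono[OF le_CM]) simp
  also have "\<dots> = (card H * (C + 1) ^ (N + 1)) * (M + 1) ^ (N + 1)"
    unfolding power_mult_distrib by (simp only: mult_ac)
  also have "card H * (C + 1) ^ (N + 1) = M" by (simp only: M_def)
  also have "M * (M + 1) ^ (N + 1) < (M + 1) * (M + 1) ^ (N + 1)"
    by (rule mult_strict_right_mono) simp_all
  also have "\<dots> = card I" by (simp add: I_def Bx)
  finally have card: "card G < card I" .
  have fin: "finite I" "finite G" using Bx H by (auto simp: I_def G_def)
  \<comment> \<open>Only the multiples by Q^n lie in the span of \<open>G\<close>; the factor is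
    cancelled again once a relation has been found.\<close>
  have "\<exists>c. Q ^ n * case_prod v x = (\<Sum>b\<in>G. mps_const (c b) * b)" if "x \<in> I" for x
  proof -
    interpret vector_space "\<lambda>c (f :: 'a mps). mps_const c * f" by (rule vector_space_mps)
    have "case_prod v x \<in> L n" using v that by (auto simp: I_def)
    then obtain r where r: "\<And>h. h \<in> H \<Longrightarrow> r h \<in> poly_deg W (Suc d * n)"
      "Q ^ n * case_prod v x = (\<Sum>h\<in>H. r h * h)"
      unfolding L_def level_def mem_Collect_eq by metis
    have "r h * h \<in> span G" if "h \<in> H" for h
    proof -
      have "r h = (\<Sum>a\<in>Bx (Suc d * n). mps_const (mps_coeff (r h) a) * mps_monom a)"
      proof (rule mps_eqI)
        fix m
        have "m \<in> Bx (Suc d * n)" if "mps_coeff (r h) m \<noteq> 0"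
        proof -
          have "Poly_Mapping.keys m \<subseteq> W" "total_degree m \<le> Suc d * n"
            using r(1)[OF \<open>h \<in> H\<close>] that by (simp_all add: poly_deg_def del: mult_Suc)
          then show ?thesis
            using lookup_le_total_degree[of m] le_trans unfolding Bx_def by blast
        qed
        then have "mps_coeff (r h) m = 0" if "m \<notin> Bx (Suc d * n)"
          using that by blast
        then show "mps_coeff (r h) m
            = mps_coeff (\<Sum>a\<in>Bx (Suc d * n). mps_const (mps_coeff (r h) a) * mps_monom a) m"
          using Bx(1) by (simp add: mps_coeff_monom if_distrib[of "(*) _"] cong: if_cong)
      qed
      then have "r h * h = (\<Sum>a\<in>Bx (Suc d * n). mps_const (mps_coeff (r h) a) * mps_monom a) * h"
        by (rule arg_cong2[OF _ refl])
      also have "\<dots> = (\<Sum>a\<in>Bx (Suc d * n). mps_const (mps_coeff (r h) a) * (mps_monom a * h))"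
        by (simp only: sum_distrib_right mult.assoc)
      also have "\<dots> \<in> span G"
        using that by (intro span_sum span_scale span_base) (auto simp: G_def)
      finally show ?thesis .
    qed
    then have "Q ^ n * case_prod v x \<in> span G" unfolding r(2) by (rule span_sum)
    then show ?thesis unfolding span_finite[OF fin(2)] by auto
  qed
  then obtain c where c: "\<exists>x\<in>I. c x \<noteq> 0" "(\<Sum>x\<in>I. mps_const (c x) * (Q ^ n * case_prod v x)) = 0"
    using linear_dependence[OF fin card, of "\<lambda>x. Q ^ n * case_prod v x"] by blast
  have "Q ^ n * (\<Sum>x\<in>I. mps_const (c x) * case_prod v x) = 0"
    using c(2) by (simp add: sum_distrib_left mult.left_commute)
  then have "(\<Sum>x\<in>I. mps_const (c x) * case_prod v x) = 0" using Q(2) by simp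
  \<comment> \<open>The exponential is linear, so the relation carries over to the series t^a p^m
    d_t^b F with the same coefficients, not all of them zero.\<close>
  then have "exp_h_perp S (\<Sum>x\<in>I. mps_const (c x) * case_prod v x) = 0"
    by (simp add: mps_linear_0[OF mps_linear_exp_h_perp])
  then have "(\<Sum>x\<in>I. mps_const (c x) * exp_h_perp S (case_prod v x)) = 0"
    by (simp only: mps_linear_sum[OF mps_linear_exp_h_perp] mps_linear_const_mult[OF mps_linear_exp_h_perp])
  also have "(\<Sum>x\<in>I. mps_const (c x) * exp_h_perp S (case_prod v x))
      = (\<Sum>(m, b)\<in>I. mps_const (c (m, b)) * (mps_monom m * (pderiv_mps 0 ^^ b) ?F))"
    by (intro sum.cong) (auto simp: I_def v)
  finally show ?thesis using fin(1) c(1) by (intro D_finite_fin_eliminate[of I c])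
qed

lemma set_other_vars_zero_exp_h_perp:
  assumes "pderiv_mps 0 f = 0"
  shows "set_other_vars_zero {0} (exp_h_perp S f)
    = mps_of_fps (Abs_fps (\<lambda>n. mps_coeff ((h_perp_sum S 0 ^^ n) f) 0 / fact n))"
proof (rule mps_eqI)
  fix m :: "nat \<Rightarrow>\<^sub>0 nat"
  have "m - Poly_Mapping.single 0 (Poly_Mapping.lookup m 0) = 0" if "Poly_Mapping.keys m \<subseteq> {0}"
    by (rule poly_mapping_eqI)
      (use that in \<open>auto simp: lookup_minus lookup_single when_def in_keys_iff\<close>)
  then show "mps_coeff (set_other_vars_zero {0} (exp_h_perp S f)) m
      = mps_coeff (mps_of_fps (Abs_fps (\<lambda>n. mps_coeff ((h_perp_sum S 0 ^^ n) f) 0 / fact n))) m"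
    by (simp add: mps_coeff_set_other_vars_zero mps_of_fps_def mps_coeff_exp_h_perp_eq[OF assms])
qed

text \<open>Only p_1, ..., p_N are differentiated by g^perp, so setting all other variables to 0
  first leaves the constant terms unchanged, and it frees the index 0 for t.\<close>

lemma D_finite_fps_h_perp:
  fixes f :: "'a :: field_char_0 mps"
  assumes "S \<subseteq> {..N}" "D_finite_fin {1..N} (set_other_vars_zero {1..N} f)"
  shows "D_finite_fps (Abs_fps (\<lambda>n. mps_coeff ((h_perp_sum S 0 ^^ n) f) 0 / fact n))"
proof -
  let ?\<pi> = "set_other_vars_zero {1..N} :: 'a mps \<Rightarrow> 'a mps"
  have 0: "pderiv_mps 0 (?\<pi> f) = 0"
    by (rule mps_eqI) (simp add: mps_coeff_pderiv mps_coeff_set_other_vars_zero keys_add_nat)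
  have "?\<pi> ((h_perp_sum S 0 ^^ n) f) = (h_perp_sum S 0 ^^ n) (?\<pi> f)" for n
    using assms(1)
    by (intro funpow_h_perp_sum_commute h_perp_sum_commute[where N = N])
      (auto simp: mps_linear_set_other_vars_zero set_other_vars_zero_pderiv)
  then have "mps_coeff ((h_perp_sum S 0 ^^ n) (?\<pi> f)) 0 = mps_coeff ((h_perp_sum S 0 ^^ n) f) 0" for n
    by (metis mps_coeff_set_other_vars_zero keys_zero empty_subsetI)
  then show ?thesis
    using D_finite_exp_h_perp[OF assms(1) 0 assms(2)]
    unfolding set_other_vars_zero_exp_h_perp[OF 0] D_finite_fps_def by simp
qed

section \<open>Cycle types of permutations\<close>

text \<open>A computed counterpart of \<open>has_cycle_type\<close>. Being a sum over cycles on an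
  arbitrary label set, it suits inductions that add points or remove cycles.\<close>

definition cycle_type :: "nat set \<Rightarrow> (nat \<Rightarrow> nat) \<Rightarrow> (nat \<Rightarrow>\<^sub>0 nat)"
  where "cycle_type A \<sigma> = (\<Sum>C\<in>Orbits.orbit \<sigma> ` A. Poly_Mapping.single (card C) 1)"

lemma lookup_cycle_type:
  assumes "finite A"
  shows "Poly_Mapping.lookup (cycle_type A \<sigma>) i = card {C \<in> Orbits.orbit \<sigma> ` A. card C = i}"
proof -
  have "Poly_Mapping.lookup (cycle_type A \<sigma>) i = (\<Sum>C\<in>Orbits.orbit \<sigma> ` A. if card C = i then 1 else 0)"
    by (simp add: cycle_type_def lookup_sum lookup_single when_def del: One_nat_def)
  also have "\<dots> = card {C \<in> Orbits.orbit \<sigma> ` A. card C = i}"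
    using assms by (simp add: sum.If_cases Int_def)
  finally show ?thesis .
qed

lemma has_cycle_type_iff: "has_cycle_type n \<sigma> m \<longleftrightarrow> \<sigma> permutes {1..n} \<and> m = cycle_type {1..n} \<sigma>"
  unfolding has_cycle_type_def by (auto simp: lookup_cycle_type intro!: poly_mapping_eqI)

context
  fixes A :: "nat set" and \<sigma> :: "nat \<Rightarrow> nat"
  assumes finA: "finite A" and \<sigma>: "\<sigma> permutes A"
begin

lemma permutes_self_in_orbit: "x \<in> Orbits.orbit \<sigma> x"
  using \<sigma> finA by (intro permutation_self_in_orbit) (auto simp: permutation_permutes)

lemma permutes_finite_orbit: "finite (Orbits.orbit \<sigma> x)"
  by (rule finite_orbit[OF permutes_self_in_orbit])

lemma permutes_orbit_eq: "y \<in> Orbits.orbit \<sigma> x \<Longrightarrow> Orbits.orbit \<sigma> y = Orbits.orbit \<sigma> x"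
  by (rule orbit_cyclic_eq3[OF cyclic_on_orbit[OF \<sigma> finA]])

lemma permutes_Union_orbits: "\<Union> (Orbits.orbit \<sigma> ` A) = A"
  using permutes_orbit_subset[OF \<sigma>] permutes_self_in_orbit by blast

lemma permutes_orbits_disjoint:
  "C \<in> Orbits.orbit \<sigma> ` A \<Longrightarrow> D \<in> Orbits.orbit \<sigma> ` A \<Longrightarrow> C \<noteq> D \<Longrightarrow> C \<inter> D = {}"
  using permutes_orbit_eq by blast

lemma permutes_card_orbit_pos: "card (Orbits.orbit \<sigma> x) > 0"
  using permutes_finite_orbit orbit_nonempty[of \<sigma> x] by (simp add: card_gt_0_iff)

end

lemma partition_size_superset:
  assumes "finite V" "Poly_Mapping.keys m \<subseteq> V"
  shows "partition_size m = (\<Sum>i\<in>V. i * Poly_Mapping.lookup m i)"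
  unfolding partition_size_def
  by (rule sum.mono_neutral_left) (use assms in \<open>auto simp: not_in_keys_iff_lookup_eq_zero\<close>)

lemma partition_size_add: "partition_size (a + b) = partition_size a + partition_size b"
  using partition_size_superset[of "Poly_Mapping.keys (a + b)"]
  by (simp add: keys_add_nat lookup_add distrib_left sum.distrib)

lemma partition_size_single: "partition_size (Poly_Mapping.single k 1) = k"
  by (simp add: partition_size_def)

lemma partition_size_cycle_type:
  assumes "finite A" "\<sigma> permutes A"
  shows "partition_size (cycle_type A \<sigma>) = card A"
proof -
  have sum: "partition_size (\<Sum>C\<in>X. Poly_Mapping.single (card C) 1) = (\<Sum>C\<in>X. card C)" for X :: "nat set set"
    by (induction X rule: infinite_finite_induct)
      (simp_all add: partition_size_add partition_size_single[simplified], simp_all add: partition_size_def)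
  have "card (\<Union> (Orbits.orbit \<sigma> ` A)) = (\<Sum>C\<in>Orbits.orbit \<sigma> ` A. card C)"
    using permutes_orbits_disjoint[OF assms] permutes_finite_orbit[OF assms]
    by (intro card_Union_disjoint) (auto simp: pairwise_def disjnt_def)
  then show ?thesis
    unfolding cycle_type_def sum using permutes_Union_orbits[OF assms] by simp
qed

text \<open>Multiplying a permutation of \<open>A\<close> by a transposition of a new point \<open>a\<close> with \<open>b \<in> A\<close>
  inserts \<open>a\<close> into the cycle of \<open>b\<close>.\<close>

lemma cycle_type_transpose_comp:
  assumes "finite A" "q permutes A" "a \<notin> A" "b \<in> A"
  shows "cycle_type (insert a A) (transpose a b \<circ> q) + Poly_Mapping.single (card (Orbits.orbit q b)) 1
    = cycle_type A q + Poly_Mapping.single (Suc (card (Orbits.orbit q b))) 1"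
proof -
  let ?C = "Orbits.orbit q b"
  define p where "p = transpose a b \<circ> q"
  have q: "q permutes insert a A" using assms(2) by (rule permutes_subset) auto
  have "transpose a b permutes insert a A" using assms(4) by (intro permutes_swap_id) auto
  then have p: "p permutes insert a A" unfolding p_def using q by (rule permutes_compose[rotated])
  have fin: "finite (insert a A)" using assms by simp
  have qa: "q a = a" using assms by (simp add: permutes_not_in)
  have q_ne_a: "q y \<noteq> a" if "y \<in> A" for y
    using permutes_in_image[OF assms(2), of y] that assms(3) by auto
  have p_a: "p a = b" by (simp add: p_def qa)
  have p_b: "p y = a" if "q y = b" for y using that by (simp add: p_def)
  have p_q: "p y = q y" if "y \<in> A" "q y \<noteq> b" for y
    using that q_ne_a[OF that(1)] by (simp add: p_def transpose_def)
  have C_A: "?C \<subseteq> A" using permutes_orbit_subset[OF assms(2,4)] .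
  have b_C: "b \<in> ?C" using permutes_self_in_orbit[OF assms(1,2)] .
  \<comment> \<open>The permutations \<open>p\<close> and \<open>q\<close> differ only at
    \<open>a\<close> and at the preimage of \<open>b\<close> under \<open>q\<close>, so cycles that
    avoid both are the same.\<close>
  have other: "Orbits.orbit p x = Orbits.orbit q x" if "x \<in> A" "x \<notin> ?C" for x
  proof (rule orbit_cong[OF permutes_self_in_orbit[OF assms(1,2)]])
    fix y assume y: "y \<in> Orbits.orbit q x"
    have "b \<notin> Orbits.orbit q x"
      using permutes_orbit_eq[OF assms(1,2), of b x] that permutes_self_in_orbit[OF assms(1,2), of x] by blast
    then have "q y \<noteq> b" using Orbits.orbit.step[OF y] by auto
    moreover have "y \<in> A" using permutes_orbit_subset[OF assms(2) that(1)] y by auto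
    ultimately show "p y = q y" by (intro p_q)
  qed
  have a: "Orbits.orbit p a = insert a ?C"
  proof
    show "Orbits.orbit p a \<subseteq> insert a ?C"
    proof
      fix y assume "y \<in> Orbits.orbit p a"
      then show "y \<in> insert a ?C"
      proof induction
        case base
        then show ?case using p_a b_C by simp
      next
        case (step y)
        show ?case
        proof (cases "y = a")
          case True
          then show ?thesis using p_a b_C by simp
        next
          case False
          then have y: "y \<in> ?C" using step.IH by simp
          then have "q y \<in> ?C" by (rule Orbits.orbit.step)
          then show ?thesis using p_b[of y] p_q[of y] y C_A by (cases "q y = b") auto
        qed
      qed
    qed
    have pa: "b \<in> Orbits.orbit p a" using Orbits.orbit.base[of p a] p_a by simp
    have "y \<in> Orbits.orbit p a" if "y \<in> ?C" for y
      using that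
    proof induction
      case base
      show ?case
        using Orbits.orbit.step[OF pa] p_q[OF assms(4)] pa by (cases "q b = b") auto
    next
      case (step y)
      show ?case
      proof (cases "q y = b")
        case False
        have "y \<in> A" using step.hyps C_A by auto
        then show ?thesis
          using Orbits.orbit.step[OF step.IH] p_q[of y] False by simp
      qed (use pa in simp)
    qed
    then show "insert a ?C \<subseteq> Orbits.orbit p a"
      using permutes_self_in_orbit[OF fin p] by auto
  qed
  have C_orb: "Orbits.orbit p x = insert a ?C" if "x \<in> ?C" for x
    using permutes_orbit_eq[OF fin p, of x a] a that by simp
  define R where "R = Orbits.orbit q ` (A - ?C)"
  have split: "f ` A = f ` ?C \<union> f ` (A - ?C)" for f :: "nat \<Rightarrow> nat set"
    by (simp only: image_Un[symmetric] Un_Diff_cancel Un_absorb1[OF C_A])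
  have "Orbits.orbit p ` ?C = (\<lambda>_. insert a ?C) ` ?C"
    by (rule image_cong[OF refl C_orb])
  also have "\<dots> = {insert a ?C}" by (rule image_constant[OF b_C])
  finally have img_C: "Orbits.orbit p ` ?C = {insert a ?C}" .
  have "Orbits.orbit p ` (A - ?C) = R" unfolding R_def using other by (intro image_cong) auto
  then have img_p: "Orbits.orbit p ` insert a A = insert (insert a ?C) R"
    unfolding image_insert split img_C a by simp
  have "Orbits.orbit q ` ?C = (\<lambda>_. ?C) ` ?C"
    by (rule image_cong[OF refl permutes_orbit_eq[OF assms(1,2)]])
  also have "\<dots> = {?C}" by (rule image_constant[OF b_C])
  finally have img_q: "Orbits.orbit q ` A = insert ?C R" unfolding split R_def by simp
  have "?C \<notin> R"
    using permutes_self_in_orbit[OF assms(1,2)] by (auto simp: R_def)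
  moreover have "insert a ?C \<notin> R"
    using permutes_orbit_subset[OF assms(2)] assms(3) by (auto simp: R_def)
  moreover have "finite R" using assms(1) by (simp add: R_def)
  moreover have "card (insert a ?C) = Suc (card ?C)"
    using permutes_finite_orbit[OF assms(1,2)] C_A assms(3) by (intro card_insert_disjoint) auto
  ultimately show ?thesis
    unfolding cycle_type_def p_def[symmetric] img_p img_q by (simp add: ac_simps)
qed

lemma cycle_type_insert_fixpoint:
  assumes "finite A" "q permutes A" "a \<notin> A"
  shows "cycle_type (insert a A) q = Poly_Mapping.single 1 1 + cycle_type A q"
proof -
  have "Orbits.orbit q a = {a}"
    using assms by (simp add: orbit_eq_singleton_iff permutes_not_in)
  moreover have "{a} \<notin> Orbits.orbit q ` A"
    using permutes_orbit_subset[OF assms(2)] assms(3) by fastforce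
  ultimately show ?thesis using assms(1) by (simp add: cycle_type_def)
qed

lemma zee_superset:
  assumes "finite V" "Poly_Mapping.keys m \<subseteq> V"
  shows "zee m = (\<Prod>i\<in>V. i ^ Poly_Mapping.lookup m i * fact (Poly_Mapping.lookup m i))"
  unfolding zee_def
  by (rule prod.mono_neutral_left) (use assms in \<open>auto simp: not_in_keys_iff_lookup_eq_zero\<close>)

lemma zee_add_single:
  "zee (m + Poly_Mapping.single k 1) = k * (Poly_Mapping.lookup m k + 1) * zee m"
proof -
  let ?V = "insert k (Poly_Mapping.keys m)" and ?z = "\<lambda>i (l::nat). i ^ l * fact l :: nat"
  have "zee (m + Poly_Mapping.single k 1)
      = (\<Prod>i\<in>?V. (if i = k then k * (Poly_Mapping.lookup m k + 1) else 1) * ?z i (Poly_Mapping.lookup m i))"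
    by (subst zee_superset[of ?V])
      (auto simp: keys_add_nat lookup_add lookup_single when_def algebra_simps intro!: prod.cong)
  also have "\<dots> = k * (Poly_Mapping.lookup m k + 1) * (\<Prod>i\<in>?V. ?z i (Poly_Mapping.lookup m i))"
    unfolding prod.distrib by (simp add: prod.delta)
  also have "(\<Prod>i\<in>?V. ?z i (Poly_Mapping.lookup m i)) = zee m"
    by (rule zee_superset[symmetric]) auto
  finally show ?thesis .
qed

abbreviation partitions :: "nat \<Rightarrow> (nat \<Rightarrow>\<^sub>0 nat) set"
  where "partitions n \<equiv> {m. is_partition m \<and> partition_size m = n}"

text \<open>Both sides sum over the ways to remove a part \<open>k\<close> from a partition of \<open>n\<close>.\<close>

lemma sum_partitions_remove_part:
  fixes G :: "(nat \<Rightarrow>\<^sub>0 nat) \<Rightarrow> nat \<Rightarrow> 'a :: field_char_0"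
  shows "(\<Sum>m\<in>partitions n. \<Sum>k\<in>Poly_Mapping.keys m. of_nat (k * Poly_Mapping.lookup m k) / of_nat (zee m) * G m k)
    = (\<Sum>k\<in>{1..n}. \<Sum>m\<in>partitions (n - k). G (m + Poly_Mapping.single k 1) k / of_nat (zee m))"
proof -
  let ?e = "\<lambda>k. Poly_Mapping.single k (1::nat)"
  have "(\<Sum>m\<in>partitions n. \<Sum>k\<in>Poly_Mapping.keys m. of_nat (k * Poly_Mapping.lookup m k) / of_nat (zee m) * G m k)
      = (\<Sum>(m, k)\<in>Sigma (partitions n) Poly_Mapping.keys. of_nat (k * Poly_Mapping.lookup m k) / of_nat (zee m) * G m k)"
    by (rule sum.Sigma) (auto intro: finite_partitions)
  also have "\<dots> = (\<Sum>(k, m)\<in>Sigma {1..n} (\<lambda>k. partitions (n - k)). G (m + ?e k) k / of_nat (zee m))"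
  \<comment> \<open>By \<open>zee_add_single\<close>, k m_k / z_m is the reciprocal of z for the
    partition with one part k removed, so the weights match.\<close>
  proof (rule sum.reindex_bij_witness[where i = "\<lambda>(k, m). (m + ?e k, k)" and j = "\<lambda>(m, k). (k, m - ?e k)"])
    fix x assume x: "x \<in> Sigma (partitions n) Poly_Mapping.keys"
    obtain m k where mk: "x = (m, k)" by (cases x)
    define m' where "m' = m - ?e k"
    have "k \<in> Poly_Mapping.keys m" using x unfolding mk by blast
    then have "Poly_Mapping.lookup m k \<noteq> 0" unfolding in_keys_iff .
    then have m: "m = m' + ?e k"
      by (intro poly_mapping_eqI) (auto simp: m'_def lookup_add lookup_minus lookup_single when_def)
    have part: "is_partition m" "partition_size m = n" using x by (auto simp: mk)
    have k: "k \<ge> 1" "is_partition m'"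
      using part(1) unfolding m by (auto simp: is_partition_def lookup_add lookup_single when_def split: if_splits)
    have n: "n = partition_size m' + k"
      using part(2) unfolding m partition_size_add partition_size_single by simp
    show "(case case x of (m, k) \<Rightarrow> (k, m - ?e k) of (k, m) \<Rightarrow> (m + ?e k, k)) = x"
      unfolding mk prod.case m'_def[symmetric] m[symmetric] ..
    show "(case x of (m, k) \<Rightarrow> (k, m - ?e k)) \<in> Sigma {1..n} (\<lambda>k. partitions (n - k))"
      unfolding mk prod.case m'_def[symmetric] using k n by simp
    define N where "N = k * (Poly_Mapping.lookup m' k + 1)"
    have "N > 0" using k(1) by (simp add: N_def)
    moreover have "k * Poly_Mapping.lookup m k = N"
      unfolding m N_def by (simp add: lookup_add)
    moreover have "zee m = N * zee m'"
      unfolding m N_def by (rule zee_add_single)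
    ultimately have "of_nat (k * Poly_Mapping.lookup m k) / of_nat (zee m) = (1 / of_nat (zee m') :: 'a)"
      by simp
    then show "(case case x of (m, k) \<Rightarrow> (k, m - ?e k) of (k, m) \<Rightarrow> G (m + ?e k) k / of_nat (zee m))
        = (case x of (m, k) \<Rightarrow> of_nat (k * Poly_Mapping.lookup m k) / of_nat (zee m) * G m k)"
      unfolding mk prod.case m'_def[symmetric] m[symmetric] by simp
  next
    fix y assume y: "y \<in> Sigma {1..n} (\<lambda>k. partitions (n - k))"
    obtain k m where km: "y = (k, m)" by (cases y)
    show "(case case y of (k, m) \<Rightarrow> (m + ?e k, k) of (m, k) \<Rightarrow> (k, m - ?e k)) = y"
      by (simp add: km)
    show "(case y of (k, m) \<Rightarrow> (m + ?e k, k)) \<in> Sigma (partitions n) Poly_Mapping.keys"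
      using y by (auto simp: km partition_size_add partition_size_single[simplified] is_partition_def
          lookup_add lookup_single when_def keys_add_nat)
  qed
  also have "\<dots> = (\<Sum>k\<in>{1..n}. \<Sum>m\<in>partitions (n - k). G (m + ?e k) k / of_nat (zee m))"
    by (rule sum.Sigma[symmetric]) (auto intro: finite_partitions)
  finally show ?thesis .
qed

text \<open>The class formula, n!/z_m permutations of cycle type m, in summed form. The arbitrary
  weight \<open>F\<close> is what the induction on the label set needs: inserting a point replaces
  it by another weight \<open>H\<close>.\<close>

lemma sum_permutations_cycle_type:
  fixes F :: "(nat \<Rightarrow>\<^sub>0 nat) \<Rightarrow> 'a :: field_char_0"
  assumes "finite A"
  shows "(\<Sum>\<sigma> | \<sigma> permutes A. F (cycle_type A \<sigma>))
    = fact (card A) * (\<Sum>m\<in>partitions (card A). F m / of_nat (zee m))"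
  using assms
proof (induction A arbitrary: F rule: finite_induct)
  case empty
  have "partitions 0 = {0}"
  proof (intro equalityI subsetI)
    fix m assume m: "m \<in> partitions 0"
    have "Poly_Mapping.lookup m i = 0" for i
      using m not_in_keys_iff_lookup_eq_zero[of i m]
      by (cases "i \<in> Poly_Mapping.keys m") (auto simp: is_partition_def partition_size_def)
    then show "m \<in> {0}" by (auto intro: poly_mapping_eqI)
  qed (simp add: is_partition_def partition_size_def)
  then show ?case by (simp add: cycle_type_def zee_def)
next
  case (insert a A)
  let ?e = "\<lambda>k. Poly_Mapping.single k (1::nat)" and ?n = "card A"
  \<comment> \<open>The new point is fixed and adds a part 1, or it enters a cycle of length k, in k
    m_k possible places, and turns a part k into k + 1.\<close>
  define H where "H m = F (?e 1 + m)
      + (\<Sum>k\<in>Poly_Mapping.keys m. of_nat (k * Poly_Mapping.lookup m k) * F (m - ?e k + ?e (Suc k)))" for m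
  have trans: "cycle_type (insert a A) (transpose a b \<circ> q)
      = cycle_type A q - ?e (card (Orbits.orbit q b)) + ?e (Suc (card (Orbits.orbit q b)))"
    if q: "q permutes A" and b: "b \<in> A" for q b
  proof -
    let ?k = "card (Orbits.orbit q b)"
    have nz: "Poly_Mapping.lookup (cycle_type A q) ?k \<noteq> 0"
      using b insert.hyps by (auto simp: lookup_cycle_type card_eq_0_iff)
    define r where "r = cycle_type A q - ?e ?k"
    have r: "cycle_type A q = r + ?e ?k"
      using nz by (intro poly_mapping_eqI) (auto simp: r_def lookup_add lookup_minus lookup_single when_def)
    have "cycle_type (insert a A) (transpose a b \<circ> q) + ?e ?k = r + ?e ?k + ?e (Suc ?k)"
      unfolding r[symmetric] by (rule cycle_type_transpose_comp[OF insert.hyps(1) q insert.hyps(2) b])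
    also have "\<dots> = r + ?e (Suc ?k) + ?e ?k" by (simp only: add_ac)
    finally show ?thesis unfolding r_def[symmetric] by (simp only: add_right_cancel)
  qed
  have count: "card {b \<in> A. card (Orbits.orbit q b) = k} = k * Poly_Mapping.lookup (cycle_type A q) k"
    if q: "q permutes A" for q k
  proof -
    let ?O = "{C \<in> Orbits.orbit q ` A. card C = k}"
    have "{b \<in> A. card (Orbits.orbit q b) = k} = \<Union> ?O"
    proof (intro equalityI subsetI)
      fix b assume "b \<in> {b \<in> A. card (Orbits.orbit q b) = k}"
      then show "b \<in> \<Union> ?O" using permutes_self_in_orbit[OF insert.hyps(1) q, of b] by blast
    next
      fix b assume "b \<in> \<Union> ?O"
      then obtain c where c: "c \<in> A" "card (Orbits.orbit q c) = k" "b \<in> Orbits.orbit q c" by auto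
      then show "b \<in> {b \<in> A. card (Orbits.orbit q b) = k}"
        using permutes_orbit_eq[OF insert.hyps(1) q c(3)] permutes_orbit_subset[OF q c(1)] by auto
    qed
    also have "card (\<Union> ?O) = (\<Sum>C\<in>?O. card C)"
      using permutes_orbits_disjoint[OF insert.hyps(1) q] permutes_finite_orbit[OF insert.hyps(1) q]
      by (intro card_Union_disjoint) (auto simp: pairwise_def disjnt_def)
    also have "\<dots> = card ?O * k" by simp
    finally show ?thesis by (simp add: lookup_cycle_type[OF insert.hyps(1)] mult.commute)
  qed
  have step: "(\<Sum>b\<in>insert a A. F (cycle_type (insert a A) (transpose a b \<circ> q))) = H (cycle_type A q)"
    if q: "q permutes A" for q
  proof -
    let ?m = "cycle_type A q" and ?c = "\<lambda>b. card (Orbits.orbit q b)"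
    have keys: "?c ` A \<subseteq> Poly_Mapping.keys ?m"
      using insert.hyps(1) by (auto simp: in_keys_iff lookup_cycle_type card_eq_0_iff simp del: lookup_not_eq_zero_eq_in_keys)
    have "(\<Sum>b\<in>A. F (cycle_type (insert a A) (transpose a b \<circ> q))) = (\<Sum>b\<in>A. F (?m - ?e (?c b) + ?e (Suc (?c b))))"
      using trans[OF q] by (intro sum.cong) auto
    also have "\<dots> = (\<Sum>k\<in>Poly_Mapping.keys ?m. \<Sum>b | b \<in> A \<and> ?c b = k. F (?m - ?e (?c b) + ?e (Suc (?c b))))"
      by (rule sum.group[symmetric]) (use insert.hyps(1) keys in auto)
    also have "\<dots> = (\<Sum>k\<in>Poly_Mapping.keys ?m. of_nat (k * Poly_Mapping.lookup ?m k) * F (?m - ?e k + ?e (Suc k)))"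
    proof (rule sum.cong)
      fix k
      have "(\<Sum>b | b \<in> A \<and> ?c b = k. F (?m - ?e (?c b) + ?e (Suc (?c b))))
          = (\<Sum>b | b \<in> A \<and> ?c b = k. F (?m - ?e k + ?e (Suc k)))"
        by (intro sum.cong) auto
      also have "\<dots> = of_nat (k * Poly_Mapping.lookup ?m k) * F (?m - ?e k + ?e (Suc k))"
        by (simp only: sum_constant count[OF q])
      finally show "(\<Sum>b | b \<in> A \<and> ?c b = k. F (?m - ?e (?c b) + ?e (Suc (?c b))))
          = of_nat (k * Poly_Mapping.lookup ?m k) * F (?m - ?e k + ?e (Suc k))" .
    qed simp
    finally show ?thesis
      using insert.hyps cycle_type_insert_fixpoint[OF insert.hyps(1) q insert.hyps(2)]
      by (simp add: H_def)
  qed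
  have "(\<Sum>\<sigma> | \<sigma> permutes insert a A. F (cycle_type (insert a A) \<sigma>))
      = (\<Sum>b\<in>insert a A. \<Sum>q | q permutes A. F (cycle_type (insert a A) (transpose a b \<circ> q)))"
    by (rule sum_over_permutations_insert) (use insert.hyps in auto)
  also have "\<dots> = (\<Sum>q | q permutes A. H (cycle_type A q))"
    by (subst sum.swap) (simp add: step)
  also have "\<dots> = fact ?n * (\<Sum>m\<in>partitions ?n. H m / of_nat (zee m))"
    by (rule insert.IH)
  also have "(\<Sum>m\<in>partitions ?n. H m / of_nat (zee m))
      = (\<Sum>m\<in>partitions ?n. F (m + ?e 1) / of_nat (zee m))
      + (\<Sum>m\<in>partitions ?n. \<Sum>k\<in>Poly_Mapping.keys m. of_nat (k * Poly_Mapping.lookup m k) / of_nat (zee m)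
            * F (m - ?e k + ?e (Suc k)))"
    by (simp add: H_def add_divide_distrib sum.distrib sum_divide_distrib add.commute)
  \<comment> \<open>First use of the removal of a part: k is taken away and k + 1 added. With the
    fixed point case, all parts from 1 to n + 1 are reached.\<close>
  also have "(\<Sum>m\<in>partitions ?n. \<Sum>k\<in>Poly_Mapping.keys m. of_nat (k * Poly_Mapping.lookup m k) / of_nat (zee m)
            * F (m - ?e k + ?e (Suc k)))
      = (\<Sum>k\<in>{1..?n}. \<Sum>m\<in>partitions (?n - k). F (m + ?e (Suc k)) / of_nat (zee m))"
    unfolding sum_partitions_remove_part by simp
  also have "\<dots> = (\<Sum>k\<in>{2..Suc ?n}. \<Sum>m\<in>partitions (Suc ?n - k). F (m + ?e k) / of_nat (zee m))"
    by (rule sum.reindex_bij_witness[where i = "\<lambda>k. k - 1" and j = Suc]) auto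
  also have "(\<Sum>m\<in>partitions ?n. F (m + ?e 1) / of_nat (zee m)) + \<dots>
      = (\<Sum>k\<in>insert 1 {2..Suc ?n}. \<Sum>m\<in>partitions (Suc ?n - k). F (m + ?e k) / of_nat (zee m))"
    by simp
  also have "insert 1 {2..Suc ?n} = {1..Suc ?n}" by auto
  \<comment> \<open>Second use, backwards: each partition is now counted with the sum of its parts,
    n + 1, which completes the factorial.\<close>
  also have "(\<Sum>k\<in>{1..Suc ?n}. \<Sum>m\<in>partitions (Suc ?n - k). F (m + ?e k) / of_nat (zee m))
      = (\<Sum>m\<in>partitions (Suc ?n). \<Sum>k\<in>Poly_Mapping.keys m. of_nat (k * Poly_Mapping.lookup m k) / of_nat (zee m) * F m)"
    by (rule sum_partitions_remove_part[where G = "\<lambda>m k. F m", symmetric])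
  also have "\<dots> = (\<Sum>m\<in>partitions (Suc ?n). of_nat (Suc ?n) * (F m / of_nat (zee m)))"
  proof (rule sum.cong)
    fix m assume "m \<in> partitions (Suc ?n)"
    then have *: "of_nat (Suc ?n) = (\<Sum>k\<in>Poly_Mapping.keys m. of_nat (k * Poly_Mapping.lookup m k) :: 'a)"
      unfolding of_nat_sum[symmetric] partition_size_def[symmetric] by simp
    show "(\<Sum>k\<in>Poly_Mapping.keys m. of_nat (k * Poly_Mapping.lookup m k) / of_nat (zee m) * F m)
        = of_nat (Suc ?n) * (F m / of_nat (zee m))"
      unfolding * sum_distrib_right by (intro sum.cong) simp_all
  qed simp
  also have "fact ?n * \<dots> = fact (card (insert a A)) * (\<Sum>m\<in>partitions (card (insert a A)). F m / of_nat (zee m))"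
    unfolding card_insert_disjoint[OF insert.hyps] fact_Suc sum_distrib_left[symmetric]
    by (simp only: mult_ac)
  finally show ?case .
qed

section \<open>Permutations with the same cycle type are conjugate\<close>

lemma orbit_enum:
  fixes A :: "nat set"
  assumes "finite A" "\<sigma> permutes A"
  shows "bij_betw (\<lambda>j. (\<sigma> ^^ j) a) {..<card (Orbits.orbit \<sigma> a)} (Orbits.orbit \<sigma> a)"
    and "(\<sigma> ^^ card (Orbits.orbit \<sigma> a)) a = a"
proof -
  let ?d = "funpow_dist1 \<sigma> a a"
  have self: "a \<in> Orbits.orbit \<sigma> a" by (rule permutes_self_in_orbit[OF assms])
  have inj: "inj_on (\<lambda>j. (\<sigma> ^^ j) a) {0..<?d}" by (rule inj_on_funpow_dist1[OF self])
  have img: "Orbits.orbit \<sigma> a = (\<lambda>j. (\<sigma> ^^ j) a) ` {0..<?d}" by (rule orbit_conv_funpow_dist1[OF self])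
  have card: "card (Orbits.orbit \<sigma> a) = ?d"
    unfolding img card_image[OF inj] by simp
  show "bij_betw (\<lambda>j. (\<sigma> ^^ j) a) {..<card (Orbits.orbit \<sigma> a)} (Orbits.orbit \<sigma> a)"
    using inj img unfolding card by (simp add: bij_betw_def lessThan_atLeast0)
  show "(\<sigma> ^^ card (Orbits.orbit \<sigma> a)) a = a"
    unfolding card by (rule funpow_dist1_prop[OF self])
qed

text \<open>The map sends \<open>(\<sigma> ^^ j) a\<close> to \<open>(\<tau> ^^ j) b\<close>. It
  respects the permutations also where the cycle closes, because both cycles close after the same
  number of steps.\<close>

lemma orbits_conjugate:
  fixes A B :: "nat set"
  assumes "finite A" "\<sigma> permutes A" "finite B" "\<tau> permutes B"
    and eq: "card (Orbits.orbit \<sigma> a) = card (Orbits.orbit \<tau> b)"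
  obtains \<gamma> where "bij_betw \<gamma> (Orbits.orbit \<sigma> a) (Orbits.orbit \<tau> b)"
    "\<forall>x\<in>Orbits.orbit \<sigma> a. \<gamma> (\<sigma> x) = \<tau> (\<gamma> x)"
proof -
  let ?k = "card (Orbits.orbit \<sigma> a)"
  note \<sigma> = orbit_enum[OF assms(1,2), of a] and \<tau> = orbit_enum[OF assms(3,4), of b]
  define g where "g = the_inv_into {..<?k} (\<lambda>j. (\<sigma> ^^ j) a)"
  define \<gamma> where "\<gamma> = (\<lambda>j. (\<tau> ^^ j) b) \<circ> g"
  have g: "g ((\<sigma> ^^ j) a) = j" if "j < ?k" for j
    unfolding g_def using \<sigma>(1) that by (intro the_inv_into_f_f) (auto simp: bij_betw_def)
  have "bij_betw g (Orbits.orbit \<sigma> a) {..<?k}"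
    unfolding g_def by (rule bij_betw_the_inv_into[OF \<sigma>(1)])
  then have bij: "bij_betw \<gamma> (Orbits.orbit \<sigma> a) (Orbits.orbit \<tau> b)"
    unfolding \<gamma>_def using \<tau>(1) unfolding eq by (rule bij_betw_trans)
  have pos: "0 < ?k" by (rule permutes_card_orbit_pos[OF assms(1,2)])
  show thesis
  proof (rule that[OF bij], rule ballI)
    fix x assume "x \<in> Orbits.orbit \<sigma> a"
    then obtain j where j: "j < ?k" "x = (\<sigma> ^^ j) a"
      using \<sigma>(1) unfolding bij_betw_def by blast
    show "\<gamma> (\<sigma> x) = \<tau> (\<gamma> x)"
    proof (cases "Suc j < ?k")
      case True
      then show ?thesis using g[of j] g[of "Suc j"] j by (simp add: \<gamma>_def)
    next
      case False
      then have k: "?k = Suc j" using j by simp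
      have "\<sigma> x = a" using \<sigma>(2) by (simp add: k j)
      moreover have "g a = 0" using g[OF pos] by simp
      moreover have "\<tau> ((\<tau> ^^ j) b) = b" using \<tau>(2) unfolding eq[symmetric] k by simp
      ultimately show ?thesis using g[OF j(1)] j by (simp add: \<gamma>_def)
    qed
  qed
qed

lemma cycle_type_remove_orbit:
  assumes "finite A" "\<sigma> permutes A" "a \<in> A"
  defines "C \<equiv> Orbits.orbit \<sigma> a"
  shows "cycle_type A \<sigma> = Poly_Mapping.single (card C) 1 + cycle_type (A - C) (perm_restrict \<sigma> (A - C))"
proof -
  have C_A: "C \<subseteq> A" unfolding C_def by (rule permutes_orbit_subset[OF assms(2,3)])
  have "Orbits.orbit (perm_restrict \<sigma> (A - C)) x = Orbits.orbit \<sigma> x" if x: "x \<in> A - C" for x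
  proof (rule orbit_cong[OF permutes_self_in_orbit[OF assms(1,2)]])
    fix y assume y: "y \<in> Orbits.orbit \<sigma> x"
    have "y \<notin> C"
    proof
      assume "y \<in> C"
      then have "Orbits.orbit \<sigma> x = C"
        using permutes_orbit_eq[OF assms(1,2) y] permutes_orbit_eq[OF assms(1,2), of y a] by (simp add: C_def)
      then show False using permutes_self_in_orbit[OF assms(1,2), of x] x by simp
    qed
    moreover have "y \<in> A" using permutes_orbit_subset[OF assms(2)] x y by auto
    ultimately show "perm_restrict \<sigma> (A - C) y = \<sigma> y" by (simp add: perm_restrict_simps)
  qed
  then have "Orbits.orbit (perm_restrict \<sigma> (A - C)) ` (A - C) = Orbits.orbit \<sigma> ` (A - C)"
    by (intro image_cong) auto
  moreover have "Orbits.orbit \<sigma> ` A = insert C (Orbits.orbit \<sigma> ` (A - C))"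
  proof -
    have "Orbits.orbit \<sigma> ` C = (\<lambda>_. C) ` C"
      unfolding C_def by (rule image_cong[OF refl permutes_orbit_eq[OF assms(1,2)]])
    also have "\<dots> = {C}"
      unfolding C_def by (rule image_constant[OF permutes_self_in_orbit[OF assms(1,2)]])
    finally have "Orbits.orbit \<sigma> ` C = {C}" .
    moreover have "Orbits.orbit \<sigma> ` A = Orbits.orbit \<sigma> ` C \<union> Orbits.orbit \<sigma> ` (A - C)"
      by (simp only: image_Un[symmetric] Un_Diff_cancel Un_absorb1[OF C_A])
    ultimately show ?thesis by simp
  qed
  moreover have "C \<notin> Orbits.orbit \<sigma> ` (A - C)"
    using permutes_self_in_orbit[OF assms(1,2)] by auto
  ultimately show ?thesis using assms(1) by (simp add: cycle_type_def)
qed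

text \<open>Cycles of equal length are matched and removed in pairs; two label sets are allowed
  because the remainders need not coincide. This makes \<open>Fix\<close> independent of the
  permutation it chooses.\<close>

lemma conjugate_if_cycle_type_eq:
  assumes "finite A" "\<sigma> permutes A" "finite B" "\<tau> permutes B" "cycle_type A \<sigma> = cycle_type B \<tau>"
  shows "\<exists>\<beta>. bij_betw \<beta> A B \<and> (\<forall>x\<in>A. \<beta> (\<sigma> x) = \<tau> (\<beta> x))"
  using assms
proof (induction "card A" arbitrary: A B \<sigma> \<tau> rule: less_induct)
  case less
  note A = less.prems(1,2) and B = less.prems(3,4) and eq = less.prems(5)
  show ?case
  proof (cases "A = {}")
    case True
    then have "card B = 0"
      using partition_size_cycle_type[OF A] partition_size_cycle_type[OF B] eq by simp
    then show ?thesis using True less.prems(3) by (auto simp: bij_betw_def)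
  next
    case False
    then obtain a where a: "a \<in> A" by blast
    let ?C = "Orbits.orbit \<sigma> a"
    have "Poly_Mapping.lookup (cycle_type A \<sigma>) (card ?C) \<noteq> 0"
      using a A(1) by (auto simp: lookup_cycle_type card_eq_0_iff)
    then have "card {D \<in> Orbits.orbit \<tau> ` B. card D = card ?C} \<noteq> 0"
      unfolding eq lookup_cycle_type[OF B(1)] .
    then have "{D \<in> Orbits.orbit \<tau> ` B. card D = card ?C} \<noteq> {}" by force
    then obtain b where b: "b \<in> B" "card ?C = card (Orbits.orbit \<tau> b)" by force
    let ?D = "Orbits.orbit \<tau> b"
    obtain \<gamma> where \<gamma>: "bij_betw \<gamma> ?C ?D" "\<forall>x\<in>?C. \<gamma> (\<sigma> x) = \<tau> (\<gamma> x)"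
      by (rule orbits_conjugate[OF A B b(2)])
    let ?\<sigma> = "perm_restrict \<sigma> (A - ?C)" and ?\<tau> = "perm_restrict \<tau> (B - ?D)"
    have C_A: "?C \<subseteq> A" by (rule permutes_orbit_subset[OF A(2) a])
    have D_B: "?D \<subseteq> B" by (rule permutes_orbit_subset[OF B(2) b(1)])
    have \<sigma>': "?\<sigma> permutes (A - ?C)"
      by (rule perm_restrict_diff_cyclic[OF A(2) cyclic_on_orbit[OF A(2,1)]])
    have \<tau>': "?\<tau> permutes (B - ?D)"
      by (rule perm_restrict_diff_cyclic[OF B(2) cyclic_on_orbit[OF B(2,1)]])
    have "a \<in> ?C" by (rule permutes_self_in_orbit[OF A])
    then have smaller: "card (A - ?C) < card A" using a A(1) by (intro psubset_card_mono) auto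
    have "cycle_type (A - ?C) ?\<sigma> = cycle_type (B - ?D) ?\<tau>"
      using eq cycle_type_remove_orbit[OF A a] cycle_type_remove_orbit[OF B b(1)] b(2) by simp
    from less.hyps[OF smaller finite_Diff[OF A(1)] \<sigma>' finite_Diff[OF B(1)] \<tau>' this]
    obtain \<beta> where \<beta>: "bij_betw \<beta> (A - ?C) (B - ?D)"
      "\<forall>x\<in>A - ?C. \<beta> (?\<sigma> x) = ?\<tau> (\<beta> x)"
      by (elim exE conjE) (rule that)
    define \<delta> where "\<delta> x = (if x \<in> ?C then \<gamma> x else \<beta> x)" for x
    have "bij_betw \<delta> ?C ?D"
      using \<gamma>(1) bij_betw_cong[of ?C \<delta> \<gamma> ?D] by (simp add: \<delta>_def)
    moreover have "bij_betw \<delta> (A - ?C) (B - ?D)"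
      using \<beta>(1) bij_betw_cong[of "A - ?C" \<delta> \<beta> "B - ?D"] by (simp add: \<delta>_def)
    ultimately have "bij_betw \<delta> (?C \<union> (A - ?C)) (?D \<union> (B - ?D))"
      by (rule bij_betw_combine) auto
    then have "bij_betw \<delta> A B" using C_A D_B by (simp add: Un_absorb1)
    moreover have "\<delta> (\<sigma> x) = \<tau> (\<delta> x)" if x: "x \<in> A" for x
    proof (cases "x \<in> ?C")
      case True
      then have "\<sigma> x \<in> ?C" by (rule Orbits.orbit.step)
      then show ?thesis using True \<gamma>(2) by (simp add: \<delta>_def)
    next
      case False
      then have xC: "x \<in> A - ?C" using x by simp
      have s: "?\<sigma> x = \<sigma> x" using xC by (rule perm_restrict_simps)
      have "?\<sigma> x \<in> A - ?C" using permutes_in_image[OF \<sigma>'] xC by blast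
      moreover have "\<beta> x \<in> B - ?D" using \<beta>(1) xC by (auto simp: bij_betw_def)
      ultimately show ?thesis using bspec[OF \<beta>(2) xC] xC unfolding s \<delta>_def by (simp add: perm_restrict_simps)
    qed
    ultimately show ?thesis by blast
  qed
qed

section \<open>Orbits of structures\<close>

context species
begin

text \<open>Relabelling by the conjugating bijection maps the structures fixed by \<sigma>
  injectively to those fixed by \<tau>. Exchanging the roles gives equality.\<close>

lemma card_fixed_le:
  assumes "\<sigma> permutes {1..n}" "\<tau> permutes {1..n}" "cycle_type {1..n} \<sigma> = cycle_type {1..n} \<tau>"
  shows "card {s \<in> structures {1..n}. transport {1..n} \<sigma> s = s}
    \<le> card {s \<in> structures {1..n}. transport {1..n} \<tau> s = s}"
proof -
  let ?U = "{1..n}"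
  obtain \<beta> where \<beta>: "bij_betw \<beta> ?U ?U" "\<And>x. x \<in> ?U \<Longrightarrow> \<beta> (\<sigma> x) = \<tau> (\<beta> x)"
    using conjugate_if_cycle_type_eq[OF _ assms(1) _ assms(2,3)] by auto
  have \<sigma>: "bij_betw \<sigma> ?U ?U" and \<tau>: "bij_betw \<tau> ?U ?U"
    using assms by (auto intro: permutes_imp_bij)
  have F\<beta>: "bij_betw (transport ?U \<beta>) (structures ?U) (structures ?U)"
    by (rule transport_bij[OF _ \<beta>(1)]) simp
  have "transport ?U \<tau> (transport ?U \<beta> s) = transport ?U \<beta> s"
    if s: "s \<in> structures ?U" "transport ?U \<sigma> s = s" for s
  proof -
    have "transport ?U \<tau> (transport ?U \<beta> s) = transport ?U (\<tau> \<circ> \<beta>) s"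
      by (rule transport_comp[symmetric, OF _ \<beta>(1) \<tau> s(1)]) simp
    also have "\<dots> = transport ?U (\<beta> \<circ> \<sigma>) s"
      by (rule transport_cong[OF _ bij_betw_trans[OF \<beta>(1) \<tau>]]) (use \<beta>(2) s in auto)
    also have "\<dots> = transport ?U \<beta> (transport ?U \<sigma> s)"
      by (rule transport_comp[OF _ \<sigma> \<beta>(1) s(1)]) simp
    finally show ?thesis using s(2) by simp
  qed
  moreover have "transport ?U \<beta> s \<in> structures ?U" if "s \<in> structures ?U" for s
    using F\<beta> that by (auto simp: bij_betw_def)
  ultimately show ?thesis
    using F\<beta> finite_structures[of ?U]
    by (intro card_inj_on_le[of "transport ?U \<beta>"]) (auto simp: bij_betw_def inj_on_def)
qed

lemma card_fixed_eq_Fix: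
  assumes "\<sigma> permutes {1..n}"
  shows "card {s \<in> structures {1..n}. transport {1..n} \<sigma> s = s} = Fix structures transport (cycle_type {1..n} \<sigma>)"
proof -
  let ?m = "cycle_type {1..n} \<sigma>"
  define \<tau> where "\<tau> = (SOME \<tau>. has_cycle_type n \<tau> ?m)"
  have "has_cycle_type n \<tau> ?m"
    unfolding \<tau>_def by (rule someI[of _ \<sigma>]) (simp add: has_cycle_type_iff assms del: One_nat_def)
  then have \<tau>: "\<tau> permutes {1..n}" "?m = cycle_type {1..n} \<tau>" by (auto simp: has_cycle_type_iff)
  have "Fix structures transport ?m = card {s \<in> structures {1..n}. transport {1..n} \<tau> s = s}"
    using partition_size_cycle_type[OF _ assms] by (simp add: Fix_def \<tau>_def Let_def)
  then show ?thesis
    using card_fixed_le[OF assms \<tau>] card_fixed_le[OF \<tau>(1) assms \<tau>(2)[symmetric]] by simp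
qed

lemma card_orbits_structures:
  "Orb structures transport n * fact n
    = (\<Sum>\<sigma> | \<sigma> permutes {1..n}. card {s \<in> structures {1..n}. transport {1..n} \<sigma> s = s})"
proof -
  define U where "U = {1..n}"
  let ?G = "sym_group n" and ?E = "structures U"
  \<comment> \<open>Elements of \<open>BijGroup\<close> are \<open>undefined\<close> outside the
    set, hence the restriction; orbits and fixed points of structures stay the same.\<close>
  define \<phi> where "\<phi> \<sigma> = restrict (transport U \<sigma>) ?E" for \<sigma>
  have fin: "finite U" by (simp add: U_def)
  have carrier: "carrier ?G = {\<sigma>. \<sigma> permutes U}"
    unfolding U_def using sym_group_carrier by blast
  have bij: "bij_betw (transport U \<sigma>) ?E ?E" if "\<sigma> permutes U" for \<sigma>
    by (rule transport_bij[OF fin permutes_imp_bij[OF that]])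
  have Bij: "\<phi> \<sigma> \<in> Bij ?E" if "\<sigma> permutes U" for \<sigma>
    using bij[OF that] by (simp add: Bij_def \<phi>_def bij_betw_restrict_eq)
  have comp: "\<phi> (\<sigma> \<circ> \<tau>) = compose ?E (\<phi> \<sigma>) (\<phi> \<tau>)" if "\<sigma> permutes U" "\<tau> permutes U" for \<sigma> \<tau>
  proof
    fix s
    show "\<phi> (\<sigma> \<circ> \<tau>) s = compose ?E (\<phi> \<sigma>) (\<phi> \<tau>) s"
    proof (cases "s \<in> ?E")
      case True
      then have "transport U \<tau> s \<in> ?E" using bij_betwE[OF bij[OF that(2)]] by blast
      then show ?thesis
        using transport_comp[OF fin permutes_imp_bij[OF that(2)] permutes_imp_bij[OF that(1)] True] True
        unfolding \<phi>_def compose_def by (simp only: restrict_apply if_True)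
    next
      case False
      then show ?thesis unfolding \<phi>_def compose_def by (simp only: restrict_apply if_False)
    qed
  qed
  have "\<phi> \<in> hom ?G (BijGroup ?E)"
  proof (rule homI)
    fix \<sigma> \<tau> assume "\<sigma> \<in> carrier ?G" "\<tau> \<in> carrier ?G"
    then show "\<phi> (\<sigma> \<otimes>\<^bsub>?G\<^esub> \<tau>) = \<phi> \<sigma> \<otimes>\<^bsub>BijGroup ?E\<^esub> \<phi> \<tau>"
      using comp Bij by (simp add: BijGroup_def carrier sym_group_mult)
  qed (simp add: BijGroup_def carrier Bij)
  then interpret group_action ?G ?E \<phi>
    by (intro group_action.intro group_hom.intro group_hom_axioms.intro sym_group_is_group group_BijGroup)
  have "orbit ?G (transport U) s = orbit ?G \<phi> s" if "s \<in> ?E" for s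
    using that by (simp add: orbit_def \<phi>_def)
  then have orb: "orbits ?G ?E (transport U) = orbits ?G ?E \<phi>"
    unfolding orbits_def by (intro Collect_cong ex_cong1) auto
  have inv: "invariants ?E \<phi> \<sigma> = {s \<in> ?E. transport U \<sigma> s = s}" for \<sigma>
    by (auto simp: invariants_def \<phi>_def)
  have order: "order ?G = fact n"
    by (simp add: order_def sym_group_card_carrier)
  have "finite (carrier ?G)" unfolding carrier by (rule finite_permutations[OF fin])
  from burnside[OF this finite_structures[OF fin]]
  have "card (orbits ?G ?E (transport U)) * fact n
      = (\<Sum>\<sigma> | \<sigma> permutes U. card {s \<in> ?E. transport U \<sigma> s = s})"
    unfolding carrier inv order orb[symmetric] .
  then show ?thesis unfolding Orb_def U_def .
qed

text \<open>Burnside's lemma with the permutations grouped by cycle type.\<close>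

lemma Orb_eq_sum_Fix:
  "of_nat (Orb structures transport n)
    = (\<Sum>m\<in>partitions n. of_nat (Fix structures transport m) / of_nat (zee m) :: 'a :: field_char_0)"
proof -
  have nat: "Orb structures transport n * fact n
      = (\<Sum>\<sigma> | \<sigma> permutes {1..n}. Fix structures transport (cycle_type {1..n} \<sigma>))"
    unfolding card_orbits_structures by (intro sum.cong refl card_fixed_eq_Fix) blast
  have "of_nat (Orb structures transport n) * fact n = (of_nat (Orb structures transport n * fact n) :: 'a)"
    by simp
  also have "\<dots> = (\<Sum>\<sigma> | \<sigma> permutes {1..n}. of_nat (Fix structures transport (cycle_type {1..n} \<sigma>)))"
    unfolding nat by (rule of_nat_sum)
  also have "\<dots> = fact n * (\<Sum>m\<in>partitions n. of_nat (Fix structures transport m) / of_nat (zee m))"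
  proof -
    have "card {1..n} = n" by simp
    with sum_permutations_cycle_type[OF finite_atLeastAtMost[of 1 n],
        of "\<lambda>m. of_nat (Fix structures transport m) :: 'a"]
    show ?thesis by (simp only:)
  qed
  finally show ?thesis by simp
qed

end

text \<open>When x_1 is the only variable, p_i becomes x_1^i, so a product of power sums keeps
  nothing but its degree.\<close>

lemma mps_coeff_power_sum_monomial_single:
  assumes "is_partition m"
  shows "mps_coeff (power_sum_monomial m) (Poly_Mapping.single 1 n)
    = (if partition_size m = n then 1 else 0 :: 'a :: comm_ring_1)"
  using assms
proof (induction m arbitrary: n rule: monom_nat_induct)
  case zero
  then show ?case
    by (auto simp: power_sum_monomial_def mps_coeff_one partition_size_def poly_mapping_eq_iff fun_eq_iff
        lookup_single when_def)
next
  case (add i m)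
  have i: "i \<ge> 1" and m: "is_partition m"
    using add.prems by (auto simp: is_partition_def lookup_add lookup_single when_def split: if_splits)
  have exp: "exponents 1 (\<lambda>_. l) = Poly_Mapping.single 1 l" "exponents 1 ((\<lambda>_. l)(v := c)) = Poly_Mapping.single 1 (if v = 1 then c else l)" for l c v
    by (auto simp: exponents_def)
  have "{v :: nat. v \<in> {1..1} \<and> i \<le> n} = (if i \<le> n then {1} else {})" by auto
  then have "mps_coeff (power_sum i * power_sum_monomial m :: 'a mps) (Poly_Mapping.single 1 n)
      = (if i \<le> n then mps_coeff (power_sum_monomial m) (Poly_Mapping.single 1 (n - i)) else 0)"
    using mps_coeff_power_sum_mult[OF i, of "power_sum_monomial m :: 'a mps" 1 "\<lambda>_. n"]
    unfolding exp by simp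
  then show ?case
    unfolding power_sum_monomial_add_single partition_size_add
    using add.IH[OF m] partition_size_single[of i] by (auto simp: )
qed

section \<open>The generating functions\<close>

text \<open>Each derivative shifts the exponent, so the induction runs for all \<open>l\<close> at
  once.\<close>

lemma mps_coeff_funpow_pderiv:
  "fact l * mps_coeff ((pderiv_mps i ^^ n) f) (Poly_Mapping.single i l)
    = (fact (l + n) * mps_coeff f (Poly_Mapping.single i (l + n)) :: 'a :: field_char_0)"
proof (induction n arbitrary: l)
  case (Suc n)
  have "Poly_Mapping.single i (Suc 0) + Poly_Mapping.single i l = Poly_Mapping.single i (Suc l)"
    by (simp flip: single_add)
  then have "fact l * mps_coeff ((pderiv_mps i ^^ Suc n) f) (Poly_Mapping.single i l)
      = fact (Suc l) * mps_coeff ((pderiv_mps i ^^ n) f) (Poly_Mapping.single i (Suc l))"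
    by (simp add: mps_coeff_pderiv algebra_simps)
  then show ?case unfolding Suc by simp
qed simp

lemma h_perp_sum_1: "h_perp_sum {1} 0 = (pderiv_mps 1 :: 'a :: field_char_0 mps \<Rightarrow> 'a mps)"
proof
  fix f :: "'a mps"
  have "{k. k \<in> {1} \<and> 0 \<le> k} = {1 :: nat}" by auto
  moreover have "h_perp (Suc 0) f = pderiv_mps (Suc 0) f"
    by (rule mps_eqI) (simp add: h_perp.simps)
  ultimately show "h_perp_sum {1} 0 f = pderiv_mps 1 f"
    by (simp add: h_perp_sum_def)
qed

text \<open>For S = {1} the operator g^perp is the derivative in the variable of index 1, and this
  is Taylor's formula.\<close>

lemma funpow_h_perp_sum_1:
  "mps_coeff ((h_perp_sum {1} 0 ^^ n) f) 0 = (fact n * mps_coeff f (Poly_Mapping.single 1 n) :: 'a :: field_char_0)"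
  using mps_coeff_funpow_pderiv[where l = 0 and i = 1 and n = n and f = f] by (simp add: h_perp_sum_1[simplified])

lemma sum_mps_coeff_in_x:
  fixes f :: "'a :: field_char_0 mps"
  assumes "finite S" "\<And>m. mps_coeff f m \<noteq> 0 \<Longrightarrow> is_partition m"
  shows "(\<Sum>k\<in>{1..n} \<rightarrow>\<^sub>E S. mps_coeff (in_x f) (\<Sum>i=1..n. Poly_Mapping.single i (k i)))
    = mps_coeff ((h_perp_sum S 0 ^^ n) f) 0"
proof -
  have "(\<Sum>k\<in>{1..n} \<rightarrow>\<^sub>E S. mps_coeff (in_x f) (\<Sum>i=1..n. Poly_Mapping.single i (k i)))
      = (\<Sum>k\<in>{1..n} \<rightarrow>\<^sub>E S. mps_coeff (h_perp_word k n f) 0)"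
    unfolding exponents_def[symmetric] by (intro sum.cong refl mps_coeff_in_x assms(2))
  then show ?thesis by (simp only: mps_coeff_sum[symmetric] sum_h_perp_word[OF assms(1)])
qed

lemma mps_coeff_in_x_const:
  fixes f :: "'a :: field_char_0 mps"
  assumes "\<And>m. mps_coeff f m \<noteq> 0 \<Longrightarrow> is_partition m"
  shows "mps_coeff (in_x f) (\<Sum>i=1..n. Poly_Mapping.single i k) = mps_coeff ((h_perp_sum {k} 0 ^^ n) f) 0"
proof -
  have "{1..n} \<rightarrow>\<^sub>E {k} = {restrict (\<lambda>_. k) {1..n}}"
    by (subst PiE_eq_singleton) simp
  then show ?thesis
    using sum_mps_coeff_in_x[of "{k}" f n] assms by simp
qed

lemma mps_coeff_in_x_single:
  assumes "\<And>m. mps_coeff f m \<noteq> 0 \<Longrightarrow> is_partition m"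
  shows "mps_coeff (in_x f) (Poly_Mapping.single 1 n) = (\<Sum>m\<in>partitions n. mps_coeff f m)"
proof -
  have "mps_coeff f m * mps_coeff (power_sum_monomial m) (Poly_Mapping.single 1 n)
      = (if partition_size m = n then mps_coeff f m else 0)" for m
    using assms[of m] mps_coeff_power_sum_monomial_single[of m n, where 'a = 'a]
    by (cases "mps_coeff f m = 0") auto
  then have "mps_coeff (in_x f) (Poly_Mapping.single 1 n)
      = Sum_any (\<lambda>m. if partition_size m = n then mps_coeff f m else 0)"
    by (simp only: in_x_def mps_coeff_Abs)
  also have "\<dots> = (\<Sum>m\<in>partitions n. if partition_size m = n then mps_coeff f m else 0)"
    using assms by (intro Sum_any.expand_superset finite_partitions) (auto split: if_splits)
  also have "\<dots> = (\<Sum>m\<in>partitions n. mps_coeff f m)" by (intro sum.cong) auto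
  finally show ?thesis .
qed

lemma is_partition_cycle_index:
  "mps_coeff (cycle_index structures transport :: 'a :: field_char_0 mps) m \<noteq> 0 \<Longrightarrow> is_partition m"
  by (simp add: cycle_index_def split: if_splits)

lemma cycle_type_id: "cycle_type {1..n} id = Poly_Mapping.single 1 n"
proof (rule poly_mapping_eqI)
  fix i
  have orb: "Orbits.orbit id x = {x}" for x :: nat
    by (simp add: orbit_eq_singleton_iff)
  have "{C \<in> Orbits.orbit id ` {1..n}. card C = i} = (if i = 1 then (\<lambda>x. {x}) ` {1..n} else {})"
    by (auto simp: orb)
  then show "Poly_Mapping.lookup (cycle_type {1..n} id) i = Poly_Mapping.lookup (Poly_Mapping.single 1 n) i"
    by (auto simp: lookup_cycle_type lookup_single when_def card_image)
qed

text \<open>The partition 1^n belongs to the identity, which fixes every structure, and its z is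
  n!.\<close>

lemma (in species) mps_coeff_cycle_index_single:
  "mps_coeff (cycle_index structures transport) (Poly_Mapping.single 1 n)
    = (of_nat (card (structures {1..n})) / fact n :: 'a :: field_char_0)"
proof -
  have "Fix structures transport (cycle_type {1..n} id) = card {s \<in> structures {1..n}. transport {1..n} id s = s}"
    by (rule card_fixed_eq_Fix[symmetric]) (rule permutes_id)
  moreover have "{s \<in> structures {1..n}. transport {1..n} id s = s} = structures {1..n}"
    using transport_id[of "{1..n}"] by blast
  ultimately have "Fix structures transport (Poly_Mapping.single 1 n) = card (structures {1..n})"
    unfolding cycle_type_id by simp
  moreover have "zee (Poly_Mapping.single 1 n) = fact n"
    by (cases "n = 0") (simp_all add: zee_def)
  moreover have "is_partition (Poly_Mapping.single 1 n)"
    by (simp add: is_partition_def lookup_single)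
  ultimately show ?thesis by (simp add: cycle_index_def)
qed

theorem theorem3:
  fixes structures :: "nat set \<Rightarrow> 's set"
    and transport :: "nat set \<Rightarrow> (nat \<Rightarrow> nat) \<Rightarrow> 's \<Rightarrow> 's"
    and Z :: "'a :: field_char_0 mps"
  assumes "species structures transport"
    and "Z = cycle_index structures transport"
    and "D_finite {1..} Z"
  shows "D_finite_fps (Abs_fps (\<lambda>n. of_nat (card (structures {1..n})) / fact n) :: 'a fps)
    \<and> (D_finite {1..} (in_x Z) \<longrightarrow>
        D_finite_fps (Abs_fps (\<lambda>n. of_nat (Orb structures transport n)) :: 'a fps))
    \<and> (\<forall>k. D_finite_fps (Abs_fps (\<lambda>n.
        mps_coeff (in_x Z) (\<Sum>i=1..n. Poly_Mapping.single i k) / fact n)))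
    \<and> (\<forall>S. finite S \<longrightarrow> D_finite_fps (Abs_fps (\<lambda>n.
        (\<Sum>k\<in>{1..n} \<rightarrow>\<^sub>E S. mps_coeff (in_x Z) (\<Sum>i=1..n. Poly_Mapping.single i (k i))) / fact n)))"
proof -
  interpret species structures transport by (rule assms(1))
  have part: "is_partition m" if "mps_coeff Z m \<noteq> 0" for m
    using that is_partition_cycle_index unfolding assms(2) by blast
  have fin: "D_finite_fin {1..N} (set_other_vars_zero {1..N} f)" if "D_finite {1..} f" for N and f :: "'a mps"
    using that unfolding D_finite_def by auto
  have main: "D_finite_fps (Abs_fps (\<lambda>n. mps_coeff ((h_perp_sum S 0 ^^ n) f) 0 / fact n))"
    if "finite S" "D_finite {1..} f" for S and f :: "'a mps"
  proof (rule D_finite_fps_h_perp[OF _ fin[OF that(2)]])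
    show "S \<subseteq> {..Max S}" using that(1) by auto
  qed
  \<comment> \<open>Applied twice: for \<open>Z\<close> the index 1 stands for p_1 and the
    coefficients count labelled structures; for \<open>in_x Z\<close> it stands for x_1 and they
    count orbits.\<close>
  have at_single: "D_finite_fps (Abs_fps (\<lambda>n. mps_coeff f (Poly_Mapping.single 1 n)))"
    if "D_finite {1..} f" for f :: "'a mps"
    using main[OF _ that, of "{1}"] unfolding funpow_h_perp_sum_1 by simp
  have "D_finite_fps (Abs_fps (\<lambda>n. of_nat (card (structures {1..n})) / fact n) :: 'a fps)"
    using at_single[OF assms(3)] unfolding assms(2) mps_coeff_cycle_index_single .
  moreover have "D_finite_fps (Abs_fps (\<lambda>n. of_nat (Orb structures transport n)) :: 'a fps)"
    if "D_finite {1..} (in_x Z)"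
  proof -
    have "mps_coeff (in_x Z) (Poly_Mapping.single 1 n) = of_nat (Orb structures transport n)" for n
    proof -
      have "mps_coeff (in_x Z) (Poly_Mapping.single 1 n) = (\<Sum>m\<in>partitions n. mps_coeff Z m)"
        by (rule mps_coeff_in_x_single) (rule part)
      also have "\<dots> = of_nat (Orb structures transport n)"
        unfolding Orb_eq_sum_Fix by (intro sum.cong) (auto simp: assms(2) cycle_index_def)
      finally show ?thesis .
    qed
    then show ?thesis using at_single[OF that] by (simp only:)
  qed
  moreover have "D_finite_fps (Abs_fps (\<lambda>n. mps_coeff (in_x Z) (\<Sum>i=1..n. Poly_Mapping.single i k) / fact n))" for k
  proof -
    have "mps_coeff (in_x Z) (\<Sum>i=1..n. Poly_Mapping.single i k) = mps_coeff ((h_perp_sum {k} 0 ^^ n) Z) 0" for n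
      by (rule mps_coeff_in_x_const) (rule part)
    then show ?thesis using main[OF _ assms(3), of "{k}"] by (simp only: finite.intros)
  qed
  moreover have "D_finite_fps (Abs_fps (\<lambda>n.
        (\<Sum>k\<in>{1..n} \<rightarrow>\<^sub>E S. mps_coeff (in_x Z) (\<Sum>i=1..n. Poly_Mapping.single i (k i))) / fact n))"
    if "finite S" for S
  proof -
    have "(\<Sum>k\<in>{1..n} \<rightarrow>\<^sub>E S. mps_coeff (in_x Z) (\<Sum>i=1..n. Poly_Mapping.single i (k i)))
        = mps_coeff ((h_perp_sum S 0 ^^ n) Z) 0" for n
      by (rule sum_mps_coeff_in_x[OF that]) (rule part)
    then show ?thesis using main[OF that assms(3)] by (simp only:)
  qed
  ultimately show ?thesis by blast
qed

end
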